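(* Let $n\ge2$. For any nonempty open set $\Omega\subseteq\mathbb{R}^n$ there is $u\in SBD(\Omega)\cap L^\infty(\Omega;\mathbb{R}^n)$ such that $e(u)=0$ $\mathcal{L}^n$-a.e., $\mathcal{H}^{n-1}(J_u)=\infty$, and $\nabla u\notin L^1(\Omega;\mathbb{R}^{n\times n})$. In particular $u\notin GBV(\Omega;\mathbb{R}^n)$.
   Context: $\mathcal{L}^n$ is Lebesgue measure, $\mathcal{H}^{n-1}$ is $(n-1)$-dimensional Hausdorff measure. $BD(\Omega):=\{u\in L^1(\Omega;\mathbb{R}^n): Eu\in\mathcal{M}(\Omega;\mathbb{R}^{n\times n}_{\mathrm{sym}})\}$, where $Eu:=(Du+Du^T)/2$ is the symmetrized distributional gradient and $\mathcal{M}$ denotes bounded Radon measures. For $u\in BD(\Omega)$, the jump set $J_u$ is the set of $x\in\Omega$ for which there are $u_+\ne u_-$ in $\mathbb{R}^n$ and $\nu\in S^{n-1}$ with $\lim_{r\to0}\frac1{\mathcal{L}^n(B_r)}\int_{B_r(x)\cap\{\pm(y-x)\cdot\nu>0\}}|u(y)-u_\pm|\,dy=0$; $[u]=u_+-u_-$. One has $Eu=e(u)\mathcal{L}^n+\frac{[u]\otimes\nu+\nu\otimes[u]}{2}\mathcal{H}^{n-1}\llcorner J_u+E^cu$, where $e(u)$ is the density of the absolutely continuous part of $Eu$ and the Cantor part $E^cu$ is the restriction to $\Omega\setminus J_u$ of the singular part of $Eu$. $SBD(\Omega):=\{u\in BD(\Omega):E^cu=0\}$. $\nabla u$ denotes the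 approximate gradient of $u$, which exists $\mathcal{L}^n$-a.e. for $u\in BD(\Omega)$. $GBV(\Omega;\mathbb{R}^n)$ is the set of measurable $w:\Omega\to\mathbb{R}^n$ such that $\phi(w)\in BV_{\mathrm{loc}}(\Omega)$ for all $\phi\in C^1(\mathbb{R}^n)$ such that $\nabla\phi$ has compact support. *)

theory Defs
  imports "HOL-Analysis.Analysis"
begin

text \<open>
  \<open>\<real>\<^sup>n\<close> is \<^typ>\<open>real^'n\<close>, so \<open>n = CARD('n)\<close>. A function on an open set \<open>\<Omega>\<close> is a
  total function whose values outside \<open>\<Omega>\<close> never matter.
\<close>


section \<open>Test functions\<close>

definition partial :: "'n \<Rightarrow> (real^'n \<Rightarrow> real) \<Rightarrow> real^'n \<Rightarrow> real" where
  "partial j f x = frechet_derivative f (at x) (axis j 1)"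

definition gradient :: "(real^'n \<Rightarrow> real) \<Rightarrow> real^'n \<Rightarrow> real^'n" where
  "gradient f x = (\<chi> j. partial j f x)"

text \<open>\<open>f \<in> C\<^sup>k(\<real>\<^sup>n)\<close>; differentiability at each order is Frechet differentiability.\<close>

primrec Ck :: "nat \<Rightarrow> (real^'n \<Rightarrow> real) \<Rightarrow> bool" where
  "Ck 0 f \<longleftrightarrow> continuous_on UNIV f"
| "Ck (Suc k) f \<longleftrightarrow> (\<forall>x. f differentiable (at x)) \<and> (\<forall>j. Ck k (partial j f))"

definition supp :: "('a::topological_space \<Rightarrow> 'b::zero) \<Rightarrow> 'a set" where
  "supp f = closure {x. f x \<noteq> 0}"

definition test_functions :: "(real^'n) set \<Rightarrow> (real^'n \<Rightarrow> real) set" where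
  "test_functions \<Omega> = {\<phi>. (\<forall>k. Ck k \<phi>) \<and> compact (supp \<phi>) \<and> supp \<phi> \<subseteq> \<Omega>}"


section \<open>Vector-valued bounded Radon measures\<close>

text \<open>
  For open \<open>\<Omega>\<close>, the Borel subsets of \<open>\<Omega>\<close> are \<open>sets (restrict_space borel \<Omega>)\<close>. A countably
  additive set function on them with values in a finite-dimensional space automatically has
  finite total variation and is Radon. Its values on all other sets are irrelevant.
\<close>

definition vector_measure_on ::
    "'a::topological_space set \<Rightarrow> ('a set \<Rightarrow> 'b::real_normed_vector) \<Rightarrow> bool" where
  "vector_measure_on \<Omega> \<mu> \<longleftrightarrow>
     (\<forall>A :: nat \<Rightarrow> 'a set. range A \<subseteq> sets (restrict_space borel \<Omega>) \<and> disjoint_family A \<longrightarrow>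
        (\<lambda>i. \<mu> (A i)) sums \<mu> (\<Union>i. A i))"

text \<open>
  \<open>\<integral> \<phi> d\<mu> = I\<close> for a real-valued \<open>\<mu>\<close>, written as a difference \<open>P - N\<close> of finite positive measures
  (for instance its Jordan decomposition). The value \<open>I\<close> does not depend on the choice of \<open>P\<close>, \<open>N\<close>.
\<close>

definition has_signed_integral ::
    "'a::topological_space set \<Rightarrow> ('a set \<Rightarrow> real) \<Rightarrow> ('a \<Rightarrow> real) \<Rightarrow> real \<Rightarrow> bool" where
  "has_signed_integral \<Omega> \<mu> \<phi> I \<longleftrightarrow>
     (\<exists>P N. finite_measure P \<and> finite_measure N \<and>
        sets P = sets (restrict_space borel \<Omega>) \<and> sets N = sets (restrict_space borel \<Omega>) \<and>
        (\<forall>A\<in>sets (restrict_space borel \<Omega>). \<mu> A = measure P A - measure N A) \<and>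
        integrable P \<phi> \<and> integrable N \<phi> \<and>
        I = (\<integral>x. \<phi> x \<partial>P) - (\<integral>x. \<phi> x \<partial>N))"

text \<open>
  Lebesgue decomposition \<open>\<mu> = e \<L>\<^sup>n + \<mu>s\<close>, where \<open>\<mu>s\<close> is concentrated on a Lebesgue null set.
  It determines \<open>\<mu>s\<close>, and \<open>e\<close> up to null sets.
\<close>

definition lebesgue_decomposition ::
    "'a::euclidean_space set \<Rightarrow> ('a set \<Rightarrow> 'b::euclidean_space) \<Rightarrow> ('a \<Rightarrow> 'b) \<Rightarrow>
     ('a set \<Rightarrow> 'b) \<Rightarrow> bool" where
  "lebesgue_decomposition \<Omega> \<mu> e \<mu>s \<longleftrightarrow>
     set_integrable lebesgue \<Omega> e \<and>
     vector_measure_on \<Omega> \<mu>s \<and>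
     (\<exists>S\<in>sets (restrict_space borel \<Omega>). S \<in> null_sets lebesgue \<and>
        (\<forall>A\<in>sets (restrict_space borel \<Omega>). A \<inter> S = {} \<longrightarrow> \<mu>s A = 0)) \<and>
     (\<forall>A\<in>sets (restrict_space borel \<Omega>). \<mu> A = (LINT x:A|lebesgue. e x) + \<mu>s A)"


section \<open>\<open>BD\<close>, the jump set and \<open>SBD\<close>\<close>

text \<open>
  \<open>is_Eu \<Omega> u \<mu>\<close>: the distribution \<open>Eu = (Du + Du\<^sup>T)/2\<close> on \<open>\<Omega>\<close> is the bounded Radon measure \<open>\<mu>\<close>
  with values in the symmetric matrices. Such a \<open>\<mu>\<close> is unique on the Borel subsets of \<open>\<Omega>\<close>.
\<close>

definition is_Eu ::
    "(real^'n) set \<Rightarrow> (real^'n \<Rightarrow> real^'n) \<Rightarrow> ((real^'n) set \<Rightarrow> real^'n^'n) \<Rightarrow> bool" where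
  "is_Eu \<Omega> u \<mu> \<longleftrightarrow>
     vector_measure_on \<Omega> \<mu> \<and>
     (\<forall>A\<in>sets (restrict_space borel \<Omega>). transpose (\<mu> A) = \<mu> A) \<and>
     (\<forall>\<phi>\<in>test_functions \<Omega>. \<forall>i j.
        has_signed_integral \<Omega> (\<lambda>A. \<mu> A $ i $ j) \<phi>
          (- (LINT x:\<Omega>|lebesgue. (u x $ i * partial j \<phi> x + u x $ j * partial i \<phi> x) / 2)))"

definition BD :: "(real^'n) set \<Rightarrow> (real^'n \<Rightarrow> real^'n) set" where
  "BD \<Omega> = {u. set_integrable lebesgue \<Omega> u \<and> (\<exists>\<mu>. is_Eu \<Omega> u \<mu>)}"

text \<open>
  One-sided approximate limit \<open>z\<close> at \<open>x\<close> in the half ball \<open>(y - x) \<bullet> \<nu> > 0\<close>; the other half ball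
  is obtained with \<open>- \<nu>\<close>.
\<close>

definition half_ball_limit ::
    "(real^'n \<Rightarrow> real^'n) \<Rightarrow> real^'n \<Rightarrow> real^'n \<Rightarrow> real^'n \<Rightarrow> bool" where
  "half_ball_limit u x \<nu> z \<longleftrightarrow>
     ((\<lambda>r. (LINT y:(ball x r \<inter> {y. (y - x) \<bullet> \<nu> > 0})|lebesgue. norm (u y - z))
             / measure lebesgue (ball x r)) \<longlongrightarrow> 0) (at_right 0)"

definition jump_set :: "(real^'n) set \<Rightarrow> (real^'n \<Rightarrow> real^'n) \<Rightarrow> (real^'n) set" where
  "jump_set \<Omega> u = {x\<in>\<Omega>. \<exists>up um \<nu>. up \<noteq> um \<and> norm \<nu> = 1 \<and>
     half_ball_limit u x \<nu> up \<and> half_ball_limit u x (- \<nu>) um}"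

text \<open>\<open>e(u)\<close>, which is determined up to null sets.\<close>

definition is_e :: "(real^'n) set \<Rightarrow> (real^'n \<Rightarrow> real^'n) \<Rightarrow> (real^'n \<Rightarrow> real^'n^'n) \<Rightarrow> bool" where
  "is_e \<Omega> u e \<longleftrightarrow> (\<exists>\<mu> \<mu>s. is_Eu \<Omega> u \<mu> \<and> lebesgue_decomposition \<Omega> \<mu> e \<mu>s)"

text \<open>
  The last conjunct says that the Cantor part, i.e. the restriction of the singular part \<open>\<mu>s\<close> of
  \<open>Eu\<close> to \<open>\<Omega> - J\<^sub>u\<close>, vanishes.
\<close>

definition SBD :: "(real^'n) set \<Rightarrow> (real^'n \<Rightarrow> real^'n) set" where
  "SBD \<Omega> = {u \<in> BD \<Omega>. \<exists>\<mu> e \<mu>s. is_Eu \<Omega> u \<mu> \<and> lebesgue_decomposition \<Omega> \<mu> e \<mu>s \<and>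
     (\<forall>A\<in>sets (restrict_space borel \<Omega>). A \<inter> jump_set \<Omega> u = {} \<longrightarrow> \<mu>s A = 0)}"

definition Linfty :: "'a::euclidean_space set \<Rightarrow> ('a \<Rightarrow> 'b::euclidean_space) set" where
  "Linfty \<Omega> = {u. u \<in> borel_measurable (lebesgue_on \<Omega>) \<and>
     (\<exists>C. AE x in lebesgue_on \<Omega>. norm (u x) \<le> C)}"


section \<open>Approximate gradient\<close>

text \<open>
  Approximate differentiability in the integral sense; \<open>z\<close> is then the approximate limit of \<open>u\<close>
  at \<open>x\<close>, and \<open>G\<close> is unique. The value \<open>0\<close> below is a convention for points where no approximate
  gradient exists; for functions in \<open>BD\<close> these form a null set.
\<close>

definition has_approx_gradient ::
    "(real^'n \<Rightarrow> real^'n) \<Rightarrow> real^'n^'n \<Rightarrow> real^'n \<Rightarrow> bool" where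
  "has_approx_gradient u G x \<longleftrightarrow>
     (\<exists>z. ((\<lambda>r. (LINT y:ball x r|lebesgue. norm (u y - z - G *v (y - x)) / r)
                   / measure lebesgue (ball x r)) \<longlongrightarrow> 0) (at_right 0))"

definition approx_gradient :: "(real^'n \<Rightarrow> real^'n) \<Rightarrow> real^'n \<Rightarrow> real^'n^'n" where
  "approx_gradient u x =
     (if \<exists>G. has_approx_gradient u G x then THE G. has_approx_gradient u G x else 0)"


section \<open>Hausdorff measure\<close>

text \<open>
  The normalising constant makes the \<open>n\<close>-dimensional Hausdorff measure on \<open>\<real>\<^sup>n\<close> agree with Lebesgue
  measure. Boundedness is required since \<^const>\<open>diameter\<close> is meaningless for unbounded sets; the
  empty set is treated separately because \<open>0 ^ 0 = 1\<close>.
\<close>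

definition hausdorff_content :: "nat \<Rightarrow> real \<Rightarrow> 'a::metric_space set \<Rightarrow> ennreal" where
  "hausdorff_content k \<delta> A =
     (INF C \<in> {C :: nat \<Rightarrow> 'a set. A \<subseteq> (\<Union>i. C i) \<and> (\<forall>i. bounded (C i) \<and> diameter (C i) \<le> \<delta>)}.
        \<Sum>i. if C i = {} then 0
             else ennreal (unit_ball_vol (real k) * (diameter (C i) / 2) ^ k))"

definition hausdorff_measure :: "nat \<Rightarrow> 'a::metric_space set \<Rightarrow> ennreal" where
  "hausdorff_measure k A = (SUP \<delta> \<in> {0<..}. hausdorff_content k \<delta> A)"


section \<open>\<open>BV\<close> and \<open>GBV\<close>\<close>

definition BV :: "(real^'n) set \<Rightarrow> (real^'n \<Rightarrow> real) set" where
  "BV \<Omega> = {v. set_integrable lebesgue \<Omega> v \<and>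
     (\<exists>\<mu> :: (real^'n) set \<Rightarrow> real^'n. vector_measure_on \<Omega> \<mu> \<and>
        (\<forall>\<phi>\<in>test_functions \<Omega>. \<forall>i.
           has_signed_integral \<Omega> (\<lambda>A. \<mu> A $ i) \<phi> (- (LINT x:\<Omega>|lebesgue. v x * partial i \<phi> x))))}"

definition BV_loc :: "(real^'n) set \<Rightarrow> (real^'n \<Rightarrow> real) set" where
  "BV_loc \<Omega> = {v. \<forall>U. open U \<and> compact (closure U) \<and> closure U \<subseteq> \<Omega> \<longrightarrow> v \<in> BV U}"

definition GBV :: "(real^'n) set \<Rightarrow> (real^'n \<Rightarrow> real^'n) set" where
  "GBV \<Omega> = {w. w \<in> borel_measurable (lebesgue_on \<Omega>) \<and>
     (\<forall>\<phi>. Ck 1 \<phi> \<and> compact (supp (gradient \<phi>)) \<longrightarrow> (\<lambda>x. \<phi> (w x)) \<in> BV_loc \<Omega>)}"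

end

theory Submission
  imports Defs
begin

text \<open>
  Take \<open>u = f e\<^sub>p + g e\<^sub>q\<close> with \<open>f\<close>, \<open>g\<close> piecewise affine on boxes. On each box only the slopes
  \<open>b = \<partial>\<^sub>q f\<close> and \<open>c = \<partial>\<^sub>p g\<close> are nonzero, and \<open>u\<close> is rigid there exactly when \<open>b + c = 0\<close>. A box with
  slopes \<open>0 \<le> b \<le> c\<close> is cut into thin slabs orthogonal to \<open>e\<^sub>q\<close>. In half of each slab \<open>b\<close> is
  replaced by \<open>- c\<close>, which is rigid, and in the other half by \<open>2 b + c\<close>. This adds a small continuous
  sawtooth to \<open>f\<close>, so that new jumps arise only on the lateral boundary and are as small as we like.
  The defect \<open>(b + c)\<close> times volume is preserved, while the rigid half contributes at least
  \<open>(b + c) / 4\<close> times volume to \<open>\<integral> |\<nabla>u|\<close>. Exchanging the roles of \<open>f\<close> and \<open>g\<close> and repeating \<open>k\<close>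
  times gives a function with \<open>\<integral> |\<nabla>u|\<close> of order \<open>k\<close> times the initial defect. The remaining defect
  is then turned into jumps of the same total mass. Hence there are rigid pieces with arbitrarily
  small jump mass and \<open>\<integral> |\<nabla>u| \<ge> 1\<close> on any box. They are placed on boxes accumulating at a
  hyperplane, next to constants of alternating sign on slabs, whose common faces have infinite total
  area.
\<close>

section \<open>Boxes, pieces and their jumps\<close>

text \<open>The obstacle: turning an affine function directly into rigid pieces costs jumps of the
  same order as the gradient produced, while the ratio of the two must become arbitrarily large.
  This is the failure of Korn's inequality in \<open>L^1\<close>, and the oscillation used is a
  laminate. The slopes \<open>- c\<close> and \<open>2 b + c\<close> have mean \<open>b\<close>, and
  the gradients of the two halves differ by a rank-one matrix compatible with the cut, so the
  perturbation is a tent that vanishes at both ends of the slab. It is the smaller slope that is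
  replaced: the rigid half keeps the slope \<open>c\<close>, at least half of the defect, and the
  other half has slopes \<open>c \<le> 2 b + c\<close>, which is the initial situation with
  \<open>p\<close> and \<open>q\<close> exchanged. Only the last step pays for the defect, whatever
  the number of steps. All boxes lie in one compact box inside \<Omega>, so integrability already
  fails on a compact set; since \<open>u\<close> is bounded by 1, a truncation leaves it unchanged
  and \<open>BV_loc\<close> fails too. The signs of the constants alternate so that the jumps across
  common faces add up, at a summable cost.\<close>

definition upd :: "real^'n \<Rightarrow> 'n \<Rightarrow> real \<Rightarrow> real^'n" where
  "upd x k t = (\<chi> j. if j = k then t else x $ j)"

text \<open>Half-open, so that cutting at a coordinate value gives two disjoint boxes whose union is
  the original one, with no exceptional face.\<close>

definition hbox :: "real^'n \<Rightarrow> real^'n \<Rightarrow> (real^'n) set" where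
  "hbox l u = {x. \<forall>j. l $ j \<le> x $ j \<and> x $ j < u $ j}"

definition vol :: "real^'n \<Rightarrow> real^'n \<Rightarrow> real" where
  "vol l u = (\<Prod>j\<in>UNIV. u $ j - l $ j)"

definition area :: "'n \<Rightarrow> real^'n \<Rightarrow> real^'n \<Rightarrow> real" where
  "area k l u = (\<Prod>j\<in>UNIV - {k}. u $ j - l $ j)"

definition strip :: "'n \<Rightarrow> (real^'n) set" where
  "strip k = {x. 0 \<le> x $ k \<and> x $ k < 1}"

text \<open>The cylinder over a face orthogonal to axis \<open>k\<close>: membership in
  \<open>hbox l u\<close> with the \<open>k\<close>-th coordinate ignored.\<close>

definition side :: "'n \<Rightarrow> real^'n \<Rightarrow> real^'n \<Rightarrow> real^'n \<Rightarrow> bool" where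
  "side k l u y \<longleftrightarrow> (\<forall>j. j \<noteq> k \<longrightarrow> l $ j \<le> y $ j \<and> y $ j < u $ j)"

text \<open>\<open>(l, u, G, d)\<close> stands for \<open>x \<mapsto> G *v x + d\<close> on \<open>hbox l u\<close>, extended by \<open>0\<close>.\<close>

type_synonym 'n piece = "(real^'n) \<times> (real^'n) \<times> (real^'n^'n) \<times> (real^'n)"

fun piece_ev :: "real^'n \<Rightarrow> ('n::finite) piece \<Rightarrow> real^'n" where
  "piece_ev x (l, u, G, d) = indicat_real (hbox l u) x *\<^sub>R (G *v x + d)"

text \<open>The limit from \<open>x $ k > y $ k\<close> minus the limit from \<open>x $ k < y $ k\<close>, at points \<open>y\<close> in general position.\<close>

fun piece_jump :: "'n \<Rightarrow> real^'n \<Rightarrow> ('n::finite) piece \<Rightarrow> real^'n" where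
  "piece_jump k y (l, u, G, d) =
     ((of_bool (y $ k = l $ k) - of_bool (y $ k = u $ k)) * of_bool (side k l u y)) *\<^sub>R (G *v y + d)"

definition ev :: "('n::finite) piece list \<Rightarrow> real^'n \<Rightarrow> real^'n" where
  "ev F x = (\<Sum>P\<leftarrow>F. piece_ev x P)"

definition jump :: "('n::finite) piece list \<Rightarrow> 'n \<Rightarrow> real^'n \<Rightarrow> real^'n" where
  "jump F k y = (\<Sum>P\<leftarrow>F. piece_jump k y P)"

text \<open>The surface measure on the hyperplane \<open>x $ k = t\<close> is the image under \<open>x \<mapsto> upd x k t\<close> of
  Lebesgue measure on the strip of unit thickness \<open>0 \<le> x $ k < 1\<close>.\<close>

definition jump_mass :: "('n::finite) piece list \<Rightarrow> ennreal" where
  "jump_mass F = (\<Sum>k\<in>UNIV. \<integral>\<^sup>+t. (\<integral>\<^sup>+x. indicator (strip k) x *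
      ennreal (norm (jump F k (upd x k t))) \<partial>lborel) \<partial>count_space UNIV)"

lemma upd_nth [simp]: "upd x k t $ j = (if j = k then t else x $ j)"
  by (simp add: upd_def)

lemma upd_self [simp]: "upd x k (x $ k) = x"
  by (simp add: vec_eq_iff)

lemma upd_upd [simp]: "upd (upd x k s) k t = upd x k t"
  by (simp add: vec_eq_iff)

lemma side_upd [simp]: "side k l u (upd y k t) = side k l u y"
  by (simp add: side_def)

lemma ev_simps [simp]: "ev [] x = 0" "ev (P # F) x = piece_ev x P + ev F x"
  "ev (F @ F') x = ev F x + ev F' x"
  by (simp_all add: ev_def)

lemma jump_simps [simp]: "jump [] k y = 0" "jump (P # F) k y = piece_jump k y P + jump F k y"
  "jump (F @ F') k y = jump F k y + jump F' k y"
  by (simp_all add: jump_def)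

lemma hbox_side: "x \<in> hbox l u \<longleftrightarrow> side k l u x \<and> l $ k \<le> x $ k \<and> x $ k < u $ k"
  by (auto simp: hbox_def side_def)

lemma vol_area: "vol l u = area k l u * (u $ k - l $ k)"
proof -
  have "vol l u = (u $ k - l $ k) * area k l u"
    unfolding vol_def area_def by (rule prod.remove) auto
  then show ?thesis by simp
qed

lemma area_upd [simp]: "area k (upd l k s) (upd u k t) = area k l u"
  "area k (upd l k s) u = area k l u" "area k l (upd u k t) = area k l u"
  unfolding area_def by (auto intro!: prod.cong)

lemma vol_upd: "vol (upd l k s) (upd u k t) = area k l u * (t - s)"
  by (simp add: vol_area[of _ _ k])

lemma vol_pos: "(\<And>j. l $ j < u $ j) \<Longrightarrow> 0 < vol l u"
  unfolding vol_def by (rule prod_pos) auto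

lemma area_pos: "(\<And>j. l $ j < u $ j) \<Longrightarrow> 0 < area k l u"
  unfolding area_def by (rule prod_pos) auto

lemma strip_measurable [measurable]: "strip k \<in> sets borel"
  unfolding strip_def by measurable

lemma hbox_measurable [measurable]: "hbox l u \<in> sets borel"
proof -
  have "hbox l u = (\<Inter>j. {x. l $ j \<le> x $ j \<and> x $ j < u $ j})"
    by (auto simp: hbox_def)
  also have "\<dots> \<in> sets borel"
    by (rule sets.finite_INT) auto
  finally show ?thesis .
qed

lemma emeasure_cbox_vol:
  assumes "\<And>j. l $ j \<le> u $ j"
  shows "emeasure lborel (cbox l (u::real^'n)) = ennreal (vol l u)"
    and "emeasure lborel (box l u) = ennreal (vol l u)"
proof -
  have *: "(\<Prod>b\<in>Basis. (u - l) \<bullet> b) = vol l u"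
    by (simp add: Basis_vec_def vol_def UNION_singleton_eq_range
        prod.reindex inj_on_def axis_eq_axis inner_axis)
  have le: "l \<bullet> b \<le> u \<bullet> b" if "b \<in> Basis" for b
    using that assms by (auto simp: Basis_vec_def inner_axis)
  show "emeasure lborel (cbox l u) = ennreal (vol l u)"
    by (subst emeasure_lborel_cbox) (use le * in auto)
  show "emeasure lborel (box l u) = ennreal (vol l u)"
    by (subst emeasure_lborel_box) (use le * in auto)
qed

lemma emeasure_hbox:
  assumes "\<And>j. l $ j \<le> u $ j"
  shows "emeasure lborel (hbox l u) = ennreal (vol l u)"
proof (rule antisym)
  have "emeasure lborel (hbox l u) \<le> emeasure lborel (cbox l u)"
    by (rule emeasure_mono) (auto simp: hbox_def mem_box_cart less_imp_le)
  then show "emeasure lborel (hbox l u) \<le> ennreal (vol l u)"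
    using emeasure_cbox_vol(1)[OF assms] by simp
  have "emeasure lborel (box l u) \<le> emeasure lborel (hbox l u)"
    by (rule emeasure_mono) (auto simp: hbox_def mem_box_cart less_imp_le)
  then show "ennreal (vol l u) \<le> emeasure lborel (hbox l u)"
    using emeasure_cbox_vol(2)[OF assms] by simp
qed

text \<open>Inside the strip the cylinder over a face becomes a box of unit height, whose volume is
  the area of the face.\<close>

lemma nn_integral_side:
  assumes "\<And>j. l $ j \<le> u $ j"
  shows "(\<integral>\<^sup>+x. indicator (strip k) x * indicator {y. side k l u y} x \<partial>lborel)
     = ennreal (area k l u)"
proof -
  have "indicator (strip k) x * indicator {y. side k l u y} x
      = (indicator (hbox (upd l k 0) (upd u k 1)) x :: ennreal)" for x
    by (auto simp: indicator_def strip_def hbox_def side_def)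
  then show ?thesis
    using assms by (simp add: emeasure_hbox vol_upd)
qed

lemma upd_continuous: "continuous_on S (\<lambda>x. upd x k t)"
proof -
  have "continuous_on S (\<lambda>x. if j = k then t else x $ j)" for j
    by (cases "j = k") (auto intro: continuous_intros)
  then show ?thesis
    unfolding upd_def by (intro continuous_on_vec_lambda)
qed

lemma upd_measurable [measurable]: "(\<lambda>x. upd x k t) \<in> borel \<rightarrow>\<^sub>M borel"
  by (rule borel_measurable_continuous_onI) (rule upd_continuous)

lemma matrix_measurable [measurable]: "(\<lambda>x. (G::real^'n^'m) *v x) \<in> borel \<rightarrow>\<^sub>M borel"
  by (intro borel_measurable_continuous_onI linear_continuous_on matrix_vector_mul_bounded_linear)

lemma side_measurable [measurable]: "Measurable.pred borel (side k l u)"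
proof -
  have "Measurable.pred borel (\<lambda>y::real^'a. \<forall>j\<in>UNIV. j \<noteq> k \<longrightarrow> l $ j \<le> y $ j \<and> y $ j < u $ j)"
    by (rule pred_intros_finite) auto
  then show ?thesis
    by (simp add: side_def[abs_def])
qed

lemma piece_ev_measurable [measurable]: "(\<lambda>x. piece_ev x P) \<in> borel \<rightarrow>\<^sub>M borel"
  by (cases P) simp

lemma piece_jump_measurable [measurable]: "(\<lambda>x. piece_jump k x P) \<in> borel \<rightarrow>\<^sub>M borel"
  by (cases P) simp

lemma ev_measurable [measurable]: "ev F \<in> borel \<rightarrow>\<^sub>M borel"
  unfolding ev_def by (induction F) auto

lemma jump_measurable [measurable]: "jump F k \<in> borel \<rightarrow>\<^sub>M borel"
  unfolding jump_def by (induction F) auto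

text \<open>Stated through norms of jumps and not through concatenation, so that it also covers
  lists in which a piece and its negative, or the two halves of a cut box, cancel.\<close>

lemma jump_mass_triangle:
  assumes "\<And>k y. norm (jump F k y) \<le> norm (jump F1 k y) + norm (jump F2 k y)"
  shows "jump_mass F \<le> jump_mass F1 + jump_mass F2"
proof -
  let ?I = "\<lambda>k x. indicator (strip k) x :: ennreal"
  have "jump_mass F \<le> (\<Sum>k\<in>UNIV. \<integral>\<^sup>+t. (\<integral>\<^sup>+x. ?I k x * ennreal (norm (jump F1 k (upd x k t)))
      + ?I k x * ennreal (norm (jump F2 k (upd x k t))) \<partial>lborel) \<partial>count_space UNIV)"
    unfolding jump_mass_def
  proof (intro sum_mono nn_integral_mono)
    fix k t x
    show "?I k x * ennreal (norm (jump F k (upd x k t)))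
      \<le> ?I k x * ennreal (norm (jump F1 k (upd x k t))) + ?I k x * ennreal (norm (jump F2 k (upd x k t)))"
      using assms[of k "upd x k t"]
      by (auto simp: indicator_def simp flip: ennreal_plus)
  qed
  also have "\<dots> = jump_mass F1 + jump_mass F2"
    unfolding jump_mass_def by (simp add: nn_integral_add sum.distrib)
  finally show ?thesis .
qed

text \<open>For jumps confined to the faces of a single box; the factor 2 counts the two opposite
  faces orthogonal to each axis.\<close>

lemma jump_mass_bound:
  assumes lu: "\<And>j. l $ j < u $ j" and M: "\<And>k. 0 \<le> M k"
    and le: "\<And>k y. norm (jump F k y) \<le> M k * ((of_bool (y $ k = l $ k) + of_bool (y $ k = u $ k)) * of_bool (side k l u y))"
  shows "jump_mass F \<le> ennreal (\<Sum>k\<in>UNIV. 2 * M k * area k l u)"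
proof -
  let ?I = "\<lambda>k x. indicator (strip k) x :: ennreal"
  have a: "0 \<le> area k l u" for k using area_pos[OF lu, of k] by simp
  have "jump_mass F \<le> (\<Sum>k\<in>UNIV. \<integral>\<^sup>+t. ennreal (M k * area k l u) * (indicator {l $ k} t + indicator {u $ k} t) \<partial>count_space UNIV)"
    unfolding jump_mass_def
  proof (intro sum_mono nn_integral_mono)
    fix k t
    have "(\<integral>\<^sup>+x. ?I k x * ennreal (norm (jump F k (upd x k t))) \<partial>lborel)
       \<le> (\<integral>\<^sup>+x. (ennreal (M k) * (indicator {l $ k} t + indicator {u $ k} t)) * (?I k x * indicator {y. side k l u y} x) \<partial>lborel)"
    proof (rule nn_integral_mono)
      fix x
      have "ennreal (norm (jump F k (upd x k t))) \<le> ennreal (M k * ((of_bool (t = l $ k) + of_bool (t = u $ k)) * of_bool (side k l u x)))"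
        using le[of k "upd x k t"] by (intro ennreal_leI) simp
      also have "\<dots> = ennreal (M k) * (indicator {l $ k} t + indicator {u $ k} t) * indicator {y. side k l u y} x"
        using M[of k] by (auto simp: indicator_def ennreal_mult' simp flip: ennreal_numeral)
      finally show "?I k x * ennreal (norm (jump F k (upd x k t))) \<le> (ennreal (M k) * (indicator {l $ k} t + indicator {u $ k} t)) * (?I k x * indicator {y. side k l u y} x)"
        by (auto simp: indicator_def)
    qed
    also have "\<dots> = (ennreal (M k) * (indicator {l $ k} t + indicator {u $ k} t)) * ennreal (area k l u)"
      using lu by (subst nn_integral_cmult) (simp_all add: nn_integral_side less_imp_le)
    also have "\<dots> = ennreal (M k * area k l u) * (indicator {l $ k} t + indicator {u $ k} t)"
      using M a by (simp add: ennreal_mult mult_ac)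
    finally show "(\<integral>\<^sup>+x. ?I k x * ennreal (norm (jump F k (upd x k t))) \<partial>lborel) \<le> \<dots>" .
  qed
  also have "\<dots> = (\<Sum>k\<in>UNIV. ennreal (2 * M k * area k l u))"
  proof (rule sum.cong)
    fix k :: 'a
    have "(\<integral>\<^sup>+t. ennreal (M k * area k l u) * (indicator {l $ k} t + indicator {u $ k} t) \<partial>count_space UNIV)
      = ennreal (M k * area k l u) * (1 + 1)"
      by (subst nn_integral_cmult) (simp_all add: nn_integral_add one_add_one del: one_add_one)
    also have "\<dots> = ennreal (2 * M k * area k l u)"
      using M a by (simp add: ennreal_mult mult_ac flip: ennreal_numeral)
    finally show "(\<integral>\<^sup>+t. ennreal (M k * area k l u) * (indicator {l $ k} t + indicator {u $ k} t) \<partial>count_space UNIV) = \<dots>" .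
  qed simp
  also have "\<dots> = ennreal (\<Sum>k\<in>UNIV. 2 * M k * area k l u)"
    using M a by (simp add: sum_ennreal)
  finally show ?thesis .
qed

section \<open>The staircase construction\<close>

definition munit :: "'n \<Rightarrow> 'n \<Rightarrow> real^'n^'n" where
  "munit p q = (\<chi> i j. of_bool (i = p \<and> j = q))"

text \<open>For \<open>p \<noteq> q\<close> these are the multiples of the infinitesimal rotation in
  the plane of \<open>p\<close> and \<open>q\<close>; affine maps with such a gradient have
  vanishing symmetrized gradient.\<close>

definition rigid :: "'n \<Rightarrow> 'n \<Rightarrow> real^'n^'n \<Rightarrow> bool" where
  "rigid p q G \<longleftrightarrow> (\<exists>w. G = w *\<^sub>R (munit p q - munit q p))"

fun dom_box :: "('n::finite) piece \<Rightarrow> (real^'n) set" where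
  "dom_box (l, u, G, d) = hbox l u"

text \<open>The relation is symmetric, so \<open>sorted_wrt\<close> expresses disjointness for any
  two positions of the list.\<close>

abbreviation disjoint_pieces :: "('n::finite) piece list \<Rightarrow> bool" where
  "disjoint_pieces \<equiv> sorted_wrt (\<lambda>P P'. dom_box P \<inter> dom_box P' = {})"

definition sub_box :: "real^'n \<Rightarrow> real^'n \<Rightarrow> ('n::finite) piece \<Rightarrow> bool" where
  "sub_box l u P \<longleftrightarrow> (case P of (l', u', G, d) \<Rightarrow> \<forall>j. l $ j \<le> l' $ j \<and> l' $ j < u' $ j \<and> u' $ j \<le> u $ j)"

text \<open>For disjoint pieces this is the integral of the modulus of the derivative of component
  \<open>p\<close> in direction \<open>q\<close>, a lower bound for the integral of the gradient
  norm.\<close>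

definition gain :: "'n \<Rightarrow> 'n \<Rightarrow> ('n::finite) piece list \<Rightarrow> real" where
  "gain p q F = (\<Sum>(l, u, G, d)\<leftarrow>F. \<bar>G $ p $ q\<bar> * vol l u)"

text \<open>The affine function \<open>G *v x + d\<close> on a box is replaced by a piecewise rigid one; \<open>m\<close> bounds the
  jumps created, including those on the boundary of the box.\<close>

definition rigid_approx :: "'n \<Rightarrow> 'n \<Rightarrow> real^'n \<Rightarrow> real^'n \<Rightarrow> real^'n^'n \<Rightarrow> real^'n \<Rightarrow> real \<Rightarrow> real \<Rightarrow> real
    \<Rightarrow> ('n::finite) piece list \<Rightarrow> bool" where
  "rigid_approx p q l u G d e m g F \<longleftrightarrow>
     (\<forall>P\<in>set F. sub_box l u P) \<and> (\<forall>(l', u', G', d')\<in>set F. rigid p q G') \<and>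
     disjoint_pieces F \<and>
     (\<forall>x\<in>hbox l u. norm (ev F x - (G *v x + d)) \<le> e) \<and>
     jump_mass (F @ [(l, u, - G, - d)]) \<le> ennreal m \<and> g \<le> gain p q F"

lemma munit_mult [simp]: "munit p q *v x = axis p (x $ q)"
proof -
  have "(\<Sum>j\<in>UNIV. of_bool (i = p \<and> j = q) * x $ j) = axis p (x $ q) $ i" for i
    by (cases "i = p") (auto simp: axis_def of_bool_def if_distrib[of "\<lambda>z. z * _"] sum.delta cong: if_cong)
  then show ?thesis
    by (simp add: matrix_vector_mult_def munit_def vec_eq_iff)
qed

lemma rigid_swap: "rigid p q G \<longleftrightarrow> rigid q p G"
proof -
  have "rigid q p G" if "rigid p q G" for p q
  proof -
    from that obtain w where "G = w *\<^sub>R (munit p q - munit q p)"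
      by (auto simp: rigid_def)
    then have "G = (- w) *\<^sub>R (munit q p - munit p q)"
      by (simp add: scaleR_diff_right)
    then show ?thesis unfolding rigid_def by blast
  qed
  then show ?thesis by blast
qed

lemma munit_nth [simp]: "munit p q $ i $ j = of_bool (i = p \<and> j = q)"
  by (simp add: munit_def)

lemma rigid_skew:
  assumes "rigid p q G"
  shows "G $ i $ j = - G $ j $ i"
proof -
  obtain w where "G = w *\<^sub>R (munit p q - munit q p)"
    using assms by (auto simp: rigid_def)
  then have "G $ i $ j = w * (of_bool (i = p \<and> j = q) - of_bool (i = q \<and> j = p))"
    "G $ j $ i = w * (of_bool (j = p \<and> i = q) - of_bool (j = q \<and> i = p))"
    by auto
  then show ?thesis by (simp only: conj_commute) (simp add: algebra_simps)
qed

lemma gain_simps [simp]: "gain p q [] = 0"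
  "gain p q ((l, u, G, d) # F) = \<bar>G $ p $ q\<bar> * vol l u + gain p q F"
  "gain p q (F @ F') = gain p q F + gain p q F'"
  by (simp_all add: gain_def)

lemma gain_swap:
  "\<forall>(l, u, G, d)\<in>set F. rigid p q G \<Longrightarrow> gain q p F = gain p q F"
proof (induction F)
  case (Cons P F)
  obtain l u G d where P: "P = (l, u, G, d)" by (cases P)
  have "\<bar>G $ q $ p\<bar> = \<bar>G $ p $ q\<bar>"
    using Cons.prems rigid_skew[of p q G q p] by (simp add: P)
  then show ?case using Cons by (simp add: P)
qed simp

text \<open>For skew gradients the entries at \<open>p q\<close> and \<open>q p\<close> have the
  same modulus, so the gain does not see the exchange. Every step of the induction in
  \<open>staircase\<close> swaps the two roles.\<close>

lemma rigid_approx_swap: "rigid_approx p q l u G d e m g F \<Longrightarrow> rigid_approx q p l u G d e m g F"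
  by (auto simp: rigid_approx_def gain_swap rigid_swap[of q p])

lemma sub_box_dom: "sub_box l u P \<Longrightarrow> dom_box P \<subseteq> hbox l u"
  by (cases P) (fastforce simp: sub_box_def hbox_def intro: order.trans less_le_trans)

lemma piece_ev_outside: "x \<notin> dom_box P \<Longrightarrow> piece_ev x P = 0"
  by (cases P) auto

lemma ev_outside: "\<forall>P\<in>set F. sub_box l u P \<Longrightarrow> x \<notin> hbox l u \<Longrightarrow> ev F x = 0"
proof (induction F)
  case (Cons P F)
  then show ?case
    using sub_box_dom[of l u P] piece_ev_outside[of x P] by auto
qed simp

section \<open>Cutting boxes and gluing approximations\<close>

lemma side_upd_box [simp]: "side k (upd l k s) u y = side k l u y" "side k l (upd u k s) y = side k l u y"
  by (auto simp: side_def)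

lemma hbox_split:
  assumes "l $ q \<le> s" "s \<le> u $ q"
  shows "hbox l (upd u q s) = {x \<in> hbox l u. x $ q < s}"
    and "hbox (upd l q s) u = {x \<in> hbox l u. s \<le> x $ q}"
  using assms by (auto simp: hbox_side[where k=q])

lemma side_split:
  assumes "l $ q < s" "s < u $ q"
  shows "side k l (upd u q s) y \<longleftrightarrow> side k l u y \<and> (k \<noteq> q \<longrightarrow> y $ q < s)"
    and "side k (upd l q s) u y \<longleftrightarrow> side k l u y \<and> (k \<noteq> q \<longrightarrow> s \<le> y $ q)"
proof -
  have "l $ j \<le> y $ j \<and> y $ j < upd u q s $ j \<longleftrightarrow> (l $ j \<le> y $ j \<and> y $ j < u $ j) \<and> (j = q \<longrightarrow> y $ q < s)" for j
    using assms by (cases "j = q") auto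
  then show "side k l (upd u q s) y \<longleftrightarrow> side k l u y \<and> (k \<noteq> q \<longrightarrow> y $ q < s)"
    unfolding side_def by metis
  have "upd l q s $ j \<le> y $ j \<and> y $ j < u $ j \<longleftrightarrow> (l $ j \<le> y $ j \<and> y $ j < u $ j) \<and> (j = q \<longrightarrow> s \<le> y $ q)" for j
    using assms by (cases "j = q") auto
  then show "side k (upd l q s) u y \<longleftrightarrow> side k l u y \<and> (k \<noteq> q \<longrightarrow> s \<le> y $ q)"
    unfolding side_def by metis
qed

lemma sub_box_trans:
  assumes "sub_box l' u' P" "\<And>j. l $ j \<le> l' $ j" "\<And>j. u' $ j \<le> u $ j"
  shows "sub_box l u P"
  using assms by (cases P) (auto simp: sub_box_def intro: order.trans)

lemma uminus_matrix_mult: "(- G) *v x = - ((G::real^'n^'m) *v x)"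
  by (simp add: matrix_vector_mult_def vec_eq_iff sum_negf)

text \<open>Both halves carry the same affine map, and their contributions on the cutting face have
  opposite signs.\<close>

lemma jump_bisect:
  assumes "l $ q < s" "s < u $ q"
  shows "piece_jump k y (l, upd u q s, G, d) + piece_jump k y (upd l q s, u, G, d) = piece_jump k y (l, u, G, d)"
  using assms by (auto simp: side_split of_bool_def)

lemma piece_jump_uminus: "piece_jump k y (l, u, - G, - d) = - piece_jump k y (l, u, G, d)"
  by (simp add: uminus_matrix_mult algebra_simps)

text \<open>The jump bound concerns \<open>F\<close> minus its target, the latter extended by
  \<open>0\<close>. The targets on the two halves recombine by \<open>jump_bisect\<close>, so the
  bounds simply add.\<close>

lemma rigid_approx_merge:
  assumes s: "l $ q < s" "s < u $ q"
    and 1: "rigid_approx p q' l (upd u q s) G d e m1 g1 F1"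
    and 2: "rigid_approx p q' (upd l q s) u G d e m2 g2 F2" and m: "0 \<le> m1" "0 \<le> m2"
  shows "rigid_approx p q' l u G d e (m1 + m2) (g1 + g2) (F1 @ F2)"
proof -
  note split = hbox_split[OF less_imp_le[OF s(1)] less_imp_le[OF s(2)]]
  have s1: "\<forall>P\<in>set F1. sub_box l (upd u q s) P" and s2: "\<forall>P\<in>set F2. sub_box (upd l q s) u P"
    using 1 2 by (auto simp: rigid_approx_def)
  have sub1: "sub_box l u P" if "P \<in> set F1" for P
    using s1 that s by (intro sub_box_trans[of l "upd u q s" P l u]) auto
  have sub2: "sub_box l u P" if "P \<in> set F2" for P
    using s2 that s by (intro sub_box_trans[of "upd l q s" u P l u]) auto
  have disj: "dom_box P \<inter> dom_box P' = {}" if "P \<in> set F1" "P' \<in> set F2" for P P'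
    using sub_box_dom[of l "upd u q s" P] sub_box_dom[of "upd l q s" u P'] s1 s2 that
    unfolding split by force
  have ev: "norm (ev (F1 @ F2) x - (G *v x + d)) \<le> e" if x: "x \<in> hbox l u" for x
  proof (cases "x $ q < s")
    case True
    then have "ev F2 x = 0" by (intro ev_outside[OF s2]) (auto simp: split)
    then show ?thesis using 1 x True by (auto simp: rigid_approx_def split)
  next
    case False
    then have "ev F1 x = 0" by (intro ev_outside[OF s1]) (auto simp: split)
    then show ?thesis using 2 x False by (auto simp: rigid_approx_def split)
  qed
  have "jump_mass ((F1 @ F2) @ [(l, u, - G, - d)])
      \<le> jump_mass (F1 @ [(l, upd u q s, - G, - d)]) + jump_mass (F2 @ [(upd l q s, u, - G, - d)])"
  proof (rule jump_mass_triangle)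
    fix k y
    have "jump ((F1 @ F2) @ [(l, u, - G, - d)]) k y
       = jump (F1 @ [(l, upd u q s, - G, - d)]) k y + jump (F2 @ [(upd l q s, u, - G, - d)]) k y"
      using jump_bisect[OF s, of k y "- G" "- d"] by (simp del: piece_jump.simps)
    then show "norm (jump ((F1 @ F2) @ [(l, u, - G, - d)]) k y)
      \<le> norm (jump (F1 @ [(l, upd u q s, - G, - d)]) k y) + norm (jump (F2 @ [(upd l q s, u, - G, - d)]) k y)"
      by (metis norm_triangle_ineq)
  qed
  also have "\<dots> \<le> ennreal m1 + ennreal m2"
    using 1 2 by (intro add_mono) (auto simp: rigid_approx_def)
  also have "\<dots> = ennreal (m1 + m2)" using m by simp
  finally show ?thesis
    using 1 2 sub1 sub2 disj ev unfolding rigid_approx_def sorted_wrt_append by auto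
qed

lemma vol_split: "vol l (upd u q s) + vol (upd l q s) u = vol l u"
  by (simp add: vol_area[of _ _ q] flip: distrib_left)

text \<open>Repeated bisection orthogonal to axis \<open>q\<close> reduces the claim to slabs that
  are thinner by the factor \<open>2 ^ N\<close>. Jump bound and gain are proportional to the
  volume, so they pass from the slabs to the whole box without loss.\<close>

lemma rigid_approx_slabs:
  assumes "\<And>j. l $ j < u $ j" "0 \<le> m"
    and "\<And>l' u'. (\<And>j. l' $ j < u' $ j) \<Longrightarrow> (\<And>j. j \<noteq> q \<Longrightarrow> l' $ j = l $ j \<and> u' $ j = u $ j) \<Longrightarrow>
      u' $ q - l' $ q = (u $ q - l $ q) / 2 ^ N \<Longrightarrow> \<exists>F. rigid_approx p q' l' u' G d e (m * vol l' u') (g * vol l' u') F"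
  shows "\<exists>F. rigid_approx p q' l u G d e (m * vol l u) (g * vol l u) F"
  using assms
proof (induction N arbitrary: l u)
  case 0
  then show ?case by simp
next
  case (Suc N)
  define s where "s = (l $ q + u $ q) / 2"
  have s: "l $ q < s" "s < u $ q" using Suc.prems(1)[of q] by (auto simp: s_def)
  have "\<exists>F. rigid_approx p q' l (upd u q s) G d e (m * vol l (upd u q s)) (g * vol l (upd u q s)) F"
    by (rule Suc.IH) (use Suc.prems s in \<open>auto intro!: Suc.prems(3) simp: s_def field_simps\<close>)
  moreover have "\<exists>F. rigid_approx p q' (upd l q s) u G d e (m * vol (upd l q s) u) (g * vol (upd l q s) u) F"
    by (rule Suc.IH) (use Suc.prems s in \<open>auto intro!: Suc.prems(3) simp: s_def field_simps\<close>)
  ultimately obtain F1 F2 where "rigid_approx p q' l (upd u q s) G d e (m * vol l (upd u q s)) (g * vol l (upd u q s)) F1"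
    "rigid_approx p q' (upd l q s) u G d e (m * vol (upd l q s) u) (g * vol (upd l q s) u) F2" by blast
  moreover have "0 < vol l (upd u q s)" "0 < vol (upd l q s) u"
    using s Suc.prems(1) by (auto intro!: vol_pos)
  ultimately have "rigid_approx p q' l u G d e (m * vol l (upd u q s) + m * vol (upd l q s) u)
     (g * vol l (upd u q s) + g * vol (upd l q s) u) (F1 @ F2)"
    using s Suc.prems(2) by (intro rigid_approx_merge[where s=s]) auto
  then show ?case
    by (metis distrib_left vol_split)
qed

section \<open>Jump mass of one tilt and of one tent\<close>

lemma matrix_add_mult: "(A + B) *v x = A *v x + (B::real^'n^'m) *v x"
  by (simp add: matrix_vector_mult_def vec_eq_iff sum.distrib algebra_simps)

lemma matrix_scaleR_mult: "(c *\<^sub>R A) *v x = c *\<^sub>R ((A::real^'n^'m) *v x)"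
  by (simp add: matrix_vector_mult_def vec_eq_iff sum_distrib_left mult_ac)

lemma matrix_diff_mult: "(A - B) *v x = A *v x - (B::real^'n^'m) *v x"
  by (simp add: matrix_vector_mult_def vec_eq_iff sum_subtractf algebra_simps)

lemmas matrix_mult_simps = matrix_add_mult matrix_diff_mult matrix_scaleR_mult uminus_matrix_mult

lemma axis_scaleR: "axis p (c::real) = c *\<^sub>R axis p 1"
  by (simp add: vec_eq_iff axis_def)

lemma norm_axis_real [simp]: "norm (axis p (c::real)) = \<bar>c\<bar>"
  by (subst axis_scaleR) (simp add: norm_axis_1)

lemma area_vol: "l $ k < u $ k \<Longrightarrow> area k l u = vol l u / (u $ k - l $ k)"
  by (simp add: vol_area[of l u k])

text \<open>The deviation from the target is at most \<open>c\<close> times the thickness in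
  direction \<open>q\<close>. Since area times thickness is volume, the faces orthogonal to axis
  \<open>q\<close> cost a multiple of the volume however thin the slab is, whereas the lateral faces
  cost an amount per volume that tends to 0 with the thickness.\<close>

lemma tilt_jump_mass:
  assumes lu: "\<And>j. l $ j < u $ j" and c: "0 \<le> c"
  shows "jump_mass [(l, u, G - c *\<^sub>R munit p q, d + axis p (c * l $ q)), (l, u, - G, - d)]
     \<le> ennreal (vol l u * (2 * c + 2 * c * (u $ q - l $ q) * (\<Sum>k\<in>UNIV - {q}. 1 / (u $ k - l $ k))))"
proof -
  define \<delta> where "\<delta> = u $ q - l $ q"
  have \<delta>: "0 < \<delta>" using lu[of q] by (simp add: \<delta>_def)
  have "jump_mass [(l, u, G - c *\<^sub>R munit p q, d + axis p (c * l $ q)), (l, u, - G, - d)]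
     \<le> ennreal (\<Sum>k\<in>UNIV. 2 * (c * \<delta>) * area k l u)"
  proof (rule jump_mass_bound[OF lu])
    fix k y
    have "jump [(l, u, G - c *\<^sub>R munit p q, d + axis p (c * l $ q)), (l, u, - G, - d)] k y
        = ((of_bool (y $ k = l $ k) - of_bool (y $ k = u $ k)) * of_bool (side k l u y)) *\<^sub>R axis p (- c * (y $ q - l $ q))"
    proof -
      have "axis p (- c * (y $ q - l $ q)) = ((G - c *\<^sub>R munit p q) *v y + (d + axis p (c * l $ q))) - (G *v y + d)"
        by (simp add: matrix_mult_simps vec_eq_iff axis_def algebra_simps)
      then show ?thesis
        by (simp add: piece_jump_uminus[of k y l u G d] del: piece_jump.simps)
           (simp add: scaleR_diff_right)
    qed
    moreover have "\<bar>y $ q - l $ q\<bar> \<le> \<delta>" if "side k l u y" "y $ k = l $ k \<or> y $ k = u $ k"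
      using that \<delta> by (cases "k = q") (auto simp: side_def \<delta>_def dest: spec[of _ q])
    then have "c * \<bar>y $ q - l $ q\<bar> \<le> c * \<delta>" if "side k l u y" "y $ k = l $ k \<or> y $ k = u $ k"
      using that c by (auto intro!: mult_left_mono)
    ultimately show "norm (jump [(l, u, G - c *\<^sub>R munit p q, d + axis p (c * l $ q)), (l, u, - G, - d)] k y)
       \<le> c * \<delta> * ((of_bool (y $ k = l $ k) + of_bool (y $ k = u $ k)) * of_bool (side k l u y))"
      using c \<delta> by (auto simp: abs_mult)
  qed (use c \<delta> in auto)
  also have "(\<Sum>k\<in>UNIV. 2 * (c * \<delta>) * area k l u) = 2 * (c * \<delta>) * area q l u + (\<Sum>k\<in>UNIV - {q}. 2 * (c * \<delta>) * area k l u)"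
    by (rule sum.remove) auto
  also have "2 * (c * \<delta>) * area q l u = vol l u * (2 * c)"
    by (simp add: vol_area[of l u q] \<delta>_def)
  also have "(\<Sum>k\<in>UNIV - {q}. 2 * (c * \<delta>) * area k l u) = (\<Sum>k\<in>UNIV - {q}. vol l u * (2 * c * \<delta> * (1 / (u $ k - l $ k))))"
    by (intro sum.cong) (use lu in \<open>auto simp: area_vol\<close>)
  also have "vol l u * (2 * c) + \<dots> = vol l u * (2 * c + 2 * c * \<delta> * (\<Sum>k\<in>UNIV - {q}. 1 / (u $ k - l $ k)))"
    by (simp only: distrib_left sum_distrib_left)
  finally show ?thesis unfolding \<delta>_def .
qed

text \<open>The perturbation with slopes \<open>- c\<close> and \<open>c\<close> vanishes at both
  ends and agrees from both sides at the middle, so no jump orthogonal to axis \<open>q\<close>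
  arises. Only the lateral faces remain, at a cost per volume proportional to the thickness.\<close>

lemma tent_jump_mass:
  assumes lu: "\<And>j. l $ j < u $ j" and c: "0 \<le> c" and s: "s = (l $ q + u $ q) / 2"
  shows "jump_mass [(l, upd u q s, G - c *\<^sub>R munit p q, d + axis p (c * l $ q)),
      (upd l q s, u, G + c *\<^sub>R munit p q, d - axis p (c * u $ q)), (l, u, - G, - d)]
     \<le> ennreal (vol l u * (c * (u $ q - l $ q) * (\<Sum>k\<in>UNIV - {q}. 1 / (u $ k - l $ k))))"
    (is "jump_mass ?F \<le> _")
proof -
  define \<delta> where "\<delta> = (u $ q - l $ q) / 2"
  have \<delta>: "0 < \<delta>" using lu[of q] by (simp add: \<delta>_def)
  have ls: "l $ q < s" "s < u $ q" using lu[of q] by (auto simp: s)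
  have s': "s = l $ q + \<delta>" "u $ q = l $ q + 2 * \<delta>" by (auto simp: s \<delta>_def field_simps)
  define M where "M = (\<lambda>k. if k = q then 0 else c * \<delta>)"
  have "jump_mass ?F \<le> ennreal (\<Sum>k\<in>UNIV. 2 * M k * area k l u)"
  proof (rule jump_mass_bound[OF lu])
    fix k y
    define A where "A = G *v y + d"
    define B where "B = axis p (- c * (y $ q - l $ q))"
    define C where "C = axis p (c * (y $ q - u $ q))"
    have eq: "(G - c *\<^sub>R munit p q) *v y + (d + axis p (c * l $ q)) = A + B"
        "(G + c *\<^sub>R munit p q) *v y + (d - axis p (c * u $ q)) = A + C"
        "G *v y + d = A"
      unfolding A_def B_def C_def
      by (simp_all add: matrix_mult_simps vec_eq_iff axis_def algebra_simps)
    have J: "jump ?F k y = piece_jump k y (l, upd u q s, G - c *\<^sub>R munit p q, d + axis p (c * l $ q))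
       + piece_jump k y (upd l q s, u, G + c *\<^sub>R munit p q, d - axis p (c * u $ q)) - piece_jump k y (l, u, G, d)"
      by (simp add: piece_jump_uminus del: piece_jump.simps)
    have BC: "B = C" if "y $ q = s"
      using that unfolding B_def C_def s' by (simp add: algebra_simps)
    have B0: "B = 0" if "y $ q = l $ q" using that by (simp add: B_def)
    have C0: "C = 0" if "y $ q = u $ q" using that by (simp add: C_def)
    show "norm (jump ?F k y) \<le> M k * ((of_bool (y $ k = l $ k) + of_bool (y $ k = u $ k)) * of_bool (side k l u y))"
    proof (cases "k = q")
      case True
      have "jump ?F k y = 0"
      proof (cases "side q l u y")
        case sd: True
        consider "y $ q = s" | "y $ q = l $ q" | "y $ q = u $ q" | "y $ q \<noteq> s" "y $ q \<noteq> l $ q" "y $ q \<noteq> u $ q" by blast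
        then show ?thesis
          using sd ls unfolding J unfolding True by cases (simp_all add: side_split[OF ls] eq BC B0 C0)
      qed (unfold J, unfold True, simp add: side_split[OF ls])
      then show ?thesis by (simp add: M_def True)
    next
      case False
      have B1: "norm B \<le> c * \<delta>" if "side k l u y" "y $ q < s"
      proof -
        have "\<bar>y $ q - l $ q\<bar> \<le> \<delta>" using that False by (auto simp: side_def s' dest!: spec[of _ q])
        then show ?thesis using c by (auto simp: B_def abs_mult intro!: mult_left_mono)
      qed
      have C1: "norm C \<le> c * \<delta>" if "side k l u y" "\<not> y $ q < s"
      proof -
        have "\<bar>y $ q - u $ q\<bar> \<le> \<delta>" using that False by (auto simp: side_def s' dest!: spec[of _ q])
        then show ?thesis using c by (auto simp: C_def abs_mult intro!: mult_left_mono)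
      qed
      have "jump ?F k y = ((of_bool (y $ k = l $ k) - of_bool (y $ k = u $ k)) * of_bool (side k l u y)) *\<^sub>R (if y $ q < s then B else C)"
      proof (cases "side k l u y")
        case True
        then show ?thesis
          using False unfolding J
          by (cases "y $ q < s") (simp_all add: side_split[OF ls] eq scaleR_add_right)
      qed (unfold J, simp add: side_split[OF ls])
      then show ?thesis using B1 C1 c \<delta> by (auto simp: M_def False)
    qed
  qed (use c \<delta> in \<open>auto simp: M_def\<close>)
  also have "(\<Sum>k\<in>UNIV. 2 * M k * area k l u) = 2 * M q * area q l u + (\<Sum>k\<in>UNIV - {q}. 2 * M k * area k l u)"
    by (rule sum.remove) auto
  also have "(\<Sum>k\<in>UNIV - {q}. 2 * M k * area k l u) = (\<Sum>k\<in>UNIV - {q}. vol l u * (c * (u $ q - l $ q) * (1 / (u $ k - l $ k))))"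
    by (intro sum.cong) (use lu in \<open>auto simp: area_vol M_def \<delta>_def\<close>)
  also have "2 * M q * area q l u + \<dots> = vol l u * (c * (u $ q - l $ q) * (\<Sum>k\<in>UNIV - {q}. 1 / (u $ k - l $ k)))"
    by (simp add: M_def sum_distrib_left)
  finally show ?thesis .
qed

text \<open>A piece and its negative are inserted and cancel. With \<open>F\<close> approximating
  the affine map given by \<open>- G\<close> and \<open>- d\<close>, the first summand is its error
  and the second the jumps with the affine piece still in place of \<open>F\<close>.\<close>

lemma add_list_jump_mass:
  "jump_mass (F @ F1 @ F2) \<le> jump_mass (F @ [(l, u, G, d)]) + jump_mass (F1 @ (l, u, - G, - d) # F2)"
proof (rule jump_mass_triangle)
  fix k y
  have "jump (F @ F1 @ F2) k y = jump (F @ [(l, u, G, d)]) k y + jump (F1 @ (l, u, - G, - d) # F2) k y"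
    by (simp add: piece_jump_uminus del: piece_jump.simps)
  then show "norm (jump (F @ F1 @ F2) k y) \<le> norm (jump (F @ [(l, u, G, d)]) k y) + norm (jump (F1 @ (l, u, - G, - d) # F2) k y)"
    by (metis norm_triangle_ineq)
qed

lemma thin_slab:
  fixes D \<delta> e :: real
  assumes "0 < e"
  obtains N :: nat where "D * (\<delta> / 2 ^ N) \<le> e"
proof -
  obtain N where "D * \<delta> / e < 2 ^ N"
    using real_arch_pow[of 2 "D * \<delta> / e"] by auto
  then have "D * (\<delta> / 2 ^ N) \<le> e"
    using assms by (simp add: field_simps)
  then show ?thesis ..
qed

text \<open>The jump bound is independent of \<open>k\<close> because a step doubles the defect
  \<open>b + c\<close> on half of the volume and makes the other half rigid at almost no cost; the
  gain collects a contribution at every step. The defect is paid for in the base case only, where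
  each slab is tilted into a rigid map.\<close>

lemma staircase:
  fixes l u d :: "real^'n"
  assumes "p \<noteq> q" "\<And>j. l $ j < u $ j" "0 \<le> b" "b \<le> c" "0 < e"
  shows "\<exists>F. rigid_approx p q l u (b *\<^sub>R munit p q + c *\<^sub>R munit q p) d e
      ((2 * (b + c) + e) * vol l u) (real k * (b + c) / 4 * vol l u) F"
  using assms
proof (induction k arbitrary: p q l u b c d e)
  case (0 p q l u b c d e)
  \<comment> \<open>\<open>S\<close> is half the lateral area divided by the volume. Cuts orthogonal
    to axis \<open>q\<close> do not change it, so one \<open>N\<close> suits all slabs.\<close>
  define S where "S = (\<Sum>k\<in>UNIV - {q}. 1 / (u $ k - l $ k))"
  have S: "0 \<le> S" unfolding S_def using 0 by (intro sum_nonneg) (auto simp: less_imp_le)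
  let ?G = "b *\<^sub>R munit p q + c *\<^sub>R munit q p"
  define D where "D = b + c"
  have D: "0 \<le> D" using 0 by (simp add: D_def)
  obtain N :: nat where N: "(2 * D * (S + 1)) * ((u $ q - l $ q) / 2 ^ N) \<le> e" using thin_slab 0(5) by blast
  show ?case
  proof (rule rigid_approx_slabs[where q=q and N=N])
    fix l' u' :: "real^'n"
    assume lu': "\<And>j. l' $ j < u' $ j" and oth: "\<And>j. j \<noteq> q \<Longrightarrow> l' $ j = l $ j \<and> u' $ j = u $ j"
      and q: "u' $ q - l' $ q = (u $ q - l $ q) / 2 ^ N"
    define \<delta> where "\<delta> = u' $ q - l' $ q"
    have \<delta>: "0 < \<delta>" using lu'[of q] by (simp add: \<delta>_def)
    have small0: "2 * D * (S + 1) * \<delta> \<le> e" using N by (simp add: \<delta>_def q)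
    have S': "(\<Sum>k\<in>UNIV - {q}. 1 / (u' $ k - l' $ k)) = S"
      unfolding S_def using oth by (intro sum.cong) auto
    have small: "2 * D * \<delta> * S + 2 * D * \<delta> \<le> e"
      using small0 by (simp add: algebra_simps)
    have V: "0 < vol l' u'" using lu' by (rule vol_pos)
    \<comment> \<open>Subtracting \<open>D\<close> from the slope \<open>b\<close> leaves
      \<open>- c\<close>, which makes the gradient skew.\<close>
    let ?F = "[(l', u', ?G - D *\<^sub>R munit p q, d + axis p (D * l' $ q))]"
    have "jump_mass (?F @ [(l', u', - ?G, - d)]) \<le> ennreal (vol l' u' * (2 * D + 2 * D * \<delta> * S))"
      using tilt_jump_mass[OF lu' D, of ?G p q d] by (simp add: S' \<delta>_def)
    also have "\<dots> \<le> ennreal ((2 * (b + c) + e) * vol l' u')"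
    proof (rule ennreal_leI)
      have "0 \<le> 2 * D * \<delta>" using D \<delta> by simp
      then have "2 * D + 2 * D * \<delta> * S \<le> 2 * D + e" using small by linarith
      then show "vol l' u' * (2 * D + 2 * D * \<delta> * S) \<le> (2 * (b + c) + e) * vol l' u'"
        using V by (simp add: D_def mult.commute[of "vol l' u'"] mult_right_mono)
    qed
    finally have m: "jump_mass (?F @ [(l', u', - ?G, - d)]) \<le> ennreal ((2 * (b + c) + e) * vol l' u')" .
    have ev: "norm (ev ?F x - (?G *v x + d)) \<le> e" if "x \<in> hbox l' u'" for x
    proof -
      have "\<bar>x $ q - l' $ q\<bar> \<le> \<delta>" using that by (auto simp: hbox_def \<delta>_def dest!: spec[of _ q])
      then have "D * \<bar>x $ q - l' $ q\<bar> \<le> D * \<delta>" using D by (rule mult_left_mono)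
      moreover have "0 \<le> 2 * D * \<delta> * S" "0 \<le> D * \<delta>" using D \<delta> S by simp_all
      ultimately have "D * \<bar>x $ q - l' $ q\<bar> \<le> e" using small by (simp only: mult.assoc)
      then have "\<bar>- D * (x $ q - l' $ q)\<bar> \<le> e" using D by (simp add: abs_mult)
      moreover have "ev ?F x - (?G *v x + d) = axis p (- D * (x $ q - l' $ q))"
        using that by (simp add: matrix_mult_simps vec_eq_iff axis_def algebra_simps)
      ultimately show ?thesis by simp
    qed
    have "rigid p q (?G - D *\<^sub>R munit p q)"
      unfolding rigid_def by (rule exI[of _ "- c"]) (simp add: D_def algebra_simps)
    then have "rigid_approx p q l' u' ?G d e ((2 * (b + c) + e) * vol l' u') (real 0 * (b + c) / 4 * vol l' u') ?F"
      unfolding rigid_approx_def using lu' m ev V by (auto simp: sub_box_def)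
    then show "\<exists>F. rigid_approx p q l' u' ?G d e ((2 * (b + c) + e) * vol l' u') (real 0 * (b + c) / 4 * vol l' u') F"
      by blast
  qed (use 0 in auto)
next
  case (Suc n p q l u b c d e)
  define S where "S = (\<Sum>k\<in>UNIV - {q}. 1 / (u $ k - l $ k))"
  have S: "0 \<le> S" unfolding S_def using Suc.prems by (intro sum_nonneg) (auto simp: less_imp_le)
  let ?G = "b *\<^sub>R munit p q + c *\<^sub>R munit q p"
  define D where "D = b + c"
  have D: "0 \<le> D" using Suc.prems by (simp add: D_def)
  obtain N :: nat where N: "(2 * D * (S + 1)) * ((u $ q - l $ q) / 2 ^ N) \<le> e" using thin_slab Suc.prems(5) by blast
  show ?case
  proof (rule rigid_approx_slabs[where q=q and N=N])
    fix l' u' :: "real^'n"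
    assume lu': "\<And>j. l' $ j < u' $ j" and oth: "\<And>j. j \<noteq> q \<Longrightarrow> l' $ j = l $ j \<and> u' $ j = u $ j"
      and q: "u' $ q - l' $ q = (u $ q - l $ q) / 2 ^ N"
    define \<delta> where "\<delta> = u' $ q - l' $ q"
    have \<delta>: "0 < \<delta>" using lu'[of q] by (simp add: \<delta>_def)
    have small0: "2 * D * (S + 1) * \<delta> \<le> e" using N by (simp add: \<delta>_def q)
    have S': "(\<Sum>k\<in>UNIV - {q}. 1 / (u' $ k - l' $ k)) = S"
      unfolding S_def using oth by (intro sum.cong) auto
    have "0 \<le> 2 * D * \<delta> * S" "0 \<le> 2 * D * \<delta>" using D \<delta> S by simp_all
    then have small: "D * \<delta> * S \<le> e / 2" "D * \<delta> \<le> e / 2"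
      using small0 by (simp_all add: algebra_simps)
    have V: "0 < vol l' u'" using lu' by (rule vol_pos)
    define s where "s = (l' $ q + u' $ q) / 2"
    have ls: "l' $ q < s" "s < u' $ q" using lu'[of q] by (auto simp: s_def)
    note split = hbox_split[OF less_imp_le[OF ls(1)] less_imp_le[OF ls(2)]]
    let ?H1 = "upd u' q s" and ?H2 = "upd l' q s"
    have V2: "vol l' ?H1 = vol l' u' / 2" "vol ?H2 u' = vol l' u' / 2"
      by (simp_all add: vol_area[of _ _ q] s_def field_simps)
    \<comment> \<open>\<open>b - D = - c\<close> and \<open>b + D = 2 * b + c\<close>; the offsets
      make the perturbation vanish at the two ends of the slab.\<close>
    let ?G1 = "?G - D *\<^sub>R munit p q" and ?d1 = "d + axis p (D * l' $ q)"
    let ?G2 = "?G + D *\<^sub>R munit p q" and ?d2 = "d - axis p (D * u' $ q)"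
    have lH2: "?H2 $ j < u' $ j" for j using lu' ls by auto
    have lH1: "l' $ j < ?H1 $ j" for j using lu' ls by auto
    have G2: "c *\<^sub>R munit q p + (2 * b + c) *\<^sub>R munit p q = ?G2"
      by (simp add: D_def vec_eq_iff algebra_simps)
    \<comment> \<open>The smaller slope is now \<open>c\<close>, hence the exchange of
      \<open>p\<close> and \<open>q\<close>. Half of \<open>e\<close> is kept back for the
      tent.\<close>
    have "\<exists>F. rigid_approx q p ?H2 u' (c *\<^sub>R munit q p + (2 * b + c) *\<^sub>R munit p q) ?d2 (e / 2)
      ((2 * (c + (2 * b + c)) + e / 2) * vol ?H2 u') (real n * (c + (2 * b + c)) / 4 * vol ?H2 u') F"
      by (rule Suc.IH) (use Suc.prems lH2 in auto)
    then obtain F where "rigid_approx q p ?H2 u' ?G2 ?d2 (e / 2)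
      ((4 * D + e / 2) * vol ?H2 u') (real n * (2 * D) / 4 * vol ?H2 u') F"
      unfolding G2 by (auto simp: D_def algebra_simps)
    then have F: "rigid_approx p q ?H2 u' ?G2 ?d2 (e / 2)
      ((4 * D + e / 2) * vol ?H2 u') (real n * (2 * D) / 4 * vol ?H2 u') F"
      by (rule rigid_approx_swap)
    let ?F = "(l', ?H1, ?G1, ?d1) # F"
    have sub: "\<forall>P\<in>set F. sub_box ?H2 u' P" using F by (auto simp: rigid_approx_def)
    have sub': "\<forall>P\<in>set F. sub_box l' u' P"
    proof
      fix P assume "P \<in> set F"
      then show "sub_box l' u' P" using sub ls by (intro sub_box_trans[of ?H2 u' P l' u']) auto
    qed
    have disj: "\<forall>P\<in>set F. hbox l' ?H1 \<inter> dom_box P = {}"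
      using sub sub_box_dom[of ?H2 u'] unfolding split by fastforce
    have rig: "rigid p q ?G1"
      unfolding rigid_def by (rule exI[of _ "- c"]) (simp add: D_def algebra_simps)
    have "jump_mass (?F @ [(l', u', - ?G, - d)]) = jump_mass (F @ (l', ?H1, ?G1, ?d1) # [(l', u', - ?G, - d)])"
      unfolding jump_mass_def by (simp add: add_ac del: piece_jump.simps)
    also have "\<dots>
      \<le> jump_mass (F @ [(?H2, u', - ?G2, - ?d2)]) + jump_mass [(l', ?H1, ?G1, ?d1), (?H2, u', - (- ?G2), - (- ?d2)), (l', u', - ?G, - d)]"
      using add_list_jump_mass[of F "[(l', ?H1, ?G1, ?d1)]" "[(l', u', - ?G, - d)]" ?H2 u' "- ?G2" "- ?d2"] by simp
    also have "\<dots> \<le> ennreal ((4 * D + e / 2) * vol ?H2 u') + ennreal (vol l' u' * (D * \<delta> * S))"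
    proof (rule add_mono)
      show "jump_mass (F @ [(?H2, u', - ?G2, - ?d2)]) \<le> ennreal ((4 * D + e / 2) * vol ?H2 u')"
        using F by (auto simp: rigid_approx_def)
      show "jump_mass [(l', ?H1, ?G1, ?d1), (?H2, u', - (- ?G2), - (- ?d2)), (l', u', - ?G, - d)] \<le> ennreal (vol l' u' * (D * \<delta> * S))"
        using tent_jump_mass[OF lu' D s_def, of ?G p d] unfolding minus_minus S' \<delta>_def .
    qed
    also have "\<dots> = ennreal ((4 * D + e / 2) * vol ?H2 u' + vol l' u' * (D * \<delta> * S))"
      using V V2 D \<delta> S Suc.prems by (intro ennreal_plus[symmetric]) auto
    \<comment> \<open>On half of the volume \<open>4 * D + e / 2\<close> amounts to
      \<open>2 * D + e / 4\<close>, which leaves room for the \<open>e / 2\<close> of the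
      tent.\<close>
    also have "\<dots> \<le> ennreal ((2 * (b + c) + e) * vol l' u')"
    proof (rule ennreal_leI)
      have "vol l' u' * (D * \<delta> * S) \<le> vol l' u' * (e / 2)"
        using V small by (intro mult_left_mono) auto
      moreover have "0 \<le> vol l' u' * e" using V Suc.prems by simp
      ultimately show "(4 * D + e / 2) * vol ?H2 u' + vol l' u' * (D * \<delta> * S) \<le> (2 * (b + c) + e) * vol l' u'"
        unfolding V2 D_def by (simp add: algebra_simps)
    qed
    finally have m: "jump_mass (?F @ [(l', u', - ?G, - d)]) \<le> ennreal ((2 * (b + c) + e) * vol l' u')" .
    have ev: "norm (ev ?F x - (?G *v x + d)) \<le> e" if x: "x \<in> hbox l' u'" for x
    proof (cases "x $ q < s")
      case True
      have "ev F x = 0" by (rule ev_outside[OF sub]) (use True in \<open>auto simp: split\<close>)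
      then have "ev ?F x - (?G *v x + d) = axis p (- D * (x $ q - l' $ q))"
        using x True by (simp add: split matrix_mult_simps vec_eq_iff axis_def algebra_simps)
      moreover have "\<bar>x $ q - l' $ q\<bar> \<le> \<delta>" using x by (auto simp: hbox_def \<delta>_def dest!: spec[of _ q])
      then have "D * \<bar>x $ q - l' $ q\<bar> \<le> D * \<delta>" using D by (rule mult_left_mono)
      ultimately show ?thesis using small D Suc.prems(5) by (simp add: abs_mult)
    next
      case False
      then have n: "norm (ev F x - (?G2 *v x + ?d2)) \<le> e / 2"
        using F x by (auto simp: rigid_approx_def split)
      have A: "(?G2 *v x + ?d2) - (?G *v x + d) = axis p (D * (x $ q - u' $ q))"
        by (simp add: matrix_mult_simps vec_eq_iff axis_def algebra_simps)
      have "\<bar>x $ q - u' $ q\<bar> \<le> \<delta>" using x by (auto simp: hbox_def \<delta>_def dest!: spec[of _ q])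
      then have "D * \<bar>x $ q - u' $ q\<bar> \<le> D * \<delta>" using D by (rule mult_left_mono)
      then have Z: "norm (axis p (D * (x $ q - u' $ q))) \<le> e / 2" using small D by (simp add: abs_mult)
      have "x \<notin> hbox l' ?H1" using False by (simp add: split)
      then have "ev ?F x = ev F x" by simp
      then have "ev ?F x - (?G *v x + d) = (ev F x - (?G2 *v x + ?d2)) + axis p (D * (x $ q - u' $ q))"
        by (simp only: A[symmetric]) simp
      then show ?thesis using norm_triangle_mono[OF n Z] by (simp only: field_sum_of_halves)
    qed
    have "real (Suc n) * (b + c) / 4 * vol l' u' \<le> c * (vol l' u' / 2) + real n * (2 * D) / 4 * (vol l' u' / 2)"
    proof -
      \<comment> \<open>Here \<open>b \<le> c\<close> enters: the rigid half has a slope of modulus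
        \<open>c\<close>, at least half of \<open>b + c\<close>, on half of the volume.\<close>
      have "(b + c) / 4 * vol l' u' \<le> c / 2 * vol l' u'"
        using V Suc.prems by (intro mult_right_mono) auto
      then show ?thesis by (simp add: D_def algebra_simps add_divide_distrib)
    qed
    also have "\<dots> \<le> gain p q ?F"
    proof -
      have "?G1 $ p $ q = - c" using Suc.prems(1) by (simp add: D_def)
      moreover have "real n * (2 * D) / 4 * (vol l' u' / 2) \<le> gain p q F"
        using F unfolding rigid_approx_def V2 by blast
      ultimately show ?thesis using Suc.prems by (simp add: V2(1))
    qed
    finally have g: "real (Suc n) * (b + c) / 4 * vol l' u' \<le> gain p q ?F" .
    have "sub_box l' u' (l', ?H1, ?G1, ?d1)"
      using lu' ls by (auto simp: sub_box_def)
    then have "rigid_approx p q l' u' ?G d e ((2 * (b + c) + e) * vol l' u') (real (Suc n) * (b + c) / 4 * vol l' u') ?F"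
      unfolding rigid_approx_def using F sub' disj m ev g rig by (auto simp: rigid_approx_def)
    then show "\<exists>F. rigid_approx p q l' u' ?G d e ((2 * (b + c) + e) * vol l' u') (real (Suc n) * (b + c) / 4 * vol l' u') F"
      by blast
  qed (use Suc.prems in auto)
qed

section \<open>Slicing Lebesgue measure\<close>

lemma upd_pair_continuous: "continuous_on S (\<lambda>(s, x). upd x k s)"
proof -
  have "continuous_on S (\<lambda>z. if j = k then fst z else snd z $ j)" for j
    by (cases "j = k") (auto intro!: continuous_intros)
  then show ?thesis
    unfolding upd_def case_prod_unfold by (intro continuous_on_vec_lambda)
qed

lemma upd_pair_measurable [measurable]: "(\<lambda>(s, x). upd x k s) \<in> borel \<Otimes>\<^sub>M borel \<rightarrow>\<^sub>M borel"
  unfolding borel_prod by (rule borel_measurable_continuous_onI) (rule upd_pair_continuous)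

lemma upd_measurable2 [measurable]:
  assumes [measurable]: "f \<in> M \<rightarrow>\<^sub>M borel" "g \<in> M \<rightarrow>\<^sub>M borel"
  shows "(\<lambda>z. upd (f z) k (g z)) \<in> M \<rightarrow>\<^sub>M borel"
proof -
  have "(\<lambda>z. (case (g z, f z) of (s, x) \<Rightarrow> upd x k s)) \<in> M \<rightarrow>\<^sub>M borel"
    by measurable
  then show ?thesis by simp
qed

lemma Basis_prod_vol: "(\<Prod>b\<in>Basis. (u - l) \<bullet> b) = vol l (u::real^'n)"
  by (simp add: Basis_vec_def vol_def UNION_singleton_eq_range
        prod.reindex inj_on_def axis_eq_axis inner_axis)

lemma sigma_finite_strip: "sigma_finite_measure (restrict_space lborel (strip k))"
  by (rule sigma_finite_measure_restrict_space) (auto intro: sigma_finite_lborel)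

lemma slice_map_measurable:
  "(\<lambda>(s, x). upd x k s) \<in> lborel \<Otimes>\<^sub>M restrict_space lborel (strip k) \<rightarrow>\<^sub>M borel"
proof -
  have "(\<lambda>x. x) \<in> restrict_space lborel (strip k) \<rightarrow>\<^sub>M borel"
    by (rule measurable_restrict_space1) simp
  then have "(\<lambda>z. snd z) \<in> (lborel :: real measure) \<Otimes>\<^sub>M restrict_space lborel (strip k) \<rightarrow>\<^sub>M borel"
    by (rule measurable_compose[OF measurable_snd])
  moreover have "(\<lambda>z. fst z) \<in> lborel \<Otimes>\<^sub>M restrict_space lborel (strip k) \<rightarrow>\<^sub>M (borel :: real measure)"
    by (rule measurable_compose[OF measurable_fst]) simp
  ultimately show ?thesis
    unfolding case_prod_unfold by (rule upd_measurable2)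
qed

text \<open>Fubini with the unit strip in the place of a space of dimension \<open>n - 1\<close>:
  the strip variable supplies the other coordinates, while its own \<open>k\<close>-th coordinate
  has total length 1 and is overwritten by \<open>s\<close>. It suffices to compare the measures on
  open boxes.\<close>

lemma lborel_slice:
  "(lborel :: (real^'n) measure) = distr (lborel \<Otimes>\<^sub>M restrict_space lborel (strip k)) borel (\<lambda>(s, x). upd x k s)"
proof (rule lborel_eqI)
  interpret S: sigma_finite_measure "restrict_space lborel (strip k)" by (rule sigma_finite_strip)
  have sub: "(\<lambda>(s, x). upd x k s) \<in> lborel \<Otimes>\<^sub>M restrict_space lborel (strip k) \<rightarrow>\<^sub>M borel"
    by (rule slice_map_measurable)
  fix l u :: "real^'n" assume le: "\<And>b. b \<in> Basis \<Longrightarrow> l \<bullet> b \<le> u \<bullet> b"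
  have lu: "l $ j \<le> u $ j" for j
    using le[of "axis j 1"] by (auto simp: inner_axis)
  define T where "T = {x. \<forall>j. j \<noteq> k \<longrightarrow> l $ j < x $ j \<and> x $ j < u $ j} \<inter> strip k"
  have "Measurable.pred borel (\<lambda>y::real^'n. \<forall>j\<in>UNIV. j \<noteq> k \<longrightarrow> l $ j < y $ j \<and> y $ j < u $ j)"
    by (rule pred_intros_finite) auto
  then have "{x::real^'n. \<forall>j. j \<noteq> k \<longrightarrow> l $ j < x $ j \<and> x $ j < u $ j} \<in> sets borel"
    by (simp add: pred_def)
  then have T: "T \<in> sets borel" unfolding T_def by auto
  have T': "T \<in> sets (restrict_space lborel (strip k))"
    using T by (subst sets_restrict_space_iff) (simp_all, simp add: T_def)
  have T'': "emeasure lborel T = ennreal (area k l u)"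
  proof (rule antisym)
    have "emeasure lborel T \<le> emeasure lborel (cbox (upd l k 0) (upd u k 1))"
      by (rule emeasure_mono) (auto simp: T_def strip_def mem_box_cart less_imp_le)
    then show "emeasure lborel T \<le> ennreal (area k l u)"
      using lu by (subst (asm) emeasure_cbox_vol) (auto simp: vol_upd)
    have "emeasure lborel (box (upd l k 0) (upd u k 1)) \<le> emeasure lborel T"
      using T by (intro emeasure_mono) (auto simp: T_def strip_def mem_box_cart less_imp_le split: if_splits)
    then show "ennreal (area k l u) \<le> emeasure lborel T"
      using lu by (subst (asm) emeasure_cbox_vol) (auto simp: vol_upd)
  qed
  have pre: "(\<lambda>(s, x). upd x k s) -` box l u \<inter> space (lborel \<Otimes>\<^sub>M restrict_space lborel (strip k)) = {l $ k<..<u $ k} \<times> T"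
  proof (intro set_eqI)
    fix z :: "real \<times> (real^'n)"
    obtain s x where z: "z = (s, x)" by (cases z)
    have "upd x k s \<in> box l u \<longleftrightarrow> (l $ k < s \<and> s < u $ k) \<and> (\<forall>j. j \<noteq> k \<longrightarrow> l $ j < x $ j \<and> x $ j < u $ j)"
    proof -
      have "upd x k s \<in> box l u \<longleftrightarrow> (\<forall>j. (j = k \<longrightarrow> l $ k < s \<and> s < u $ k) \<and> (j \<noteq> k \<longrightarrow> l $ j < x $ j \<and> x $ j < u $ j))"
        by (auto simp: mem_box_cart)
      then show ?thesis by blast
    qed
    then show "z \<in> (\<lambda>(s, x). upd x k s) -` box l u \<inter> space (lborel \<Otimes>\<^sub>M restrict_space lborel (strip k)) \<longleftrightarrow> z \<in> {l $ k<..<u $ k} \<times> T"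
      by (auto simp: z T_def space_pair_measure)
  qed
  have "emeasure (distr (lborel \<Otimes>\<^sub>M restrict_space lborel (strip k)) borel (\<lambda>(s, x). upd x k s)) (box l u)
     = emeasure (lborel \<Otimes>\<^sub>M restrict_space lborel (strip k)) ({l $ k<..<u $ k} \<times> T)"
    by (subst emeasure_distr[OF sub]) (simp_all add: pre)
  also have "\<dots> = ennreal (u $ k - l $ k) * ennreal (area k l u)"
    using T' T'' lu by (subst S.emeasure_pair_measure_Times) (auto simp: emeasure_restrict_space T_def)
  also have "\<dots> = ennreal (vol l u)"
    using lu by (simp add: vol_area[of _ _ k] ennreal_mult'' mult.commute)
  finally show "emeasure (distr (lborel \<Otimes>\<^sub>M restrict_space lborel (strip k)) borel (\<lambda>(s, x). upd x k s)) (box l u) = ennreal (\<Prod>b\<in>Basis. (u - l) \<bullet> b)"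
    by (simp add: Basis_prod_vol)
qed simp

lemma integral_slice:
  fixes h :: "real^'n \<Rightarrow> real"
  assumes h: "integrable lborel h"
  shows "(LBINT x. h x) = (\<integral>x. indicator (strip k) x * (LBINT s. h (upd x k s)) \<partial>lborel)"
proof -
  let ?S = "restrict_space lborel (strip k)"
  interpret S: sigma_finite_measure ?S by (rule sigma_finite_strip)
  interpret P: pair_sigma_finite lborel ?S ..
  have sub: "(\<lambda>(s, x). upd x k s) \<in> lborel \<Otimes>\<^sub>M ?S \<rightarrow>\<^sub>M borel"
    by (rule slice_map_measurable)
  have hm [measurable]: "h \<in> borel \<rightarrow>\<^sub>M borel" using h by simp
  have int: "integrable (lborel \<Otimes>\<^sub>M ?S) (\<lambda>(s, x). h (upd x k s))"
    using h integrable_distr[OF sub, of h] unfolding lborel_slice[of k, symmetric] by (simp add: case_prod_unfold)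
  have "(LBINT x. h x) = (\<integral>z. h (case z of (s, x) \<Rightarrow> upd x k s) \<partial>(lborel \<Otimes>\<^sub>M ?S))"
    by (subst lborel_slice[of k], rule integral_distr[OF sub]) simp
  also have "\<dots> = (\<integral>(s, x). h (upd x k s) \<partial>(lborel \<Otimes>\<^sub>M ?S))"
    by (simp add: case_prod_unfold)
  also have "\<dots> = (\<integral>x. (LBINT s. h (upd x k s)) \<partial>?S)"
    using P.integral_snd[OF int] by simp
  also have "\<dots> = (\<integral>x. indicator (strip k) x *\<^sub>R (LBINT s. h (upd x k s)) \<partial>lborel)"
    by (subst integral_restrict_space) (auto)
  finally show ?thesis by simp
qed

lemma upd_line: "upd x k s = upd x k 0 + s *\<^sub>R axis k 1"
  by (simp add: vec_eq_iff axis_def)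

lemma has_derivative_partial:
  fixes \<psi> :: "real^'n \<Rightarrow> real"
  assumes "\<psi> differentiable (at (upd x k s))"
  shows "((\<lambda>s. \<psi> (upd x k s)) has_real_derivative partial k \<psi> (upd x k s)) (at s)"
proof -
  have "((\<lambda>s. upd x k s) has_derivative (\<lambda>h. h *\<^sub>R axis k 1)) (at s)"
    by (subst upd_line) (auto intro!: derivative_eq_intros)
  moreover have D: "(\<psi> has_derivative frechet_derivative \<psi> (at (upd x k s))) (at (upd x k s))"
    using assms by (simp add: frechet_derivative_works)
  ultimately have "((\<lambda>s. \<psi> (upd x k s)) has_derivative (\<lambda>h. frechet_derivative \<psi> (at (upd x k s)) (h *\<^sub>R axis k 1))) (at s)"
    by (rule has_derivative_compose)
  moreover have "frechet_derivative \<psi> (at (upd x k s)) (h *\<^sub>R axis k 1) = partial k \<psi> (upd x k s) * h" for h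
    using linear_frechet_derivative[OF assms] by (simp add: linear_scale partial_def)
  ultimately show ?thesis
    by (simp add: has_field_derivative_def mult.commute[of _ "partial k \<psi> (upd x k s)"])
qed

lemma integrable_hbox:
  fixes h :: "real^'n \<Rightarrow> real"
  assumes "continuous_on UNIV h"
  shows "integrable lborel (\<lambda>x. indicator (hbox l u) x * h x)"
proof -
  have "integrable lborel (\<lambda>x. indicator (cbox l u) x *\<^sub>R h x)"
    by (rule borel_integrable_compact) (auto intro: continuous_on_subset[OF assms])
  then have "integrable lborel (\<lambda>x. indicator (hbox l u) x *\<^sub>R (indicator (cbox l u) x *\<^sub>R h x))"
    by (rule integrable_mult_indicator[rotated]) simp
  also have "(\<lambda>x. indicator (hbox l u) x *\<^sub>R (indicator (cbox l u) x *\<^sub>R h x)) = (\<lambda>x. indicator (hbox l u) x * h x)"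
    by (auto simp: fun_eq_iff indicator_def hbox_def mem_box_cart less_imp_le)
  finally show ?thesis .
qed

text \<open>The fundamental theorem of calculus on every line parallel to axis \<open>k\<close>,
  integrated over the strip.\<close>

lemma divergence_hbox:
  fixes \<psi> :: "real^'n \<Rightarrow> real"
  assumes lu: "\<And>j. l $ j < u $ j" and diff: "\<And>x. \<psi> differentiable (at x)"
    and cont: "continuous_on UNIV (partial k \<psi>)"
  shows "(LBINT x. indicator (hbox l u) x * partial k \<psi> x) =
    (LBINT x. indicator (strip k) x * (of_bool (side k l u x) * (\<psi> (upd x k (u $ k)) - \<psi> (upd x k (l $ k)))))"
proof -
  have [measurable]: "partial k \<psi> \<in> borel \<rightarrow>\<^sub>M borel"
    using cont by (rule borel_measurable_continuous_onI)
  have inner: "(LBINT s. indicator (hbox l u) (upd x k s) * partial k \<psi> (upd x k s))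
      = of_bool (side k l u x) * (\<psi> (upd x k (u $ k)) - \<psi> (upd x k (l $ k)))" for x
  proof -
    have "(LBINT s. indicator (hbox l u) (upd x k s) * partial k \<psi> (upd x k s))
      = (LBINT s. of_bool (side k l u x) * (partial k \<psi> (upd x k s) * indicator {l $ k..u $ k} s))"
    proof (rule integral_cong_AE)
      \<comment> \<open>The half-open and the closed interval differ at \<open>u $ k\<close>
        only.\<close>
      have "AE s in lborel. s \<noteq> u $ k" by (rule AE_lborel_singleton)
      then show "AE s in lborel. indicator (hbox l u) (upd x k s) * partial k \<psi> (upd x k s)
        = of_bool (side k l u x) * (partial k \<psi> (upd x k s) * indicator {l $ k..u $ k} s)"
        by eventually_elim (auto simp: indicator_def hbox_side[where k=k])
    qed auto
    also have "\<dots> = of_bool (side k l u x) * (LBINT s. partial k \<psi> (upd x k s) * indicator {l $ k..u $ k} s)"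
      by simp
    also have "(LBINT s. partial k \<psi> (upd x k s) * indicator {l $ k..u $ k} s) = \<psi> (upd x k (u $ k)) - \<psi> (upd x k (l $ k))"
    proof (rule integral_FTC_Icc_real)
      show "l $ k \<le> u $ k" using lu[of k] by simp
      show "((\<lambda>s. \<psi> (upd x k s)) has_real_derivative partial k \<psi> (upd x k s)) (at s)" for s
        by (rule has_derivative_partial) (rule diff)
      have "continuous_on UNIV (\<lambda>s. upd x k s)"
        by (subst upd_line) (intro continuous_intros)
      then have "continuous_on UNIV (\<lambda>s. partial k \<psi> (upd x k s))"
        by (rule continuous_on_compose2[OF cont]) auto
      then show "isCont (\<lambda>s. partial k \<psi> (upd x k s)) s" for s
        by (simp add: continuous_on_eq_continuous_at)
    qed
    finally show ?thesis .
  qed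
  show ?thesis
    using integral_slice[OF integrable_hbox[OF cont, of l u], of k] unfolding inner .
qed

section \<open>The measure on a countable union of hyperplanes\<close>

lemma vec_nth_measurable [measurable (raw)]:
  assumes "f \<in> M \<rightarrow>\<^sub>M borel"
  shows "(\<lambda>x. (f x :: real^'n) $ i) \<in> M \<rightarrow>\<^sub>M borel"
proof -
  have "(\<lambda>y::real^'n. y $ i) \<in> borel \<rightarrow>\<^sub>M borel"
    by (intro borel_measurable_continuous_onI continuous_intros)
  then show ?thesis using assms by (rule measurable_compose[rotated])
qed

lemma partial_eq: "(f has_derivative D) (at x) \<Longrightarrow> partial j f x = D (axis j 1)"
  unfolding partial_def using frechet_derivative_at by metis

lemma affine_nth_has_derivative: "((\<lambda>x. ((G::real^'n^'m) *v x + d) $ i) has_derivative (\<lambda>h. (G *v h) $ i)) (at x)"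
proof -
  have "((\<lambda>x. (G *v x) $ i + d $ i) has_derivative (\<lambda>h. (G *v h) $ i)) (at x)"
    by (rule has_derivative_add_const, rule bounded_linear_imp_has_derivative)
       (rule bounded_linear_compose[OF bounded_linear_vec_nth matrix_vector_mul_bounded_linear])
  then show ?thesis by simp
qed

lemma affine_mult_has_derivative:
  assumes "\<phi> differentiable (at x)"
  shows "((\<lambda>x. ((G::real^'n^'n) *v x + d) $ i * \<phi> x) has_derivative
     (\<lambda>h. (G *v x + d) $ i * frechet_derivative \<phi> (at x) h + (G *v h) $ i * \<phi> x)) (at x)"
  by (rule has_derivative_mult[OF affine_nth_has_derivative])
     (use assms frechet_derivative_works in blast)

lemma partial_affine_mult:
  assumes "\<phi> differentiable (at x)"
  shows "partial j (\<lambda>x. ((G::real^'n^'n) *v x + d) $ i * \<phi> x) x = (G *v x + d) $ i * partial j \<phi> x + G $ i $ j * \<phi> x"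
  by (subst partial_eq[OF affine_mult_has_derivative[OF assms]])
     (simp add: partial_def matrix_vector_mult_basis column_def)

lemma affine_continuous: "continuous_on S (\<lambda>x. ((G::real^'n^'m) *v x + d) $ i)"
  by (intro continuous_intros linear_continuous_on matrix_vector_mul_bounded_linear)

text \<open>Integrals against surface measure on \<open>\<Union>(k, t)\<in>I. {x. x $ k = t}\<close> are computed on \<open>hyper I\<close> by
  composing with \<open>hproj\<close>; the strip factor in \<open>jump_dens\<close> makes each hyperplane count once.\<close>

definition hyper :: "('n \<times> real) set \<Rightarrow> (('n \<times> real) \<times> (real^'n)) measure" where
  "hyper I = count_space I \<Otimes>\<^sub>M lborel"

definition hproj :: "('n \<times> real) \<times> (real^'n) \<Rightarrow> real^'n" where
  "hproj z = (case z of ((k, t), x) \<Rightarrow> upd x k t)"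

definition jump_dens :: "('n::finite) piece list \<Rightarrow> 'n \<Rightarrow> 'n \<Rightarrow> ('n \<times> real) \<times> (real^'n) \<Rightarrow> real" where
  "jump_dens F j i z = (case z of ((k, t), x) \<Rightarrow> of_bool (k = j) * (indicator (strip k) x * jump F k (upd x k t) $ i))"

definition coords :: "('n::finite) piece list \<Rightarrow> ('n \<times> real) set" where
  "coords F = (\<Union>(l, u, G, d)\<in>set F. range (\<lambda>k. (k, l $ k)) \<union> range (\<lambda>k. (k, u $ k)))"

lemma finite_coords: "finite (coords F)"
  unfolding coords_def by auto

lemma jump_dens_Nil [simp]: "jump_dens [] j i z = 0"
  by (auto simp: jump_dens_def split: prod.splits)

lemma jump_dens_Cons: "jump_dens (P # F) j i z = jump_dens [P] j i z + jump_dens F j i z"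
  by (auto simp: jump_dens_def algebra_simps split: prod.splits)

lemma hproj_measurable: "countable I \<Longrightarrow> hproj \<in> hyper I \<rightarrow>\<^sub>M borel"
  unfolding hyper_def by (rule measurable_pair_measure_countable1) (auto simp: hproj_def split: prod.splits)

lemma jump_dens_measurable: "countable I \<Longrightarrow> jump_dens F j i \<in> hyper I \<rightarrow>\<^sub>M borel"
  unfolding hyper_def by (rule measurable_pair_measure_countable1) (auto simp: jump_dens_def split: prod.splits)

lemma pair_sigma_finite_hyper: "countable I \<Longrightarrow> pair_sigma_finite (count_space I) (lborel :: (real^'n) measure)"
  unfolding pair_sigma_finite_def
  by (simp add: sigma_finite_measure_count_space_countable sigma_finite_lborel)

text \<open>\<open>jump_mass\<close> sums over all hyperplanes, \<open>hyper I\<close> only over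
  those in the countable set \<open>I\<close>, where sigma-finiteness permits Fubini; moreover one
  component is bounded by the norm.\<close>

lemma nn_integral_jump_dens:
  assumes I: "countable I"
  shows "(\<integral>\<^sup>+z. ennreal (norm (jump_dens F j i z)) \<partial>hyper I) \<le> jump_mass F"
proof -
  interpret pair_sigma_finite "count_space I" "lborel :: (real^'a) measure"
    using I by (rule pair_sigma_finite_hyper)
  have [measurable]: "jump_dens F j i \<in> (count_space I \<Otimes>\<^sub>M lborel) \<rightarrow>\<^sub>M borel"
    using jump_dens_measurable[OF I] by (simp add: hyper_def)
  let ?g = "\<lambda>k t. \<integral>\<^sup>+x. indicator (strip k) x * ennreal (norm (jump F k (upd x k t))) \<partial>lborel"
  have "(\<integral>\<^sup>+z. ennreal (norm (jump_dens F j i z)) \<partial>hyper I)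
     = (\<integral>\<^sup>+\<kappa>. (\<integral>\<^sup>+x. ennreal (norm (jump_dens F j i (\<kappa>, x))) \<partial>lborel) \<partial>count_space I)"
    unfolding hyper_def by (rule lborel.nn_integral_fst[symmetric]) measurable
  also have "\<dots> \<le> (\<integral>\<^sup>+\<kappa>. (case \<kappa> of (k, t) \<Rightarrow> ?g k t) \<partial>count_space I)"
  proof (rule nn_integral_mono)
    fix \<kappa> :: "'a \<times> real"
    obtain k t where \<kappa>: "\<kappa> = (k, t)" by (cases \<kappa>)
    have "(\<integral>\<^sup>+x. ennreal (norm (jump_dens F j i (\<kappa>, x))) \<partial>lborel) \<le> ?g k t"
    proof (rule nn_integral_mono)
      fix x
      have "\<bar>jump F k (upd x k t) $ i\<bar> \<le> norm (jump F k (upd x k t))"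
        by (rule component_le_norm_cart)
      then show "ennreal (norm (jump_dens F j i (\<kappa>, x))) \<le> indicator (strip k) x * ennreal (norm (jump F k (upd x k t)))"
        by (auto simp: jump_dens_def \<kappa> indicator_def strip_def intro!: ennreal_leI)
    qed
    then show "(\<integral>\<^sup>+x. ennreal (norm (jump_dens F j i (\<kappa>, x))) \<partial>lborel) \<le> (case \<kappa> of (k, t) \<Rightarrow> ?g k t)"
      by (simp add: \<kappa>)
  qed
  also have "\<dots> = (\<integral>\<^sup>+\<kappa>. (case \<kappa> of (k, t) \<Rightarrow> ?g k t) * indicator I \<kappa> \<partial>count_space UNIV)"
    by (simp add: nn_integral_count_space_indicator)
  also have "\<dots> \<le> (\<integral>\<^sup>+\<kappa>. (case \<kappa> of (k, t) \<Rightarrow> ?g k t) \<partial>count_space UNIV)"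
    by (rule nn_integral_mono) (auto simp: indicator_def)
  also have "\<dots> = (\<integral>\<^sup>+k. (\<integral>\<^sup>+t. ?g k t \<partial>count_space UNIV) \<partial>count_space UNIV)"
    by (simp add: nn_integral_fst_count_space[symmetric])
  also have "\<dots> = jump_mass F"
    unfolding jump_mass_def by (simp add: nn_integral_count_space_finite)
  finally show ?thesis .
qed

text \<open>An affine map is bounded on a compact box. What matters is the linear dependence on
  \<open>c\<close>: scaling a piece makes its jumps as small as required.\<close>

lemma jump_mass_single:
  assumes lu: "\<And>j. l $ j < u $ j"
  obtains K where "0 \<le> K" "\<And>c. 0 \<le> c \<Longrightarrow> jump_mass [(l, u, c *\<^sub>R G, c *\<^sub>R d)] \<le> ennreal (c * K)"
proof -
  have "compact ((\<lambda>x. G *v x + d) ` cbox l u)"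
    by (intro compact_continuous_image continuous_intros linear_continuous_on matrix_vector_mul_bounded_linear) auto
  from compact_imp_bounded[OF this] obtain B where B: "\<And>x. x \<in> cbox l u \<Longrightarrow> norm (G *v x + d) \<le> B"
    unfolding bounded_iff by blast
  define M where "M = max B 0"
  have M: "0 \<le> M" "\<And>x. x \<in> cbox l u \<Longrightarrow> norm (G *v x + d) \<le> M"
    using B by (auto simp: M_def le_max_iff_disj)
  define K where "K = (\<Sum>k\<in>UNIV. 2 * M * area k l u)"
  show thesis
  proof
    show "0 \<le> K" unfolding K_def
      using M area_pos[OF lu] by (intro sum_nonneg mult_nonneg_nonneg) (auto simp: less_imp_le)
    fix c :: real assume c: "0 \<le> c"
    have "jump_mass [(l, u, c *\<^sub>R G, c *\<^sub>R d)] \<le> ennreal (\<Sum>k\<in>UNIV. 2 * (c * M) * area k l u)"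
    proof (rule jump_mass_bound[OF lu])
      fix k y
      have "norm (G *v y + d) \<le> M" if "side k l u y" "y $ k = l $ k \<or> y $ k = u $ k"
      proof (rule M(2))
        have "l $ j \<le> y $ j \<and> y $ j \<le> u $ j" for j
          using that lu[of j] by (cases "j = k") (auto simp: side_def dest!: spec[of _ j])
        then show "y \<in> cbox l u" by (auto simp: mem_box_cart)
      qed
      then have "c * norm (G *v y + d) \<le> c * M" if "side k l u y" "y $ k = l $ k \<or> y $ k = u $ k"
        using that c by (intro mult_left_mono) auto
      moreover have "norm ((c *\<^sub>R G) *v y + c *\<^sub>R d) = c * norm (G *v y + d)"
        using c unfolding matrix_scaleR_mult scaleR_add_right[symmetric] norm_scaleR by simp
      ultimately show "norm (jump [(l, u, c *\<^sub>R G, c *\<^sub>R d)] k y) \<le> c * M * ((of_bool (y $ k = l $ k) + of_bool (y $ k = u $ k)) * of_bool (side k l u y))"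
        using c M by (auto simp del: scaleR_right_distrib)
    qed (use c M in auto)
    also have "(\<Sum>k\<in>UNIV. 2 * (c * M) * area k l u) = c * K"
      unfolding K_def by (simp add: sum_distrib_left mult_ac)
    finally show "jump_mass [(l, u, c *\<^sub>R G, c *\<^sub>R d)] \<le> ennreal (c * K)" .
  qed
qed

lemma jump_dens_single_integrable:
  assumes I: "countable I" and lu: "\<And>j. l $ j < u $ j"
  shows "integrable (hyper I) (jump_dens [(l, u, G, d)] j i)"
proof (rule integrableI_bounded)
  obtain K where "\<And>c. 0 \<le> c \<Longrightarrow> jump_mass [(l, u, c *\<^sub>R G, c *\<^sub>R d)] \<le> ennreal (c * K)"
    using jump_mass_single[OF lu, of G d] by metis
  from this[of 1] have "jump_mass [(l, u, G, d)] < \<infinity>"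
    by (simp add: le_less_trans)
  then show "(\<integral>\<^sup>+z. ennreal (norm (jump_dens [(l, u, G, d)] j i z)) \<partial>hyper I) < \<infinity>"
    using nn_integral_jump_dens[OF I] by (rule le_less_trans[rotated])
qed (rule jump_dens_measurable[OF I])

lemma strip_side: "indicator (strip k) x * of_bool (side k l u x) = indicat_real (hbox (upd l k 0) (upd u k 1)) x"
  by (auto simp: indicator_def strip_def hbox_side[where k=k])

lemma integrable_face:
  assumes "continuous_on UNIV (\<psi> :: real^'n \<Rightarrow> real)"
  shows "integrable lborel (\<lambda>x. indicator (hbox (upd l k 0) (upd u k 1)) x * \<psi> (upd x k t))"
  by (rule integrable_hbox) (rule continuous_on_compose2[OF assms upd_continuous], auto)

text \<open>Integration by parts on one box: \<open>divergence_hbox\<close> is applied to the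
  product of component \<open>i\<close> of the affine map with the test function, and the face terms
  are the jumps of the piece extended by \<open>0\<close>.\<close>

lemma hyper_single:
  fixes \<phi> :: "real^'n \<Rightarrow> real"
  assumes I: "countable I" "coords [(l, u, G, d)] \<subseteq> I" and lu: "\<And>j. l $ j < u $ j"
    and diff: "\<And>x. \<phi> differentiable (at x)" and cont: "continuous_on UNIV (partial j \<phi>)"
    and B: "\<And>x. \<bar>\<phi> x\<bar> \<le> B"
  shows "integrable (hyper I) (\<lambda>z. \<phi> (hproj z) * jump_dens [(l, u, G, d)] j i z)"
    and "(\<integral>z. \<phi> (hproj z) * jump_dens [(l, u, G, d)] j i z \<partial>hyper I) =
      - (LBINT x. piece_ev x (l, u, G, d) $ i * partial j \<phi> x)
      - G $ i $ j * (LBINT x. indicator (hbox l u) x * \<phi> x)"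
proof -
  interpret pair_sigma_finite "count_space I" "lborel :: (real^'n) measure"
    using I(1) by (rule pair_sigma_finite_hyper)
  have c\<phi>: "continuous_on UNIV \<phi>"
    using diff by (intro continuous_at_imp_continuous_on) (auto intro: differentiable_imp_continuous_within)
  then have [measurable]: "\<phi> \<in> borel \<rightarrow>\<^sub>M borel"
    by (rule borel_measurable_continuous_onI)
  note jm [measurable] = jump_dens_measurable[OF I(1)] hproj_measurable[OF I(1)]
  show int: "integrable (hyper I) (\<lambda>z. \<phi> (hproj z) * jump_dens [(l, u, G, d)] j i z)"
  proof (rule Bochner_Integration.integrable_bound)
    show "integrable (hyper I) (\<lambda>z. B * jump_dens [(l, u, G, d)] j i z)"
      using jump_dens_single_integrable[OF I(1) lu] by simp
    have "\<bar>\<phi> y\<bar> \<le> \<bar>B\<bar>" for y using B[of y] by linarith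
    then show "AE z in hyper I. norm (\<phi> (hproj z) * jump_dens [(l, u, G, d)] j i z) \<le> norm (B * jump_dens [(l, u, G, d)] j i z)"
      by (auto simp: abs_mult intro!: mult_right_mono)
  qed simp
  define \<psi> where "\<psi> = (\<lambda>x. (G *v x + d) $ i * \<phi> x)"
  define g where "g = (\<lambda>t. \<integral>x. indicator (hbox (upd l j 0) (upd u j 1)) x * \<psi> (upd x j t) \<partial>lborel)"
  have c\<psi>: "continuous_on UNIV \<psi>"
    unfolding \<psi>_def by (intro continuous_on_mult affine_continuous c\<phi>)
  have p: "partial j \<psi> x = (G *v x + d) $ i * partial j \<phi> x + G $ i $ j * \<phi> x" for x
    unfolding \<psi>_def by (rule partial_affine_mult) (rule diff)
  have "(\<integral>z. \<phi> (hproj z) * jump_dens [(l, u, G, d)] j i z \<partial>hyper I)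
      = (\<integral>\<kappa>. (LBINT x. \<phi> (hproj (\<kappa>, x)) * jump_dens [(l, u, G, d)] j i (\<kappa>, x)) \<partial>count_space I)"
    using integral_fst'[OF int[unfolded hyper_def]] by (simp add: hyper_def)
  also have "\<dots> = (\<integral>\<kappa>. (case \<kappa> of (k, t) \<Rightarrow> of_bool (k = j) * ((of_bool (t = l $ j) - of_bool (t = u $ j)) * g t)) \<partial>count_space I)"
  proof (rule Bochner_Integration.integral_cong)
    fix \<kappa> :: "'n \<times> real"
    obtain k t where \<kappa>: "\<kappa> = (k, t)" by (cases \<kappa>)
    have "(LBINT x. \<phi> (hproj (\<kappa>, x)) * jump_dens [(l, u, G, d)] j i (\<kappa>, x))
      = (LBINT x. (of_bool (k = j) * (of_bool (t = l $ j) - of_bool (t = u $ j))) * (indicator (hbox (upd l j 0) (upd u j 1)) x * \<psi> (upd x j t)))"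
      by (rule Bochner_Integration.integral_cong)
         (auto simp: \<kappa> hproj_def jump_dens_def \<psi>_def strip_side[symmetric])
    then show "(LBINT x. \<phi> (hproj (\<kappa>, x)) * jump_dens [(l, u, G, d)] j i (\<kappa>, x))
      = (case \<kappa> of (k, t) \<Rightarrow> of_bool (k = j) * ((of_bool (t = l $ j) - of_bool (t = u $ j)) * g t))"
      by (simp add: \<kappa> g_def mult.assoc)
  qed simp
  \<comment> \<open>Only the two faces orthogonal to axis \<open>j\<close> contribute, and
    \<open>I\<close> contains both.\<close>
  also have "\<dots> = (\<Sum>\<kappa>\<in>{(j, l $ j), (j, u $ j)}. (case \<kappa> of (k, t) \<Rightarrow> of_bool (k = j) * ((of_bool (t = l $ j) - of_bool (t = u $ j)) * g t)))"
    (is "_ = sum ?f ?S")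
  proof -
    have sub: "{\<kappa> \<in> I. ?f \<kappa> \<noteq> 0} \<subseteq> ?S" by (auto split: if_splits)
    have SI: "?S \<subseteq> I" using I(2) by (auto simp: coords_def)
    have "(\<integral>\<kappa>. ?f \<kappa> \<partial>count_space I) = (\<Sum>\<kappa> | \<kappa> \<in> I \<and> ?f \<kappa> \<noteq> 0. ?f \<kappa>)"
      by (rule lebesgue_integral_count_space_finite_support) (rule finite_subset[OF sub], simp)
    also have "\<dots> = sum ?f ?S"
      using sub SI by (intro sum.mono_neutral_left) blast+
    finally show ?thesis .
  qed
  also have "\<dots> = g (l $ j) - g (u $ j)"
    using lu[of j] by simp
  also have "\<dots> = - (LBINT x. indicator (hbox l u) x * partial j \<psi> x)"
  proof -
    have "(LBINT x. indicator (hbox l u) x * partial j \<psi> x) =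
      (LBINT x. indicator (strip j) x * (of_bool (side j l u x) * (\<psi> (upd x j (u $ j)) - \<psi> (upd x j (l $ j)))))"
    proof (rule divergence_hbox[OF lu])
      show "\<psi> differentiable at x" for x
        unfolding \<psi>_def differentiable_def using affine_mult_has_derivative[OF diff] by blast
      have "continuous_on UNIV (\<lambda>x. (G *v x + d) $ i * partial j \<phi> x + G $ i $ j * \<phi> x)"
        by (intro continuous_intros affine_continuous cont c\<phi> continuous_on_mult)
      then show "continuous_on UNIV (partial j \<psi>)" by (simp add: p[abs_def])
    qed
    also have "\<dots> = (\<integral>x. indicator (hbox (upd l j 0) (upd u j 1)) x * \<psi> (upd x j (u $ j))
        - indicator (hbox (upd l j 0) (upd u j 1)) x * \<psi> (upd x j (l $ j)) \<partial>lborel)"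
      by (simp only: mult.assoc[symmetric] strip_side) (simp add: algebra_simps)
    also have "\<dots> = g (u $ j) - g (l $ j)"
      unfolding g_def by (rule Bochner_Integration.integral_diff) (rule integrable_face[OF c\<psi>])+
    finally show ?thesis by simp
  qed
  also have "(LBINT x. indicator (hbox l u) x * partial j \<psi> x)
     = (LBINT x. indicator (hbox l u) x * ((G *v x + d) $ i * partial j \<phi> x) + G $ i $ j * (indicator (hbox l u) x * \<phi> x))"
    unfolding p by (simp only: distrib_left) (simp add: mult_ac)
  also have "\<dots> = (LBINT x. indicator (hbox l u) x * ((G *v x + d) $ i * partial j \<phi> x))
     + (LBINT x. G $ i $ j * (indicator (hbox l u) x * \<phi> x))"
    by (intro Bochner_Integration.integral_add integrable_mult_right integrable_hbox continuous_on_mult affine_continuous cont c\<phi>)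
  finally show "(\<integral>z. \<phi> (hproj z) * jump_dens [(l, u, G, d)] j i z \<partial>hyper I) =
      - (LBINT x. piece_ev x (l, u, G, d) $ i * partial j \<phi> x)
      - G $ i $ j * (LBINT x. indicator (hbox l u) x * \<phi> x)"
    by (simp add: mult.assoc)
qed

definition box_piece :: "('n::finite) piece \<Rightarrow> bool" where
  "box_piece P \<longleftrightarrow> (case P of (l, u, G, d) \<Rightarrow> \<forall>j. l $ j < u $ j)"

lemma coords_Cons: "coords (P # F) = coords [P] \<union> coords F"
  by (auto simp: coords_def)

lemma piece_ev_integrable:
  assumes "continuous_on UNIV (h :: real^'n \<Rightarrow> real)"
  shows "integrable lborel (\<lambda>x. piece_ev x P $ i * h x)"
proof -
  obtain l u G d where P: "P = (l, u, G, d)" by (cases P)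
  have "integrable lborel (\<lambda>x. indicator (hbox l u) x * ((G *v x + d) $ i * h x))"
    by (intro integrable_hbox continuous_on_mult affine_continuous assms)
  then show ?thesis by (simp add: P mult.assoc)
qed

lemma ev_integrable:
  assumes "continuous_on UNIV (h :: real^'n \<Rightarrow> real)"
  shows "integrable lborel (\<lambda>x. ev F x $ i * h x)"
  by (induction F) (simp_all add: distrib_right piece_ev_integrable[OF assms])

text \<open>The last sum stems from the gradients on the pieces. It is kept explicit because it
  cancels under symmetrization when the gradients are skew.\<close>

lemma hyper_list:
  fixes \<phi> :: "real^'n \<Rightarrow> real"
  assumes I: "countable I" "coords F \<subseteq> I" and F: "\<forall>P\<in>set F. box_piece P"
    and diff: "\<And>x. \<phi> differentiable (at x)" and cont: "continuous_on UNIV (partial j \<phi>)"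
    and B: "\<And>x. \<bar>\<phi> x\<bar> \<le> B"
  shows "integrable (hyper I) (\<lambda>z. \<phi> (hproj z) * jump_dens F j i z) \<and>
    (\<integral>z. \<phi> (hproj z) * jump_dens F j i z \<partial>hyper I) =
      - (LBINT x. ev F x $ i * partial j \<phi> x)
      - (\<Sum>(l, u, G, d)\<leftarrow>F. G $ i $ j * (LBINT x. indicator (hbox l u) x * \<phi> x))"
  using I(2) F
proof (induction F)
  case Nil
  then show ?case by simp
next
  case (Cons P F)
  obtain l u G d where P: "P = (l, u, G, d)" by (cases P)
  have lu: "l $ j < u $ j" for j using Cons.prems by (simp add: P box_piece_def)
  have co: "coords [(l, u, G, d)] \<subseteq> I" "coords F \<subseteq> I"
    using Cons.prems(1) coords_Cons[of P F] by (auto simp: P)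
  note 1 = hyper_single[OF I(1) co(1) lu diff cont B, of i]
  have 2: "integrable (hyper I) (\<lambda>z. \<phi> (hproj z) * jump_dens F j i z)"
    "(\<integral>z. \<phi> (hproj z) * jump_dens F j i z \<partial>hyper I) =
      - (LBINT x. ev F x $ i * partial j \<phi> x)
      - (\<Sum>(l, u, G, d)\<leftarrow>F. G $ i $ j * (LBINT x. indicator (hbox l u) x * \<phi> x))"
    using Cons.IH[OF co(2)] Cons.prems(2) by auto
  have "(LBINT x. ev (P # F) x $ i * partial j \<phi> x) =
     (LBINT x. piece_ev x P $ i * partial j \<phi> x + ev F x $ i * partial j \<phi> x)"
    by (simp add: distrib_right)
  also have "\<dots> = (LBINT x. piece_ev x P $ i * partial j \<phi> x) + (LBINT x. ev F x $ i * partial j \<phi> x)"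
    by (intro Bochner_Integration.integral_add piece_ev_integrable ev_integrable cont)
  finally have e: "(LBINT x. ev (P # F) x $ i * partial j \<phi> x) = \<dots>" .
  define f1 where "f1 = (\<lambda>z. \<phi> (hproj z) * jump_dens [P] j i z)"
  define f2 where "f2 = (\<lambda>z. \<phi> (hproj z) * jump_dens F j i z)"
  have j: "(\<lambda>z. \<phi> (hproj z) * jump_dens (P # F) j i z) = (\<lambda>z. f1 z + f2 z)"
    by (rule ext, subst jump_dens_Cons) (simp only: f1_def f2_def distrib_left)
  have "integrable (hyper I) f1" "integrable (hyper I) f2"
    using 1(1) 2(1) by (simp_all add: f1_def f2_def P)
  moreover have "integral\<^sup>L (hyper I) f1 = - (LBINT x. piece_ev x P $ i * partial j \<phi> x)
      - G $ i $ j * (LBINT x. indicator (hbox l u) x * \<phi> x)"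
    using 1(2) by (simp only: f1_def P)
  moreover have "integral\<^sup>L (hyper I) f2 = - (LBINT x. ev F x $ i * partial j \<phi> x)
      - (\<Sum>(l, u, G, d)\<leftarrow>F. G $ i $ j * (LBINT x. indicator (hbox l u) x * \<phi> x))"
    using 2(2) by (simp only: f2_def)
  ultimately show ?case
    unfolding j e by (simp add: P)
qed

section \<open>One-sided limits and signed measures\<close>

text \<open>The image of the positive part of a density; used for \<open>h\<close> and
  \<open>- h\<close>, it provides the two measures that \<open>has_signed_integral\<close> asks
  for.\<close>

lemma signed_image:
  fixes h :: "'z \<Rightarrow> real" and \<pi> :: "'z \<Rightarrow> 'a::euclidean_space"
  assumes \<Omega>: "\<Omega> \<in> sets borel" and h: "integrable H h" and \<pi>: "\<pi> \<in> H \<rightarrow>\<^sub>M borel"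
  defines "P \<equiv> restrict_space (distr (density H (\<lambda>z. ennreal (max 0 (h z)))) borel \<pi>) \<Omega>"
  shows "finite_measure P" "sets P = sets (restrict_space borel \<Omega>)"
    and "\<phi> \<in> borel \<rightarrow>\<^sub>M borel \<Longrightarrow> (\<And>x. \<bar>\<phi> x\<bar> \<le> B) \<Longrightarrow> (\<And>x. x \<notin> \<Omega> \<Longrightarrow> \<phi> x = (0::real)) \<Longrightarrow>
      integrable P \<phi> \<and> (\<integral>x. \<phi> x \<partial>P) = (\<integral>z. max 0 (h z) * \<phi> (\<pi> z) \<partial>H)"
proof -
  have hm [measurable]: "h \<in> H \<rightarrow>\<^sub>M borel" "\<pi> \<in> H \<rightarrow>\<^sub>M borel" using h \<pi> by auto
  define D where "D = distr (density H (\<lambda>z. ennreal (max 0 (h z)))) borel \<pi>"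
  have "emeasure D UNIV = (\<integral>\<^sup>+z. ennreal (max 0 (h z)) \<partial>H)"
    unfolding D_def by (subst emeasure_distr) (simp_all add: emeasure_density cong: nn_integral_cong)
  also have "\<dots> \<le> (\<integral>\<^sup>+z. ennreal (norm (h z)) \<partial>H)"
    by (intro nn_integral_mono ennreal_leI) auto
  also have "\<dots> < \<infinity>" using h by (simp add: integrable_iff_bounded)
  finally have fin: "emeasure D UNIV < \<infinity>" .
  have sD: "sets D = sets borel" "space D = UNIV" by (simp_all add: D_def)
  have fD: "finite_measure D"
    using fin by (intro finite_measureI) (simp add: sD)
  show "sets P = sets (restrict_space borel \<Omega>)"
    unfolding P_def D_def[symmetric] by (rule sets_restrict_space_cong) (rule sD)
  have \<Omega>D: "\<Omega> \<inter> space D \<in> sets D" using \<Omega> by (simp add: sD)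
  show fP: "finite_measure P"
  proof (rule finite_measureI)
    have "emeasure P (space P) = emeasure D \<Omega>"
      unfolding P_def D_def[symmetric] using \<Omega> by (subst emeasure_restrict_space) (auto simp: sD space_restrict_space)
    then show "emeasure P (space P) \<noteq> \<infinity>"
      using finite_measure.emeasure_finite[OF fD] by simp
  qed
  assume \<phi> [measurable]: "\<phi> \<in> borel \<rightarrow>\<^sub>M borel" and B: "\<And>x. \<bar>\<phi> x\<bar> \<le> B" and 0: "\<And>x. x \<notin> \<Omega> \<Longrightarrow> \<phi> x = 0"
  have "integrable P \<phi>"
  proof (rule finite_measure.integrable_const_bound[OF fP])
    show "AE x in P. norm (\<phi> x) \<le> B" using B by simp
    have "\<phi> \<in> D \<rightarrow>\<^sub>M borel" using \<phi> by (simp add: D_def)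
    then show "\<phi> \<in> P \<rightarrow>\<^sub>M borel"
      unfolding P_def D_def[symmetric] by (rule measurable_restrict_space1)
  qed
  moreover have "(\<integral>x. \<phi> x \<partial>P) = (\<integral>x. indicator \<Omega> x *\<^sub>R \<phi> x \<partial>D)"
    unfolding P_def D_def[symmetric] by (rule integral_restrict_space[OF \<Omega>D])
  moreover have "(\<lambda>x. indicator \<Omega> x *\<^sub>R \<phi> x) = \<phi>"
    using 0 by (auto simp: indicator_def fun_eq_iff)
  moreover have "(\<integral>x. \<phi> x \<partial>D) = (\<integral>z. \<phi> (\<pi> z) \<partial>(density H (\<lambda>z. ennreal (max 0 (h z)))))"
    unfolding D_def by (rule integral_distr) auto
  moreover have "\<dots> = (\<integral>z. max 0 (h z) * \<phi> (\<pi> z) \<partial>H)"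
    by (subst integral_density) auto
  ultimately show "integrable P \<phi> \<and> (\<integral>x. \<phi> x \<partial>P) = (\<integral>z. max 0 (h z) * \<phi> (\<pi> z) \<partial>H)"
    by simp
qed

lemma signed_image_integral:
  fixes h :: "'z \<Rightarrow> real" and \<pi> :: "'z \<Rightarrow> 'a::euclidean_space"
  assumes \<Omega>: "\<Omega> \<in> sets borel" and h: "integrable H h" and \<pi>: "\<pi> \<in> H \<rightarrow>\<^sub>M borel"
  shows "\<exists>P N. finite_measure P \<and> finite_measure N \<and>
    sets P = sets (restrict_space borel \<Omega>) \<and> sets N = sets (restrict_space borel \<Omega>) \<and>
    (\<forall>A\<in>sets (restrict_space borel \<Omega>). (\<integral>z. indicator A (\<pi> z) * h z \<partial>H) = measure P A - measure N A) \<and>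
    (\<forall>\<phi> B. \<phi> \<in> borel \<rightarrow>\<^sub>M borel \<longrightarrow> (\<forall>x. \<bar>\<phi> x\<bar> \<le> B) \<longrightarrow> (\<forall>x. x \<notin> \<Omega> \<longrightarrow> \<phi> x = (0::real)) \<longrightarrow>
      integrable P \<phi> \<and> integrable N \<phi> \<and> (\<integral>z. \<phi> (\<pi> z) * h z \<partial>H) = (\<integral>x. \<phi> x \<partial>P) - (\<integral>x. \<phi> x \<partial>N))"
proof -
  define P where "P h = restrict_space (distr (density H (\<lambda>z. ennreal (max 0 (h z)))) borel \<pi>) \<Omega>" for h :: "'z \<Rightarrow> real"
  have h': "integrable H (\<lambda>z. - h z)" using h by simp
  note 1 = signed_image[OF \<Omega> h \<pi>, folded P_def] and 2 = signed_image[OF \<Omega> h' \<pi>, folded P_def]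
  have 3: "integrable (P h) \<phi> \<and> integrable (P (\<lambda>z. - h z)) \<phi> \<and> (\<integral>z. \<phi> (\<pi> z) * h z \<partial>H) = (\<integral>x. \<phi> x \<partial>P h) - (\<integral>x. \<phi> x \<partial>P (\<lambda>z. - h z))"
    if \<phi>: "\<phi> \<in> borel \<rightarrow>\<^sub>M borel" and B: "\<And>x. \<bar>\<phi> x\<bar> \<le> B" and 0: "\<And>x. x \<notin> \<Omega> \<Longrightarrow> \<phi> x = (0::real)" for \<phi> B
  proof -
    have m [measurable]: "\<phi> \<in> borel \<rightarrow>\<^sub>M borel" "h \<in> H \<rightarrow>\<^sub>M borel" "\<pi> \<in> H \<rightarrow>\<^sub>M borel" using h \<phi> \<pi> by auto
    have i: "integrable H (\<lambda>z. max 0 (g z) * \<phi> (\<pi> z))" if g: "integrable H g" for g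
    proof (rule Bochner_Integration.integrable_bound)
      show "integrable H (\<lambda>z. B * g z)" using g by simp
      have [measurable]: "g \<in> H \<rightarrow>\<^sub>M borel" using g by auto
      show "(\<lambda>z. max 0 (g z) * \<phi> (\<pi> z)) \<in> H \<rightarrow>\<^sub>M borel" by measurable
      have B': "\<bar>\<phi> y\<bar> \<le> \<bar>B\<bar>" for y using B[of y] by linarith
      have "\<bar>max 0 (g z) * \<phi> (\<pi> z)\<bar> \<le> \<bar>B\<bar> * \<bar>g z\<bar>" for z
        using mult_mono[of "\<bar>max 0 (g z)\<bar>" "\<bar>g z\<bar>" "\<bar>\<phi> (\<pi> z)\<bar>" "\<bar>B\<bar>"] B' by (simp add: abs_mult mult.commute)
      then show "AE z in H. norm (max 0 (g z) * \<phi> (\<pi> z)) \<le> norm (B * g z)"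
        by (simp add: abs_mult)
    qed
    have "(\<integral>x. \<phi> x \<partial>P h) - (\<integral>x. \<phi> x \<partial>P (\<lambda>z. - h z)) = (\<integral>z. max 0 (h z) * \<phi> (\<pi> z) - max 0 (- h z) * \<phi> (\<pi> z) \<partial>H)"
      using 1(3)[OF \<phi> B 0] 2(3)[OF \<phi> B 0] i[OF h] i[OF h'] by simp
    also have "\<dots> = (\<integral>z. \<phi> (\<pi> z) * h z \<partial>H)"
      by (rule Bochner_Integration.integral_cong) (auto simp: max_def)
    finally show ?thesis using 1(3)[OF \<phi> B 0] 2(3)[OF \<phi> B 0] by simp
  qed
  have 4: "(\<integral>z. indicator A (\<pi> z) * h z \<partial>H) = measure (P h) A - measure (P (\<lambda>z. - h z)) A"
    if A: "A \<in> sets (restrict_space borel \<Omega>)" for A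
  proof -
    have A': "A \<subseteq> \<Omega>" "A \<in> sets borel"
      using A \<Omega> by (auto simp: sets_restrict_space_iff)
    have "(\<integral>z. indicator A (\<pi> z) * h z \<partial>H) = (\<integral>x. indicator A x \<partial>P h) - (\<integral>x. indicator A x \<partial>P (\<lambda>z. - h z))"
      using A' by (intro 3[of "indicator A" 1, THEN conjunct2, THEN conjunct2]) (auto simp: indicator_def)
    moreover have "A \<inter> space (P g) = A" for g
      using A' by (auto simp: P_def space_restrict_space)
    ultimately show ?thesis by simp
  qed
  show ?thesis
    by (intro exI[of _ "P h"] exI[of _ "P (\<lambda>z. - h z)"] conjI ballI allI impI)
       (rule 1(1) 1(2) 2(1) 2(2) 4 3[THEN conjunct1] 3[THEN conjunct2, THEN conjunct1] 3[THEN conjunct2, THEN conjunct2]; blast)+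
qed

text \<open>A linear bound on the half ball makes the average at radius \<open>r\<close> at most
  \<open>K * r\<close>.\<close>

lemma half_ball_limit_local:
  fixes u :: "real^'n \<Rightarrow> real^'n"
  assumes ev: "\<forall>\<^sub>F y in nhds x. 0 < (y - x) \<bullet> \<nu> \<longrightarrow> norm (u y - z) \<le> K * norm (y - x)" and K: "0 \<le> K"
  shows "half_ball_limit u x \<nu> z"
proof -
  obtain \<delta> where \<delta>: "0 < \<delta>" "\<And>y. dist y x < \<delta> \<Longrightarrow> 0 < (y - x) \<bullet> \<nu> \<Longrightarrow> norm (u y - z) \<le> K * norm (y - x)"
    using ev unfolding eventually_nhds_metric by blast
  let ?f = "\<lambda>r. (LINT y:(ball x r \<inter> {y. (y - x) \<bullet> \<nu> > 0})|lebesgue. norm (u y - z)) / measure lebesgue (ball x r)"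
  have bound: "?f r \<le> K * r" and nonneg: "0 \<le> ?f r" if r: "0 < r" "r < \<delta>" for r
  proof -
    have m: "0 < measure lebesgue (ball x r)" using content_ball_pos[OF r(1)] by simp
    have "(LINT y:(ball x r \<inter> {y. (y - x) \<bullet> \<nu> > 0})|lebesgue. norm (u y - z)) \<le> (\<integral>y. (K * r) * indicator (ball x r) y \<partial>lebesgue)"
      unfolding set_lebesgue_integral_def
    \<comment> \<open>A nonnegative integrable majorant suffices, since a non-integrable integrand
      would have integral \<open>0\<close>.\<close>
    proof (rule integral_mono')
      have "emeasure lebesgue (ball x r) < \<infinity>"
        using emeasure_lborel_ball_finite[of x r] by simp
      then show "integrable lebesgue (\<lambda>y. (K * r) * indicator (ball x r) y)"
        by (intro integrable_mult_right integrable_real_indicator) simp_all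
      fix y
      have "norm (u y - z) \<le> K * r" if "y \<in> ball x r" "0 < (y - x) \<bullet> \<nu>"
      proof -
        have "norm (y - x) < r" using that(1) by (simp add: dist_norm norm_minus_commute)
        moreover have "norm (u y - z) \<le> K * norm (y - x)"
          using \<delta>(2)[of y] that r by (simp add: dist_commute)
        ultimately show ?thesis
          using mult_left_mono[of "norm (y - x)" r K] K by linarith
      qed
      then show "indicat_real (ball x r \<inter> {y. 0 < (y - x) \<bullet> \<nu>}) y *\<^sub>R norm (u y - z) \<le> K * r * indicat_real (ball x r) y"
        using K r by (auto simp: indicator_def)
      show "0 \<le> K * r * indicat_real (ball x r) y" using K r by simp
    qed
    also have "\<dots> = K * r * measure lebesgue (ball x r)" by simp
    finally show "?f r \<le> K * r" using m by (simp add: field_simps)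
    show "0 \<le> ?f r" unfolding set_lebesgue_integral_def
      by (intro divide_nonneg_nonneg Bochner_Integration.integral_nonneg) auto
  qed
  have ev1: "\<forall>\<^sub>F r in at_right 0. 0 < r \<and> r < \<delta>"
    using \<delta>(1) by (auto simp: eventually_at_right[of 0 1] intro!: exI[of _ \<delta>])
  show ?thesis
    unfolding half_ball_limit_def
  proof (rule tendsto_sandwich)
    show "\<forall>\<^sub>F r in at_right 0. 0 \<le> ?f r" using ev1 by eventually_elim (rule nonneg, auto)
    show "\<forall>\<^sub>F r in at_right 0. ?f r \<le> K * r" using ev1 by eventually_elim (rule bound, auto)
    show "((\<lambda>r. K * r) \<longlongrightarrow> 0) (at_right 0)"
      by (rule tendsto_eq_intros | simp)+
  qed auto
qed

text \<open>Once \<open>y\<close> avoids the face coordinates along all other axes, membership of a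
  nearby point in the box depends only on its side of the hyperplane through \<open>y\<close>
  orthogonal to axis \<open>k\<close>. Thus \<open>a\<close> is the indicator seen from above and
  \<open>b\<close> the one seen from below.\<close>

lemma piece_local:
  fixes y :: "real^'n"
  assumes lu: "\<And>j. l $ j < u $ j" and y: "\<And>j. j \<noteq> k \<Longrightarrow> y $ j \<noteq> l $ j \<and> y $ j \<noteq> u $ j"
  defines "a \<equiv> of_bool (side k l u y \<and> l $ k \<le> y $ k \<and> y $ k < u $ k)"
    and "b \<equiv> of_bool (side k l u y \<and> l $ k < y $ k \<and> y $ k \<le> u $ k)"
  shows "\<forall>\<^sub>F x in nhds y. (y $ k < x $ k \<longrightarrow> piece_ev x (l, u, G, d) = a *\<^sub>R (G *v x + d)) \<and>
      (x $ k < y $ k \<longrightarrow> piece_ev x (l, u, G, d) = b *\<^sub>R (G *v x + d))"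
    and "a *\<^sub>R (G *v y + d) - b *\<^sub>R (G *v y + d) = piece_jump k y (l, u, G, d)"
proof -
  have tend: "((\<lambda>x. x $ j) \<longlongrightarrow> y $ j) (nhds y)" for j
    by (intro tendsto_vec_nth filterlim_ident)
  have less: "\<forall>\<^sub>F x in nhds y. x $ j < c" if "y $ j < c" for j c
    using order_tendstoD(2)[OF tend that] .
  have greater: "\<forall>\<^sub>F x in nhds y. c < x $ j" if "c < y $ j" for j c
    using order_tendstoD(1)[OF tend that] .
  have cmp: "\<forall>\<^sub>F x in nhds y. (y $ j < c \<longrightarrow> x $ j < c) \<and> (c < y $ j \<longrightarrow> c < x $ j)" for j c
    using less[of j c] greater[of c j] by (cases "y $ j < c"; cases "c < y $ j") (auto intro: eventually_mono)
  have "\<forall>\<^sub>F x in nhds y. \<forall>j. ((y $ j < l $ j \<longrightarrow> x $ j < l $ j) \<and> (l $ j < y $ j \<longrightarrow> l $ j < x $ j))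
      \<and> ((y $ j < u $ j \<longrightarrow> x $ j < u $ j) \<and> (u $ j < y $ j \<longrightarrow> u $ j < x $ j))"
    by (intro eventually_all_finite eventually_conj cmp)
  then show "\<forall>\<^sub>F x in nhds y. (y $ k < x $ k \<longrightarrow> piece_ev x (l, u, G, d) = a *\<^sub>R (G *v x + d)) \<and>
      (x $ k < y $ k \<longrightarrow> piece_ev x (l, u, G, d) = b *\<^sub>R (G *v x + d))"
  proof eventually_elim
    case (elim x)
    have "(l $ j \<le> x $ j \<and> x $ j < u $ j) = (l $ j \<le> y $ j \<and> y $ j < u $ j)" if "j \<noteq> k" for j
      using elim[rule_format, of j] y[OF that] by linarith
    then have "side k l u x = side k l u y"
      unfolding side_def by blast
    moreover have "(l $ k \<le> x $ k \<and> x $ k < u $ k) = (l $ k \<le> y $ k \<and> y $ k < u $ k)" if "y $ k < x $ k"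
      using elim[rule_format, of k] that by linarith
    moreover have "(l $ k \<le> x $ k \<and> x $ k < u $ k) = (l $ k < y $ k \<and> y $ k \<le> u $ k)" if "x $ k < y $ k"
      using elim[rule_format, of k] that by linarith
    ultimately show ?case
      by (auto simp: a_def b_def hbox_side[where k=k] indicator_def)
  qed
  have "of_bool (l $ k \<le> y $ k \<and> y $ k < u $ k) - of_bool (l $ k < y $ k \<and> y $ k \<le> u $ k)
     = (of_bool (y $ k = l $ k) - of_bool (y $ k = u $ k) :: real)"
    using lu[of k] by auto
  then show "a *\<^sub>R (G *v y + d) - b *\<^sub>R (G *v y + d) = piece_jump k y (l, u, G, d)"
    unfolding a_def b_def by (cases "side k l u y") (simp_all flip: scaleR_diff_left)
qed

text \<open>Affine formulas, not just limits, are recorded on the two sides, because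
  \<open>half_ball_limit_local\<close> asks for a linear bound.\<close>

lemma ev_local:
  fixes y :: "real^'n"
  assumes "\<forall>P\<in>set F. box_piece P" "\<And>j t. j \<noteq> k \<Longrightarrow> (j, t) \<in> coords F \<Longrightarrow> y $ j \<noteq> t"
  shows "\<exists>G d G' d'. (\<forall>\<^sub>F x in nhds y. (y $ k < x $ k \<longrightarrow> ev F x = G *v x + d) \<and>
      (x $ k < y $ k \<longrightarrow> ev F x = G' *v x + d')) \<and> (G *v y + d) - (G' *v y + d') = jump F k y"
  using assms
proof (induction F)
  case Nil
  then show ?case by (intro exI[of _ 0]) simp
next
  case (Cons P F)
  obtain l u G0 d0 where P: "P = (l, u, G0, d0)" by (cases P)
  have co: "coords (P # F) = coords [P] \<union> coords F" by (rule coords_Cons)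
  have lu: "l $ j < u $ j" for j using Cons.prems(1) by (simp add: P box_piece_def)
  obtain G d G' d' where IH: "\<forall>\<^sub>F x in nhds y. (y $ k < x $ k \<longrightarrow> ev F x = G *v x + d) \<and>
      (x $ k < y $ k \<longrightarrow> ev F x = G' *v x + d')" "(G *v y + d) - (G' *v y + d') = jump F k y"
    using Cons.IH Cons.prems unfolding co by auto
  have "y $ j \<noteq> l $ j \<and> y $ j \<noteq> u $ j" if "j \<noteq> k" for j
    using Cons.prems(2)[OF that] unfolding co by (auto simp: P coords_def)
  note 1 = piece_local[OF lu this, of k G0 d0]
  define a where "a = (of_bool (side k l u y \<and> l $ k \<le> y $ k \<and> y $ k < u $ k) :: real)"
  define b where "b = (of_bool (side k l u y \<and> l $ k < y $ k \<and> y $ k \<le> u $ k) :: real)"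
  have 2: "\<forall>\<^sub>F x in nhds y. (y $ k < x $ k \<longrightarrow> piece_ev x P = a *\<^sub>R (G0 *v x + d0)) \<and>
      (x $ k < y $ k \<longrightarrow> piece_ev x P = b *\<^sub>R (G0 *v x + d0))"
    "a *\<^sub>R (G0 *v y + d0) - b *\<^sub>R (G0 *v y + d0) = piece_jump k y P"
    unfolding P a_def b_def by (rule 1, assumption)+
  show ?case
  proof (intro exI conjI)
    show "\<forall>\<^sub>F x in nhds y. (y $ k < x $ k \<longrightarrow> ev (P # F) x = (a *\<^sub>R G0 + G) *v x + (a *\<^sub>R d0 + d)) \<and>
      (x $ k < y $ k \<longrightarrow> ev (P # F) x = (b *\<^sub>R G0 + G') *v x + (b *\<^sub>R d0 + d'))"
      using IH(1) 2(1) by eventually_elim (simp add: matrix_mult_simps algebra_simps)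
    show "(a *\<^sub>R G0 + G) *v y + (a *\<^sub>R d0 + d) - ((b *\<^sub>R G0 + G') *v y + (b *\<^sub>R d0 + d')) = jump (P # F) k y"
      unfolding jump_simps IH(2)[symmetric] 2(2)[symmetric] by (simp add: matrix_mult_simps algebra_simps)
  qed
qed

section \<open>Locally finite sequences of pieces\<close>

lemma sum_list_nonzero: "(\<Sum>x\<leftarrow>xs. f x) \<noteq> (0 :: 'a::comm_monoid_add) \<Longrightarrow> \<exists>x\<in>set xs. f x \<noteq> 0"
  by (induction xs) auto

lemma hbox_cbox: "hbox l u \<subseteq> cbox l u"
  by (auto simp: hbox_def mem_box_cart less_imp_le)

lemma null_hyperplane: "{x::real^'n. x $ k = t} \<in> null_sets lborel"
proof -
  have "negligible {x::real^'n. x $ k = t}"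
    using negligible_standard_hyperplane[of "axis k 1 :: real^'n" t] by (simp add: inner_axis)
  then have "{x::real^'n. x $ k = t} \<in> null_sets lebesgue" by (simp add: negligible_iff_null_sets)
  moreover have "closed {x::real^'n. x $ k = t}"
    by (intro closed_Collect_eq continuous_intros)
  ultimately show ?thesis
    by (simp add: null_sets_def emeasure_completion borel_closed)
qed

text \<open>All that the analysis of \<open>u\<close> uses about the pieces. \<open>mass\<close>
  makes the jump densities summable, so that \<open>Eu\<close> is finite. Local finiteness is
  required only at points of the closed boxes, which leaves the boxes free to accumulate elsewhere
  in \<open>K\<close>; and \<open>K\<close> confines \<open>u\<close> to a compact subset of
  \<open>\<Omega>\<close>.\<close>

locale piece_seq =
  fixes F :: "nat \<Rightarrow> ('n::finite) piece list" and L U :: "nat \<Rightarrow> real^'n" and p q :: 'n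
    and \<Omega> K :: "(real^'n) set"
  assumes sub: "P \<in> set (F m) \<Longrightarrow> sub_box (L m) (U m) P"
    and rig: "(l, u, G, d) \<in> set (F m) \<Longrightarrow> rigid p q G"
    and ord: "disjoint_pieces (F m)"
    and disj: "m \<noteq> m' \<Longrightarrow> hbox (L m) (U m) \<inter> hbox (L m') (U m') = {}"
    and locally_finite: "y \<in> cbox (L m) (U m) \<Longrightarrow> \<exists>\<delta>>0. finite {m'. cbox (L m') (U m') \<inter> ball y \<delta> \<noteq> {}}"
    and mass: "jump_mass (F m) \<le> ennreal ((1 / 2) ^ m)"
    and ev_bound: "norm (ev (F m) x) \<le> 1"
    and \<Omega>: "open \<Omega>" and K: "compact K" "K \<subseteq> \<Omega>" "cbox (L m) (U m) \<subseteq> K"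
begin

definition u :: "real^'n \<Rightarrow> real^'n" where
  "u x = (\<Sum>m. ev (F m) x)"

definition I :: "('n \<times> real) set" where
  "I = (\<Union>m. coords (F m))"

definition sym_dens :: "nat \<Rightarrow> 'n \<Rightarrow> 'n \<Rightarrow> ('n \<times> real) \<times> (real^'n) \<Rightarrow> real" where
  "sym_dens m i j z = (jump_dens (F m) j i z + jump_dens (F m) i j z) / 2"

definition dens :: "'n \<Rightarrow> 'n \<Rightarrow> ('n \<times> real) \<times> (real^'n) \<Rightarrow> real" where
  "dens i j z = (\<Sum>m. sym_dens m i j z)"

text \<open>The image under \<open>hproj\<close> of the signed densities on the hyperplanes. There
  is no volume term because the gradients of the pieces are skew.\<close>

definition Eu :: "(real^'n) set \<Rightarrow> real^'n^'n" where
  "Eu A = (\<chi> i j. \<integral>z. indicator A (hproj z) * dens i j z \<partial>hyper I)"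

lemma countable_I: "countable I"
  unfolding I_def by (auto intro: countable_finite finite_coords)

lemma coords_I: "coords (F m) \<subseteq> I"
  by (auto simp: I_def)

lemmas [measurable] = hproj_measurable[OF countable_I] jump_dens_measurable[OF countable_I]

lemma box_pieces: "\<forall>P\<in>set (F m). box_piece P"
  using sub by (fastforce simp: sub_box_def box_piece_def split: prod.splits)

lemma ev_zero: "x \<notin> hbox (L m) (U m) \<Longrightarrow> ev (F m) x = 0"
  using sub by (intro ev_outside) auto

lemma ev_other: "x \<in> hbox (L m) (U m) \<Longrightarrow> m' \<noteq> m \<Longrightarrow> ev (F m') x = 0"
  using disj[of m m'] by (intro ev_zero) auto

lemma u_eq: "x \<in> hbox (L m) (U m) \<Longrightarrow> u x = ev (F m) x"
  unfolding u_def by (subst suminf_finite[of "{m}"]) (auto dest: ev_other)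

lemma u_zero: "(\<And>m. x \<notin> hbox (L m) (U m)) \<Longrightarrow> u x = 0"
  unfolding u_def by (simp add: ev_zero)

lemma u_cases: obtains m where "u x = ev (F m) x" "\<And>m'. m' \<noteq> m \<Longrightarrow> ev (F m') x = 0"
proof (cases "\<exists>m. x \<in> hbox (L m) (U m)")
  case True
  then show ?thesis using that u_eq ev_other by blast
next
  case False
  then show ?thesis using that[of 0] u_zero[of x] ev_zero[of x] by auto
qed

lemma norm_u: "norm (u x) \<le> 1"
  by (rule u_cases[of x]) (simp add: ev_bound)

lemma hbox_K: "hbox (L m) (U m) \<subseteq> K"
  using K(3)[of m] hbox_cbox[of "L m" "U m"] by blast

lemma u_outside: "x \<notin> K \<Longrightarrow> u x = 0"
  using hbox_K by (intro u_zero) auto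

lemma u_sums: "(\<lambda>m. ev (F m) x) sums u x"
proof -
  obtain m where "u x = ev (F m) x" "\<And>m'. m' \<noteq> m \<Longrightarrow> ev (F m') x = 0" by (rule u_cases[of x]) blast
  then show ?thesis using sums_finite[of "{m}" "\<lambda>m. ev (F m) x"] by simp
qed

lemma u_measurable [measurable]: "u \<in> borel \<rightarrow>\<^sub>M borel"
  unfolding u_def[abs_def] by measurable

lemma jump_support: "jump (F m) k y \<noteq> 0 \<Longrightarrow> y \<in> cbox (L m) (U m)"
proof -
  assume "jump (F m) k y \<noteq> 0"
  then obtain P where P: "P \<in> set (F m)" "piece_jump k y P \<noteq> 0"
    using sum_list_nonzero unfolding jump_def by blast
  obtain l u' G d where Pe: "P = (l, u', G, d)" by (cases P)
  have b: "L m $ j \<le> l $ j \<and> l $ j < u' $ j \<and> u' $ j \<le> U m $ j" for j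
    using sub[OF P(1)] by (auto simp: Pe sub_box_def)
  have s: "side k l u' y" "y $ k = l $ k \<or> y $ k = u' $ k"
    using P(2) by (auto simp: Pe split: if_splits)
  have "L m $ j \<le> y $ j \<and> y $ j \<le> U m $ j" for j
    using b[of j] s by (cases "j = k") (auto simp: side_def dest!: spec[of _ j])
  then show ?thesis by (simp add: mem_box_cart)
qed

lemma jump_dens_support: "jump_dens (F m) j i z \<noteq> 0 \<Longrightarrow> hproj z \<in> cbox (L m) (U m)"
proof -
  assume "jump_dens (F m) j i z \<noteq> 0"
  then have "jump (F m) (fst (fst z)) (hproj z) \<noteq> 0"
    by (auto simp: jump_dens_def hproj_def split: prod.splits if_splits)
  then show ?thesis by (rule jump_support)
qed

lemma finite_meets: "finite {m. y \<in> cbox (L m) (U m)}"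
proof (cases "\<exists>m. y \<in> cbox (L m) (U m)")
  case True
  then obtain \<delta> where "0 < \<delta>" "finite {m'. cbox (L m') (U m') \<inter> ball y \<delta> \<noteq> {}}" using locally_finite by blast
  moreover have "{m. y \<in> cbox (L m) (U m)} \<subseteq> {m'. cbox (L m') (U m') \<inter> ball y \<delta> \<noteq> {}}"
    using \<open>0 < \<delta>\<close> centre_in_ball by blast
  ultimately show ?thesis by (auto intro: finite_subset)
qed simp

lemma sym_dens_support: "sym_dens m i j z \<noteq> 0 \<Longrightarrow> hproj z \<in> cbox (L m) (U m)"
  using jump_dens_support[of m j i z] jump_dens_support[of m i j z]
  by (cases "jump_dens (F m) j i z = 0") (auto simp: sym_dens_def)

lemma finite_sym_dens: "finite {m. sym_dens m i j z \<noteq> 0}"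
  by (rule finite_subset[OF _ finite_meets[of "hproj z"]]) (use sym_dens_support in blast)

lemma dens_sums: "(\<lambda>m. sym_dens m i j z) sums dens i j z"
proof -
  have "(\<lambda>m. sym_dens m i j z) sums (\<Sum>m\<in>{m. sym_dens m i j z \<noteq> 0}. sym_dens m i j z)"
    by (rule sums_finite[OF finite_sym_dens]) auto
  then show ?thesis unfolding dens_def by (simp add: sums_iff)
qed

lemma jump_dens_integrable: "integrable (hyper I) (jump_dens (F m) j i)"
  and jump_dens_integral: "(\<integral>z. \<bar>jump_dens (F m) j i z\<bar> \<partial>hyper I) \<le> (1 / 2) ^ m"
proof -
  have le: "(\<integral>\<^sup>+z. ennreal (norm (jump_dens (F m) j i z)) \<partial>hyper I) \<le> ennreal ((1 / 2) ^ m)"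
    using nn_integral_jump_dens[OF countable_I] mass by (rule order_trans)
  show int: "integrable (hyper I) (jump_dens (F m) j i)"
    using le by (intro integrableI_bounded) (auto intro: le_less_trans)
  have "ennreal (\<integral>z. norm (jump_dens (F m) j i z) \<partial>hyper I) = (\<integral>\<^sup>+z. ennreal (norm (jump_dens (F m) j i z)) \<partial>hyper I)"
    using int by (intro nn_integral_eq_integral[symmetric]) auto
  also note le
  finally show "(\<integral>z. \<bar>jump_dens (F m) j i z\<bar> \<partial>hyper I) \<le> (1 / 2) ^ m" by simp
qed

lemma sym_dens_integrable: "integrable (hyper I) (sym_dens m i j)"
  unfolding sym_dens_def[abs_def] using jump_dens_integrable by auto

lemma sym_dens_integral: "(\<integral>z. \<bar>sym_dens m i j z\<bar> \<partial>hyper I) \<le> (1 / 2) ^ m"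
proof -
  have "(\<integral>z. \<bar>sym_dens m i j z\<bar> \<partial>hyper I) \<le> (\<integral>z. (\<bar>jump_dens (F m) j i z\<bar> + \<bar>jump_dens (F m) i j z\<bar>) / 2 \<partial>hyper I)"
  proof (rule integral_mono)
    show "integrable (hyper I) (\<lambda>z. \<bar>sym_dens m i j z\<bar>)" using sym_dens_integrable by auto
    show "integrable (hyper I) (\<lambda>z. (\<bar>jump_dens (F m) j i z\<bar> + \<bar>jump_dens (F m) i j z\<bar>) / 2)"
      using jump_dens_integrable by auto
  qed (auto simp: sym_dens_def)
  also have "\<dots> = ((\<integral>z. \<bar>jump_dens (F m) j i z\<bar> \<partial>hyper I) + (\<integral>z. \<bar>jump_dens (F m) i j z\<bar> \<partial>hyper I)) / 2"
    using jump_dens_integrable by (simp add: Bochner_Integration.integral_add integrable_abs)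
  also have "\<dots> \<le> (1 / 2) ^ m"
    using jump_dens_integral[of m j i] jump_dens_integral[of m i j] by simp
  finally show ?thesis .
qed

text \<open>Termwise integration: at each point only finitely many terms are nonzero, and by
  \<open>mass\<close> the \<open>L^1\<close> norms of the terms are dominated by a geometric
  series.\<close>

lemma dens_series:
  assumes g [measurable]: "g \<in> hyper I \<rightarrow>\<^sub>M borel" and B: "\<And>z. \<bar>g z\<bar> \<le> B"
  shows "integrable (hyper I) (\<lambda>z. g z * dens i j z)"
    and "(\<lambda>m. \<integral>z. g z * sym_dens m i j z \<partial>hyper I) sums (\<integral>z. g z * dens i j z \<partial>hyper I)"
proof -
  have [measurable]: "sym_dens m i j \<in> hyper I \<rightarrow>\<^sub>M borel" for m
    using sym_dens_integrable by auto
  have B': "\<bar>g z\<bar> \<le> \<bar>B\<bar>" for z using B[of z] by linarith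
  have i: "integrable (hyper I) (\<lambda>z. g z * sym_dens m i j z)" for m
  proof (rule Bochner_Integration.integrable_bound)
    show "integrable (hyper I) (\<lambda>z. B * sym_dens m i j z)" using sym_dens_integrable by auto
    show "AE z in hyper I. norm (g z * sym_dens m i j z) \<le> norm (B * sym_dens m i j z)"
      using B' by (auto simp: abs_mult intro!: mult_right_mono)
  qed auto
  have s: "AE z in hyper I. summable (\<lambda>m. norm (g z * sym_dens m i j z))"
  proof (rule AE_I2)
    fix z show "summable (\<lambda>m. norm (g z * sym_dens m i j z))"
      by (rule summable_finite[OF finite_sym_dens[of i j z]]) auto
  qed
  have n: "summable (\<lambda>m. \<integral>z. norm (g z * sym_dens m i j z) \<partial>hyper I)"
  proof (rule summable_comparison_test')
    show "summable (\<lambda>m. \<bar>B\<bar> * (1 / 2) ^ m)" by (intro summable_mult summable_geometric) simp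
    fix m
    have "(\<integral>z. norm (g z * sym_dens m i j z) \<partial>hyper I) \<le> (\<integral>z. \<bar>B\<bar> * \<bar>sym_dens m i j z\<bar> \<partial>hyper I)"
    proof (rule integral_mono)
      show "integrable (hyper I) (\<lambda>z. norm (g z * sym_dens m i j z))" by (rule integrable_norm[OF i])
      show "integrable (hyper I) (\<lambda>z. \<bar>B\<bar> * \<bar>sym_dens m i j z\<bar>)"
        using integrable_abs[OF sym_dens_integrable] by (rule integrable_mult_right)
    qed (use B' in \<open>auto simp: abs_mult intro!: mult_right_mono\<close>)
    also have "\<dots> \<le> \<bar>B\<bar> * (1 / 2) ^ m"
      using sym_dens_integral by (simp add: mult_left_mono)
    finally show "norm (\<integral>z. norm (g z * sym_dens m i j z) \<partial>hyper I) \<le> \<bar>B\<bar> * (1 / 2) ^ m"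
      by simp
  qed
  have e: "(\<Sum>m. g z * sym_dens m i j z) = g z * dens i j z" for z
    using dens_sums[of i j z] by (metis sums_mult sums_unique)
  show "integrable (hyper I) (\<lambda>z. g z * dens i j z)"
    using integrable_suminf[OF i s n] unfolding e .
  show "(\<lambda>m. \<integral>z. g z * sym_dens m i j z \<partial>hyper I) sums (\<integral>z. g z * dens i j z \<partial>hyper I)"
    using sums_integral[OF i s n] unfolding e .
qed

lemma dens_integrable: "integrable (hyper I) (dens i j)"
  using dens_series(1)[of "\<lambda>_. 1" 1] by simp

lemma dens_sym: "dens i j z = dens j i z"
  unfolding dens_def sym_dens_def by (simp add: add.commute)

lemma sets_restrict_\<Omega>: "A \<in> sets (restrict_space borel \<Omega>) \<longleftrightarrow> A \<subseteq> \<Omega> \<and> A \<in> sets borel"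
  using \<Omega> by (subst sets_restrict_space_iff) auto

lemma Eu_signed:
  "\<exists>P N. finite_measure P \<and> finite_measure N \<and>
    sets P = sets (restrict_space borel \<Omega>) \<and> sets N = sets (restrict_space borel \<Omega>) \<and>
    (\<forall>A\<in>sets (restrict_space borel \<Omega>). Eu A $ i $ j = measure P A - measure N A) \<and>
    (\<forall>\<phi> B. \<phi> \<in> borel \<rightarrow>\<^sub>M borel \<longrightarrow> (\<forall>x. \<bar>\<phi> x\<bar> \<le> B) \<longrightarrow> (\<forall>x. x \<notin> \<Omega> \<longrightarrow> \<phi> x = (0::real)) \<longrightarrow>
      integrable P \<phi> \<and> integrable N \<phi> \<and> (\<integral>z. \<phi> (hproj z) * dens i j z \<partial>hyper I) = (\<integral>x. \<phi> x \<partial>P) - (\<integral>x. \<phi> x \<partial>N))"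
  using signed_image_integral[OF borel_open[OF \<Omega>] dens_integrable[of i j] hproj_measurable[OF countable_I]]
  by (simp add: Eu_def)

lemma vector_measure_Eu: "vector_measure_on \<Omega> Eu"
  unfolding vector_measure_on_def
proof (intro allI impI)
  fix A :: "nat \<Rightarrow> (real^'n) set"
  assume A: "range A \<subseteq> sets (restrict_space borel \<Omega>) \<and> disjoint_family A"
  have "(\<lambda>n. Eu (A n) $ i $ j) sums (Eu (\<Union>n. A n) $ i $ j)" for i j
  proof -
    obtain P N where P: "finite_measure P" "finite_measure N"
      "sets P = sets (restrict_space borel \<Omega>)" "sets N = sets (restrict_space borel \<Omega>)"
      "\<And>A. A \<in> sets (restrict_space borel \<Omega>) \<Longrightarrow> Eu A $ i $ j = measure P A - measure N A"
      using Eu_signed[of i j] by (elim exE conjE) blast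
    have "(\<lambda>n. measure P (A n)) sums measure P (\<Union>n. A n)" "(\<lambda>n. measure N (A n)) sums measure N (\<Union>n. A n)"
      using A P by (auto intro!: finite_measure.finite_measure_UNION)
    then have "(\<lambda>n. measure P (A n) - measure N (A n)) sums (measure P (\<Union>n. A n) - measure N (\<Union>n. A n))"
      by (rule sums_diff)
    moreover have "A n \<in> sets (restrict_space borel \<Omega>)" for n using A by auto
    moreover from this have "(\<Union>n. A n) \<in> sets (restrict_space borel \<Omega>)" by auto
    ultimately show ?thesis by (simp add: P(5))
  qed
  then show "(\<lambda>n. Eu (A n)) sums Eu (\<Union>n. A n)"
    unfolding sums_def by (intro vec_tendstoI) (simp add: sum_component)
qed

section \<open>Integration by parts for the whole series\<close>

lemma test_functionD:
  assumes "\<phi> \<in> test_functions \<Omega>"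
  shows "\<phi> differentiable (at x)" "continuous_on UNIV (partial j \<phi>)" "continuous_on UNIV \<phi>"
    "x \<notin> supp \<phi> \<Longrightarrow> \<phi> x = 0" "x \<notin> supp \<phi> \<Longrightarrow> partial j \<phi> x = 0" "compact (supp \<phi>)" "supp \<phi> \<subseteq> \<Omega>"
    "\<exists>B. \<forall>x. \<bar>\<phi> x\<bar> \<le> B"
proof -
  have C: "Ck k \<phi>" for k using assms by (simp add: test_functions_def)
  show d: "\<phi> differentiable (at x)" for x using C[of 1] by simp
  show "continuous_on UNIV (partial j \<phi>)" using C[of 1] by simp
  show c: "continuous_on UNIV \<phi>" using C[of 0] by simp
  show s: "compact (supp \<phi>)" "supp \<phi> \<subseteq> \<Omega>" using assms by (auto simp: test_functions_def)
  show z: "\<phi> x = 0" if "x \<notin> supp \<phi>" for x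
    using that closure_subset[of "{x. \<phi> x \<noteq> 0}"] unfolding supp_def by auto
  show "partial j \<phi> x = 0" if "x \<notin> supp \<phi>"
  proof -
    have "open (- supp \<phi>)" by (simp add: supp_def open_Compl)
    then have "(\<phi> has_derivative (\<lambda>h. 0)) (at x)"
      by (rule has_derivative_transform_within_open[OF has_derivative_const[of 0]]) (use that z in auto)
    then show ?thesis by (rule partial_eq)
  qed
  have "bounded (\<phi> ` supp \<phi>)"
    by (intro compact_imp_bounded compact_continuous_image s continuous_on_subset[OF c]) auto
  then obtain B where B: "\<And>x. x \<in> supp \<phi> \<Longrightarrow> \<bar>\<phi> x\<bar> \<le> B"
    by (auto simp: bounded_iff)
  have "\<bar>\<phi> x\<bar> \<le> max B 0" for x
    using B[of x] z[of x] by (cases "x \<in> supp \<phi>") auto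
  then show "\<exists>B. \<forall>x. \<bar>\<phi> x\<bar> \<le> B" by blast
qed

text \<open>Dominated convergence: since the boxes are disjoint, a partial sum has at most one
  nonzero term at each point, so it is bounded by 1 and vanishes off the compact set
  \<open>K\<close>.\<close>

lemma u_integral_sums:
  fixes h :: "real^'n \<Rightarrow> real"
  assumes h: "continuous_on UNIV h"
  shows "integrable lborel (\<lambda>x. u x $ i * h x)"
    and "(\<lambda>m. \<integral>x. ev (F m) x $ i * h x \<partial>lborel) sums (LBINT x. u x $ i * h x)"
proof -
  have [measurable]: "h \<in> borel \<rightarrow>\<^sub>M borel" using h by (rule borel_measurable_continuous_onI)
  have "bounded (h ` K)"
    by (intro compact_imp_bounded compact_continuous_image K(1) continuous_on_subset[OF h]) auto
  then obtain B where B: "\<And>x. x \<in> K \<Longrightarrow> \<bar>h x\<bar> \<le> B"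
    by (auto simp: bounded_iff)
  define w where "w = (\<lambda>x. B * indicat_real K x)"
  have w: "integrable lborel w"
    unfolding w_def using K(1) emeasure_lborel_cbox_finite emeasure_bounded_finite[OF compact_imp_bounded[OF K(1)]]
    by (intro integrable_mult_right integrable_real_indicator) (auto simp: compact_imp_closed)
  have part: "norm (\<Sum>m<n. ev (F m) x) \<le> 1" "x \<notin> K \<Longrightarrow> (\<Sum>m<n. ev (F m) x) = 0" for n x
  proof -
    obtain m where "u x = ev (F m) x" "\<And>m'. m' \<noteq> m \<Longrightarrow> ev (F m') x = 0" by (rule u_cases[of x]) blast
    then have "(\<Sum>m<n. ev (F m) x) = (if m < n then ev (F m) x else 0)"
      by (subst sum.mono_neutral_right[of "{..<n}" "{m} \<inter> {..<n}"]) auto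
    then show "norm (\<Sum>m<n. ev (F m) x) \<le> 1" using ev_bound by simp
    show "(\<Sum>m<n. ev (F m) x) = 0" if "x \<notin> K"
      using that hbox_K ev_zero by (intro sum.neutral) blast
  qed
  have dom: "norm (v $ i * h x) \<le> w x" if "norm v \<le> 1" "x \<notin> K \<Longrightarrow> v = 0" for v :: "real^'n" and x
  proof (cases "x \<in> K")
    case True
    have "\<bar>v $ i\<bar> \<le> 1" using that(1) component_le_norm_cart[of v i] by linarith
    then have "\<bar>v $ i\<bar> * \<bar>h x\<bar> \<le> 1 * B" using B[OF True] by (intro mult_mono) auto
    then show ?thesis using True by (simp add: w_def abs_mult)
  qed (use that in \<open>simp add: w_def\<close>)
  have lim: "(\<lambda>n. (\<Sum>m<n. ev (F m) x) $ i * h x) \<longlonglongrightarrow> u x $ i * h x" for x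
    using u_sums[of x] unfolding sums_def by (intro tendsto_mult tendsto_vec_nth tendsto_const)
  have D: "\<bar>(\<Sum>m<n. ev (F m) x) $ i * h x\<bar> \<le> w x" for n x
    using dom[OF part(1)[of x n] part(2)[of x n]] by (simp only: real_norm_def)
  have 1: "(\<lambda>n. \<integral>x. (\<Sum>m<n. ev (F m) x) $ i * h x \<partial>lborel) \<longlonglongrightarrow> (LBINT x. u x $ i * h x)"
    by (rule integral_dominated_convergence[OF _ _ w]) (simp_all add: lim D del: sum_component)
  show "integrable lborel (\<lambda>x. u x $ i * h x)"
    by (rule integrable_dominated_convergence[OF _ _ w, of _ "\<lambda>n x. (\<Sum>m<n. ev (F m) x) $ i * h x"]) (simp_all add: lim D del: sum_component)
  have "(LBINT x. (\<Sum>m<n. ev (F m) x) $ i * h x) = (\<Sum>m<n. \<integral>x. ev (F m) x $ i * h x \<partial>lborel)" for n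
    unfolding sum_component sum_distrib_right by (rule Bochner_Integration.integral_sum) (rule ev_integrable[OF h])
  then show "(\<lambda>m. \<integral>x. ev (F m) x $ i * h x \<partial>lborel) sums (LBINT x. u x $ i * h x)"
    using 1 unfolding sums_def by simp
qed

text \<open>By \<open>rigid_skew\<close> the gradient terms of \<open>hyper_list\<close> cancel
  under symmetrization, and only the face terms survive.\<close>

lemma sym_dens_by_parts:
  assumes \<phi>: "\<phi> \<in> test_functions \<Omega>"
  shows "(\<integral>z. \<phi> (hproj z) * sym_dens m i j z \<partial>hyper I) =
    - ((LBINT x. ev (F m) x $ i * partial j \<phi> x) + (LBINT x. ev (F m) x $ j * partial i \<phi> x)) / 2"
proof -
  obtain B where B: "\<And>x. \<bar>\<phi> x\<bar> \<le> B" using test_functionD(8)[OF \<phi>] by blast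
  note h = hyper_list[OF countable_I coords_I box_pieces test_functionD(1)[OF \<phi>] test_functionD(2)[OF \<phi>] B]
  define s where "s i j = (\<Sum>(l, u, G, d)\<leftarrow>F m. G $ i $ j * (LBINT x. indicator (hbox l u) x * \<phi> x))" for i j
  have "s i j = - s j i"
  proof -
    have "(\<Sum>(l, u, G, d)\<leftarrow>F'. G $ i $ j * (LBINT x. indicator (hbox l u) x * \<phi> x))
      = - (\<Sum>(l, u, G, d)\<leftarrow>F'. G $ j $ i * (LBINT x. indicator (hbox l u) x * \<phi> x))" if "set F' \<subseteq> set (F m)" for F'
      using that
    proof (induction F')
      case (Cons P F')
      obtain l u G d where P: "P = (l, u, G, d)" by (cases P)
      have "rigid p q G" using Cons.prems rig by (auto simp: P)
      then have "G $ i $ j = - G $ j $ i" by (rule rigid_skew)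
      then show ?case using Cons by (simp add: P)
    qed simp
    from this[of "F m"] show ?thesis by (simp add: s_def)
  qed
  moreover have "(\<integral>z. \<phi> (hproj z) * sym_dens m i j z \<partial>hyper I) =
    ((\<integral>z. \<phi> (hproj z) * jump_dens (F m) j i z \<partial>hyper I) + (\<integral>z. \<phi> (hproj z) * jump_dens (F m) i j z \<partial>hyper I)) / 2"
    using h[of m j i] h[of m i j]
    by (simp add: sym_dens_def distrib_left add_divide_distrib Bochner_Integration.integral_add[symmetric])
  ultimately show ?thesis
    using h[of m j i] h[of m i j] unfolding s_def[symmetric] by (simp add: field_simps)
qed

lemma integral_lebesgue_\<Omega>:
  assumes f [measurable]: "f \<in> borel \<rightarrow>\<^sub>M borel" and 0: "\<And>x. x \<notin> \<Omega> \<Longrightarrow> f x = (0::real)"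
  shows "(LINT x:\<Omega>|lebesgue. f x) = (LBINT x. f x)"
proof -
  have "(\<lambda>x. indicat_real \<Omega> x *\<^sub>R f x) = f" using 0 by (auto simp: indicator_def fun_eq_iff)
  then show ?thesis
    unfolding set_lebesgue_integral_def using integral_completion[of f lborel] by simp
qed

text \<open>The identity for each \<open>F m\<close> is summed over \<open>m\<close>;
  \<open>dens_series\<close> identifies the limit of one side and \<open>u_integral_sums\<close>
  that of the other.\<close>

lemma is_Eu: "is_Eu \<Omega> u Eu"
  unfolding is_Eu_def
proof (intro conjI ballI allI)
  show "vector_measure_on \<Omega> Eu" by (rule vector_measure_Eu)
  show "transpose (Eu A) = Eu A" for A
    by (simp add: Eu_def transpose_def vec_eq_iff dens_sym)
  fix \<phi> i j assume \<phi>: "\<phi> \<in> test_functions \<Omega>"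
  obtain P N where P: "finite_measure P" "finite_measure N"
    "sets P = sets (restrict_space borel \<Omega>)" "sets N = sets (restrict_space borel \<Omega>)"
    "\<forall>A\<in>sets (restrict_space borel \<Omega>). Eu A $ i $ j = measure P A - measure N A"
    "\<forall>\<phi> B. \<phi> \<in> borel \<rightarrow>\<^sub>M borel \<longrightarrow> (\<forall>x. \<bar>\<phi> x\<bar> \<le> B) \<longrightarrow> (\<forall>x. x \<notin> \<Omega> \<longrightarrow> \<phi> x = (0::real)) \<longrightarrow>
      integrable P \<phi> \<and> integrable N \<phi> \<and> (\<integral>z. \<phi> (hproj z) * dens i j z \<partial>hyper I) = (\<integral>x. \<phi> x \<partial>P) - (\<integral>x. \<phi> x \<partial>N)"
    using Eu_signed[of i j] by (elim exE conjE) blast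
  obtain B where B: "\<And>x. \<bar>\<phi> x\<bar> \<le> B" using test_functionD(8)[OF \<phi>] by blast
  have m [measurable]: "\<phi> \<in> borel \<rightarrow>\<^sub>M borel" "partial k \<phi> \<in> borel \<rightarrow>\<^sub>M borel" for k
    using test_functionD(2,3)[OF \<phi>] by (auto intro: borel_measurable_continuous_onI)
  have out: "\<phi> x = 0" "partial k \<phi> x = 0" if "x \<notin> \<Omega>" for x k
    using that test_functionD(4,5,7)[OF \<phi>] by auto
  have pn: "integrable P \<phi> \<and> integrable N \<phi> \<and> (\<integral>z. \<phi> (hproj z) * dens i j z \<partial>hyper I) = (\<integral>x. \<phi> x \<partial>P) - (\<integral>x. \<phi> x \<partial>N)"
    by (rule P(6)[rule_format, of \<phi> B]) (use m(1) B out(1) in auto)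
  have "(\<lambda>m. - ((LBINT x. ev (F m) x $ i * partial j \<phi> x) + (LBINT x. ev (F m) x $ j * partial i \<phi> x)) / 2)
      sums (\<integral>z. \<phi> (hproj z) * dens i j z \<partial>hyper I)"
    using dens_series(2)[of "\<lambda>z. \<phi> (hproj z)" B i j] B unfolding sym_dens_by_parts[OF \<phi>] by simp
  moreover have "(\<lambda>m. - ((LBINT x. ev (F m) x $ i * partial j \<phi> x) + (LBINT x. ev (F m) x $ j * partial i \<phi> x)) / 2)
      sums (- ((LBINT x. u x $ i * partial j \<phi> x) + (LBINT x. u x $ j * partial i \<phi> x)) / 2)"
    by (intro sums_divide sums_minus sums_add u_integral_sums(2) test_functionD(2)[OF \<phi>])
  ultimately have "(\<integral>z. \<phi> (hproj z) * dens i j z \<partial>hyper I) =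
      - ((LBINT x. u x $ i * partial j \<phi> x) + (LBINT x. u x $ j * partial i \<phi> x)) / 2"
    by (rule sums_unique2)
  also have "\<dots> = - (LBINT x. (u x $ i * partial j \<phi> x + u x $ j * partial i \<phi> x) / 2)"
    using u_integral_sums(1)[OF test_functionD(2)[OF \<phi>]] by (simp add: add_divide_distrib)
  also have "\<dots> = - (LINT x:\<Omega>|lebesgue. (u x $ i * partial j \<phi> x + u x $ j * partial i \<phi> x) / 2)"
    by (subst integral_lebesgue_\<Omega>) (use out in auto)
  finally have e: "(\<integral>z. \<phi> (hproj z) * dens i j z \<partial>hyper I) = \<dots>" .
  show "has_signed_integral \<Omega> (\<lambda>A. Eu A $ i $ j) \<phi>
      (- (LINT x:\<Omega>|lebesgue. (u x $ i * partial j \<phi> x + u x $ j * partial i \<phi> x) / 2))"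
    unfolding has_signed_integral_def e[symmetric]
    using P(1-5) pn by (intro exI[of _ P] exI[of _ N]) (simp only: simp_thms)
qed

lemma borel_integrable_K:
  fixes f :: "real^'n \<Rightarrow> 'b::euclidean_space"
  assumes f [measurable]: "f \<in> borel \<rightarrow>\<^sub>M borel" and B: "\<And>x. norm (f x) \<le> B" and 0: "\<And>x. x \<notin> K \<Longrightarrow> f x = 0"
  shows "set_integrable lebesgue \<Omega> f"
proof -
  have "integrable lborel f"
  proof (rule Bochner_Integration.integrable_bound)
    show "integrable lborel (\<lambda>x. B * indicat_real K x)"
      using K(1) emeasure_bounded_finite[OF compact_imp_bounded[OF K(1)]]
      by (intro integrable_mult_right integrable_real_indicator) (auto simp: compact_imp_closed)
    have "norm (f x) \<le> \<bar>B\<bar>" for x using B[of x] by linarith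
    then show "AE x in lborel. norm (f x) \<le> norm (B * indicat_real K x)"
      using 0 by (auto simp: indicator_def)
  qed auto
  moreover have "(\<lambda>x. indicat_real \<Omega> x *\<^sub>R f x) = f"
    using 0 K(2) by (auto simp: indicator_def fun_eq_iff)
  ultimately show ?thesis
    unfolding set_integrable_def using integrable_completion[of f lborel] by simp
qed

lemma u_Linfty: "u \<in> Linfty \<Omega>"
proof -
  have "u \<in> lebesgue \<rightarrow>\<^sub>M borel" by (simp add: measurable_completion)
  then have "u \<in> borel_measurable (lebesgue_on \<Omega>)" by (rule measurable_restrict_space1)
  then show ?thesis unfolding Linfty_def using norm_u by auto
qed

lemma u_BD: "u \<in> BD \<Omega>"
  unfolding BD_def using is_Eu borel_integrable_K[OF u_measurable norm_u u_outside] by auto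

text \<open>\<open>Eu\<close> is carried by the countably many hyperplanes in \<open>I\<close>,
  which form a Lebesgue null set, so it is its own singular part.\<close>

lemma decomposition: "lebesgue_decomposition \<Omega> Eu (\<lambda>_. 0) Eu"
  unfolding lebesgue_decomposition_def
proof (intro conjI ballI)
  show "set_integrable lebesgue \<Omega> (\<lambda>_. 0 :: real^'n^'n)" by (simp add: set_integrable_def)
  show "vector_measure_on \<Omega> Eu" by (rule vector_measure_Eu)
  show "Eu A = (LINT x:A|lebesgue. 0) + Eu A" for A by (simp add: set_lebesgue_integral_def)
  define S where "S = \<Omega> \<inter> (\<Union>(k, t)\<in>I. {x. x $ k = t})"
  have "(\<Union>(k, t)\<in>I. {x::real^'n. x $ k = t}) \<in> null_sets lborel"
    using null_hyperplane by (intro null_sets_UN' countable_I) auto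
  then have S0: "S \<in> null_sets lborel"
    unfolding S_def using \<Omega> by (intro null_set_Int1) auto
  show "\<exists>S\<in>sets (restrict_space borel \<Omega>). S \<in> null_sets lebesgue \<and>
      (\<forall>A\<in>sets (restrict_space borel \<Omega>). A \<inter> S = {} \<longrightarrow> Eu A = 0)"
  proof (intro bexI conjI ballI impI)
    show "S \<in> sets (restrict_space borel \<Omega>)" using S0 unfolding sets_restrict_\<Omega> by (auto simp: S_def)
    show "S \<in> null_sets lebesgue" using S0 by (rule null_sets_completionI)
    fix A assume A: "A \<in> sets (restrict_space borel \<Omega>)" "A \<inter> S = {}"
    have "(\<integral>z. indicator A (hproj z) * dens i j z \<partial>hyper I) = (\<integral>z. 0 \<partial>hyper I)" for i j
    proof (rule Bochner_Integration.integral_cong)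
      fix z assume "z \<in> space (hyper I)"
      then have "hproj z \<in> (\<Union>(k, t)\<in>I. {x. x $ k = t})"
        by (force simp: hyper_def space_pair_measure hproj_def)
      then have "hproj z \<notin> A" using A unfolding sets_restrict_\<Omega> S_def by blast
      then show "indicator A (hproj z) * dens i j z = 0" by simp
    qed simp
    then show "Eu A = 0" by (simp add: Eu_def vec_eq_iff)
  qed
qed

lemma is_e_zero: "is_e \<Omega> u (\<lambda>_. 0)"
  unfolding is_e_def using is_Eu decomposition by blast

end


section \<open>The singular part is carried by the jump set\<close>

lemma matrix_bound:
  obtains C where "0 < C" "\<And>v. norm ((G::real^'n^'m) *v v) \<le> C * norm v"
  using bounded_linear.pos_bounded[OF matrix_vector_mul_bounded_linear[of G]] by (metis mult.commute)

context piece_seq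
begin

definition total_jump :: "'n \<Rightarrow> real^'n \<Rightarrow> real^'n" where
  "total_jump k y = (\<Sum>m. jump (F m) k y)"

lemma total_jump_sums: "(\<lambda>m. jump (F m) k y) sums total_jump k y"
proof -
  have "finite {m. jump (F m) k y \<noteq> 0}"
    by (rule finite_subset[OF _ finite_meets[of y]]) (use jump_support in blast)
  then have "(\<lambda>m. jump (F m) k y) sums (\<Sum>m\<in>{m. jump (F m) k y \<noteq> 0}. jump (F m) k y)"
    by (rule sums_finite) auto
  then show ?thesis unfolding total_jump_def by (simp add: sums_iff)
qed

text \<open>By local finiteness only finitely many families meet a small ball around
  \<open>y\<close>. There \<open>u\<close> is given by one finite list \<open>E\<close>, and
  \<open>ev_local\<close> supplies the one-sided limits.\<close>

lemma jump_set_generic: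
  assumes gen: "\<And>j t. j \<noteq> k \<Longrightarrow> (j, t) \<in> I \<Longrightarrow> y $ j \<noteq> t" and nz: "total_jump k y \<noteq> 0"
  shows "y \<in> jump_set \<Omega> u"
proof -
  have "\<exists>m. jump (F m) k y \<noteq> 0"
    using nz unfolding total_jump_def by (rule contrapos_np) simp
  then obtain m where m: "y \<in> cbox (L m) (U m)" using jump_support by blast
  then have y\<Omega>: "y \<in> \<Omega>" using K(2,3) by blast
  obtain \<delta> where \<delta>: "0 < \<delta>" and fin: "finite {m'. cbox (L m') (U m') \<inter> ball y \<delta> \<noteq> {}}" using locally_finite[OF m] by blast
  define S where "S = {m'. cbox (L m') (U m') \<inter> ball y \<delta> \<noteq> {}}"
  define E where "E = concat (map F (sorted_list_of_set S))"
  have fS: "finite S" using fin by (simp add: S_def)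
  have evE: "ev E x = (\<Sum>m\<in>S. ev (F m) x)" for x
  proof -
    have "ev (concat (map F ms)) x = (\<Sum>m\<leftarrow>ms. ev (F m) x)" for ms by (induction ms) auto
    then show ?thesis using fS by (simp add: E_def sum_list_distinct_conv_sum_set)
  qed
  have jE: "jump E k x = (\<Sum>m\<in>S. jump (F m) k x)" for x
  proof -
    have "jump (concat (map F ms)) k x = (\<Sum>m\<leftarrow>ms. jump (F m) k x)" for ms by (induction ms) auto
    then show ?thesis using fS by (simp add: E_def sum_list_distinct_conv_sum_set)
  qed
  have uE: "u x = ev E x" if "x \<in> ball y \<delta>" for x
  proof -
    have "ev (F m) x = 0" if "m \<notin> S" for m
      using that \<open>x \<in> ball y \<delta>\<close> hbox_cbox[of "L m" "U m"] by (intro ev_zero) (auto simp: S_def)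
    then show ?thesis unfolding u_def evE using fS by (intro suminf_finite) auto
  qed
  have jy: "jump E k y = total_jump k y"
  proof -
    have "jump (F m) k y = 0" if "m \<notin> S" for m
      using that jump_support[of m k y] \<delta> by (auto simp: S_def)
    then show ?thesis unfolding total_jump_def jE using fS by (intro suminf_finite[symmetric]) auto
  qed
  have "\<forall>P\<in>set E. box_piece P" using box_pieces fS by (auto simp: E_def)
  moreover have "coords E \<subseteq> I" using coords_I fS unfolding E_def coords_def by fastforce
  ultimately obtain G d G' d' where loc: "\<forall>\<^sub>F x in nhds y. (y $ k < x $ k \<longrightarrow> ev E x = G *v x + d) \<and>
      (x $ k < y $ k \<longrightarrow> ev E x = G' *v x + d')" and J: "(G *v y + d) - (G' *v y + d') = jump E k y"
    using ev_local[of E k y] gen by blast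
  have ball: "\<forall>\<^sub>F x in nhds y. x \<in> ball y \<delta>"
    by (rule eventually_nhds_in_open) (use \<delta> in auto)
  obtain C where C: "0 < C" "\<And>v. norm (G *v v) \<le> C * norm v" using matrix_bound[of G] by blast
  obtain C' where C': "0 < C'" "\<And>v. norm (G' *v v) \<le> C' * norm v" using matrix_bound[of G'] by blast
  have "half_ball_limit u y (axis k 1) (G *v y + d)"
  proof (rule half_ball_limit_local)
    show "\<forall>\<^sub>F x in nhds y. 0 < (x - y) \<bullet> axis k 1 \<longrightarrow> norm (u x - (G *v y + d)) \<le> C * norm (x - y)"
      using loc ball
    proof eventually_elim
      case (elim x)
      then show ?case using C(2)[of "x - y"] uE[of x] by (auto simp: inner_axis matrix_vector_mult_diff_distrib)
    qed
  qed (use C in simp)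
  moreover have "half_ball_limit u y (- axis k 1) (G' *v y + d')"
  proof (rule half_ball_limit_local)
    show "\<forall>\<^sub>F x in nhds y. 0 < (x - y) \<bullet> (- axis k 1) \<longrightarrow> norm (u x - (G' *v y + d')) \<le> C' * norm (x - y)"
      using loc ball
    proof eventually_elim
      case (elim x)
      then show ?case using C'(2)[of "x - y"] uE[of x] by (auto simp: inner_axis matrix_vector_mult_diff_distrib)
    qed
  qed (use C' in simp)
  moreover have "G *v y + d \<noteq> G' *v y + d'" using J jy nz by auto
  moreover have "norm (axis k (1::real)) = 1" by simp
  ultimately show ?thesis unfolding jump_set_def using y\<Omega> by blast
qed

text \<open>This is the density of the symmetrized product of the jump with the normal
  \<open>axis k 1\<close>, as in the structure formula for the jump part of
  \<open>Eu\<close>.\<close>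

lemma dens_total_jump:
  "dens i j ((k, t), x) = indicator (strip k) x *
     (of_bool (k = j) * total_jump k (upd x k t) $ i + of_bool (k = i) * total_jump k (upd x k t) $ j) / 2"
proof -
  have n: "(\<lambda>m. jump (F m) k (upd x k t) $ i) sums (total_jump k (upd x k t) $ i)" for i
    using bounded_linear.sums[OF bounded_linear_vec_nth total_jump_sums] .
  have "(\<lambda>m. (of_bool (k = j) * (indicator (strip k) x * jump (F m) k (upd x k t) $ i) + of_bool (k = i) * (indicator (strip k) x * jump (F m) k (upd x k t) $ j)) / 2)
     sums ((of_bool (k = j) * (indicator (strip k) x * total_jump k (upd x k t) $ i) + of_bool (k = i) * (indicator (strip k) x * total_jump k (upd x k t) $ j)) / 2)"
    by (intro sums_divide sums_add sums_mult n)
  also have "(\<lambda>m. (of_bool (k = j) * (indicator (strip k) x * jump (F m) k (upd x k t) $ i) + of_bool (k = i) * (indicator (strip k) x * jump (F m) k (upd x k t) $ j)) / 2)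
    = (\<lambda>m. sym_dens m i j ((k, t), x))"
    by (simp add: sym_dens_def jump_dens_def)
  finally show ?thesis
    using dens_sums[of i j "((k, t), x)"] by (auto dest: sums_unique2 simp: algebra_simps)
qed

text \<open>Here \<open>snd z\<close> is the strip variable: one of its coordinates is overwritten
  by \<open>hproj\<close>, the others are those of \<open>hproj z\<close>. So almost every point of
  the hyperplanes is in general position for \<open>jump_set_generic\<close>.\<close>

lemma AE_generic: "AE z in hyper I. \<forall>(j, t)\<in>I. snd z $ j \<noteq> t"
proof (rule AE_ball_countable'[OF _ countable_I])
  fix \<kappa> assume "\<kappa> \<in> I"
  obtain j t where \<kappa>: "\<kappa> = (j, t)" by (cases \<kappa>)
  have "emeasure (hyper I) (I \<times> {x. x $ j = t}) = emeasure (count_space I) I * emeasure lborel {x::real^'n. x $ j = t}"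
    unfolding hyper_def by (rule lborel.emeasure_pair_measure_Times) (use null_hyperplane in auto)
  also have "\<dots> = 0" using null_hyperplane[of j t] by auto
  finally have e: "emeasure (hyper I) (I \<times> {x. x $ j = t}) = 0" .
  have "{z \<in> space (hyper I). \<not> snd z $ j \<noteq> t} = I \<times> {x. x $ j = t}"
    by (auto simp: hyper_def space_pair_measure)
  moreover have "I \<times> {x. x $ j = t} \<in> sets (hyper I)"
    unfolding hyper_def by (rule pair_measureI) (use null_hyperplane in auto)
  ultimately have "AE z in hyper I. snd z $ j \<noteq> t"
    using e by (intro AE_I[of _ _ "I \<times> {x. x $ j = t}"]) auto
  then show "AE z in hyper I. case \<kappa> of (j, t) \<Rightarrow> snd z $ j \<noteq> t" by (simp add: \<kappa>)
qed

text \<open>At almost every point of the hyperplanes either the total jump, and with it the density,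
  is \<open>0\<close>, or the point is in the jump set and hence not in \<open>A\<close>.\<close>

lemma Eu_jump_set:
  assumes A: "A \<inter> jump_set \<Omega> u = {}" "A \<in> sets borel"
  shows "Eu A = 0"
proof -
  have "(\<integral>z. indicator A (hproj z) * dens i j z \<partial>hyper I) = 0" for i j
  proof (rule integral_eq_zero_AE)
    show "AE z in hyper I. indicator A (hproj z) * dens i j z = 0"
      using AE_generic
    proof eventually_elim
      case (elim z)
      obtain k t x where z: "z = ((k, t), x)" by (metis surj_pair)
      show ?case
      proof (cases "total_jump k (upd x k t) = 0")
        case True
        then show ?thesis by (simp add: z dens_total_jump)
      next
        case False
        then have "upd x k t \<in> jump_set \<Omega> u"
          by (rule jump_set_generic[rotated]) (use elim in \<open>auto simp: z\<close>)
        then show ?thesis using A by (auto simp: z hproj_def indicator_def)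
      qed
    qed
  qed
  then show ?thesis by (simp add: Eu_def vec_eq_iff)
qed

lemma u_SBD: "u \<in> SBD \<Omega>"
proof -
  have "\<forall>A\<in>sets (restrict_space borel \<Omega>). A \<inter> jump_set \<Omega> u = {} \<longrightarrow> Eu A = 0"
    by (auto simp: sets_restrict_\<Omega> intro!: Eu_jump_set)
  then have "is_Eu \<Omega> u Eu \<and> lebesgue_decomposition \<Omega> Eu (\<lambda>_. 0) Eu \<and>
      (\<forall>A\<in>sets (restrict_space borel \<Omega>). A \<inter> jump_set \<Omega> u = {} \<longrightarrow> Eu A = 0)"
    using is_Eu decomposition by (intro conjI)
  then show ?thesis unfolding SBD_def mem_Collect_eq
    by (intro conjI[OF u_BD] exI)
qed

end

section \<open>Approximate gradients\<close>

lemma has_approx_gradient_affine: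
  fixes u :: "real^'n \<Rightarrow> real^'n"
  assumes "\<forall>\<^sub>F y in nhds x. u y = G *v y + d"
  shows "has_approx_gradient u G x"
proof -
  obtain \<delta> where \<delta>: "0 < \<delta>" "\<And>y. dist y x < \<delta> \<Longrightarrow> u y = G *v y + d"
    using assms unfolding eventually_nhds_metric by blast
  have 0: "(LINT y:ball x r|lebesgue. norm (u y - (G *v x + d) - G *v (y - x)) / r) / measure lebesgue (ball x r) = 0"
    if "0 < r" "r < \<delta>" for r
  proof -
    have "u y - (G *v x + d) - G *v (y - x) = 0" if "y \<in> ball x r" for y
      using \<delta>(2)[of y] that \<open>r < \<delta>\<close> by (simp add: dist_commute matrix_vector_mult_diff_distrib)
    then have "(\<lambda>y. indicat_real (ball x r) y *\<^sub>R (norm (u y - (G *v x + d) - G *v (y - x)) / r)) = (\<lambda>y. 0)"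
      by (auto simp: indicator_def fun_eq_iff)
    then show ?thesis unfolding set_lebesgue_integral_def by simp
  qed
  have "\<forall>\<^sub>F r in at_right 0. 0 < r \<and> r < \<delta>"
    using \<delta>(1) by (auto simp: eventually_at_right[of 0 1] intro!: exI[of _ \<delta>])
  then have "((\<lambda>r. (LINT y:ball x r|lebesgue. norm (u y - (G *v x + d) - G *v (y - x)) / r) / measure lebesgue (ball x r)) \<longlongrightarrow> 0) (at_right 0)"
    by (intro tendsto_eventually, elim eventually_mono) (rule 0, simp_all)
  then show ?thesis unfolding has_approx_gradient_def by blast
qed

text \<open>For affine \<open>w\<close> with gradient \<open>M \<noteq> 0\<close>, one of the values at \<open>x \<plusminus> (r / 2) v\<close> is at least of
  order \<open>r\<close>, hence so is \<open>w\<close> on a ball of radius comparable to \<open>r\<close>.\<close>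

lemma affine_average_lower_bound:
  fixes M :: "real^'n^'n"
  assumes "M \<noteq> 0"
  obtains \<kappa> where "0 < \<kappa>" "\<And>c x r. 0 < r \<Longrightarrow>
    \<kappa> \<le> (LINT y:ball x r|lebesgue. norm (c + M *v (y - x)) / r) / measure lebesgue (ball x r)"
proof -
  obtain v0 where v0: "M *v v0 \<noteq> 0"
    using assms by (metis matrix_eq matrix_vector_mult_0)
  define v where "v = v0 /\<^sub>R norm v0"
  have nz: "v0 \<noteq> 0" using v0 by auto
  have v: "norm v = 1" using nz by (simp add: v_def)
  define g where "g = norm (M *v v)"
  have g: "0 < g" using v0 nz by (simp add: g_def v_def matrix_vector_mult_scaleR)
  obtain C where C: "0 < C" "\<And>w. norm (M *v w) \<le> C * norm w" using matrix_bound[of M] by blast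
  \<comment> \<open>The bound \<open>1 / 2\<close> keeps the ball around \<open>x + w\<close> inside
    \<open>ball x r\<close>; the bound \<open>g / (4 * C)\<close> lets the norm drop by at most
    \<open>g * r / 4\<close> on it.\<close>
  define \<eta> where "\<eta> = min (1 / 2) (g / (4 * C))"
  have \<eta>: "0 < \<eta>" "\<eta> \<le> 1 / 2" "C * \<eta> \<le> g / 4"
    using g C(1) by (auto simp: \<eta>_def min_def field_simps)
  show thesis
  proof (rule that[of "g / 4 * \<eta> ^ CARD('n)"])
    show "0 < g / 4 * \<eta> ^ CARD('n)" using g \<eta> by simp
    fix c x :: "real^'n" and r :: real assume r: "0 < r"
    have cont: "continuous_on S (\<lambda>y. norm (c + M *v (y - x)) / r)" for S
      using r by (intro continuous_intros linear_continuous_on_compose[OF _ matrix_vector_mul_linear]) auto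
    have meas [measurable]: "(\<lambda>y. norm (c + M *v (y - x)) / r) \<in> borel \<rightarrow>\<^sub>M borel"
      by (rule borel_measurable_continuous_onI[OF cont])
    have "norm (c + M *v ((r / 2) *\<^sub>R v)) + norm (c + M *v (- (r / 2) *\<^sub>R v)) \<ge> g * r"
    proof -
      have "(c + M *v ((r / 2) *\<^sub>R v)) - (c + M *v (- (r / 2) *\<^sub>R v)) = r *\<^sub>R (M *v v)"
        by (simp only: matrix_vector_mult_scaleR) (simp flip: scaleR_add_left)
      then have "norm ((c + M *v ((r / 2) *\<^sub>R v)) - (c + M *v (- (r / 2) *\<^sub>R v))) = g * r"
        using r by (simp add: g_def)
      then show ?thesis using norm_triangle_ineq4[of "c + M *v ((r / 2) *\<^sub>R v)" "c + M *v (- (r / 2) *\<^sub>R v)"] by linarith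
    qed
    then have "g * r / 2 \<le> norm (c + M *v ((r / 2) *\<^sub>R v)) \<or> g * r / 2 \<le> norm (c + M *v (- (r / 2) *\<^sub>R v))"
      by linarith
    then obtain w where w: "norm w = r / 2" "g * r / 2 \<le> norm (c + M *v w)"
    proof
      assume "g * r / 2 \<le> norm (c + M *v ((r / 2) *\<^sub>R v))"
      then show thesis by (rule that[rotated]) (use v r in simp)
    next
      assume "g * r / 2 \<le> norm (c + M *v (- (r / 2) *\<^sub>R v))"
      then show thesis by (rule that[rotated]) (use v r in simp)
    qed
    define B where "B = ball (x + w) (\<eta> * r)"
    have sub: "B \<subseteq> ball x r"
    proof
      fix y assume "y \<in> B"
      then have "norm (y - (x + w)) < \<eta> * r" by (simp add: B_def dist_norm norm_minus_commute)
      moreover have "norm (y - x) \<le> norm (y - (x + w)) + norm w"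
        using norm_triangle_ineq[of "y - (x + w)" w] by simp
      moreover have "\<eta> * r \<le> 1 / 2 * r" using \<eta> r by (intro mult_right_mono) auto
      ultimately show "y \<in> ball x r" using w by (simp add: dist_norm norm_minus_commute)
    qed
    have low: "g / 4 \<le> norm (c + M *v (y - x)) / r" if "y \<in> B" for y
    proof -
      have "norm (y - (x + w)) \<le> \<eta> * r" using that by (simp add: B_def dist_norm norm_minus_commute)
      then have "norm (M *v (y - (x + w))) \<le> C * (\<eta> * r)"
        using C(2)[of "y - (x + w)"] C(1) mult_left_mono[of "norm (y - (x + w))" "\<eta> * r" C] by linarith
      also have "\<dots> \<le> g / 4 * r" using \<eta>(3) r by (simp add: mult.assoc[symmetric] mult_right_mono)
      finally have "norm (M *v (y - (x + w))) \<le> g / 4 * r" .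
      moreover have "c + M *v w = (c + M *v (y - x)) - M *v (y - (x + w))"
        by (simp add: matrix_vector_mult_diff_distrib matrix_vector_right_distrib)
      then have "norm (c + M *v w) \<le> norm (c + M *v (y - x)) + norm (M *v (y - (x + w)))"
        by (metis norm_triangle_ineq4)
      ultimately have "g * r / 4 \<le> norm (c + M *v (y - x))" using w(2) by linarith
      then show ?thesis using r by (simp add: field_simps)
    qed
    have mB: "measure lebesgue B = \<eta> ^ CARD('n) * measure lebesgue (ball x r)"
      using r \<eta> by (simp add: B_def content_ball power_mult_distrib)
    have fin: "emeasure lebesgue B < \<infinity>" unfolding B_def
      using emeasure_lborel_ball_finite[of "x + w" "\<eta> * r"] by simp
    have "g / 4 * measure lebesgue B = (\<integral>y. g / 4 * indicat_real B y \<partial>lebesgue)" by (simp add: B_def)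
    also have "\<dots> \<le> (LINT y:ball x r|lebesgue. norm (c + M *v (y - x)) / r)"
      unfolding set_lebesgue_integral_def
    proof (rule integral_mono)
      show "integrable lebesgue (\<lambda>y. g / 4 * indicat_real B y)"
        using fin by (intro integrable_mult_right integrable_real_indicator) (auto simp: B_def)
      have "integrable lborel (\<lambda>y. indicat_real (cball x r) y *\<^sub>R (norm (c + M *v (y - x)) / r))"
        by (rule borel_integrable_compact) (auto intro: cont)
      then have "integrable lborel (\<lambda>y. indicat_real (ball x r) y *\<^sub>R (indicat_real (cball x r) y *\<^sub>R (norm (c + M *v (y - x)) / r)))"
        by (rule integrable_mult_indicator[rotated]) simp
      also have "(\<lambda>y. indicat_real (ball x r) y *\<^sub>R (indicat_real (cball x r) y *\<^sub>R (norm (c + M *v (y - x)) / r)))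
        = (\<lambda>y. indicat_real (ball x r) y *\<^sub>R (norm (c + M *v (y - x)) / r))"
        by (auto simp: indicator_def fun_eq_iff)
      finally show "integrable lebesgue (\<lambda>y. indicat_real (ball x r) y *\<^sub>R (norm (c + M *v (y - x)) / r))"
        by (subst integrable_completion) auto
      fix y show "g / 4 * indicat_real B y \<le> indicat_real (ball x r) y *\<^sub>R (norm (c + M *v (y - x)) / r)"
        using low[of y] sub r by (auto simp: indicator_def)
    qed
    finally have "g / 4 * \<eta> ^ CARD('n) * measure lebesgue (ball x r) \<le> (LINT y:ball x r|lebesgue. norm (c + M *v (y - x)) / r)"
      by (simp add: mB mult.assoc)
    moreover have "0 < measure lebesgue (ball x r)" using content_ball_pos[OF r] by simp
    ultimately show "g / 4 * \<eta> ^ CARD('n) \<le> (LINT y:ball x r|lebesgue. norm (c + M *v (y - x)) / r) / measure lebesgue (ball x r)"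
      by (simp only: pos_le_divide_eq)
  qed
qed

text \<open>For a second matrix the averages would stay above the constant of
  \<open>affine_average_lower_bound\<close>, whatever limit value \<open>z\<close> is chosen. This
  justifies \<open>THE\<close> in \<open>approx_gradient\<close>.\<close>

lemma has_approx_gradient_unique:
  fixes u :: "real^'n \<Rightarrow> real^'n"
  assumes aff: "\<forall>\<^sub>F y in nhds x. u y = G *v y + d" and H: "has_approx_gradient u H x"
  shows "H = G"
proof (rule ccontr)
  assume "H \<noteq> G"
  then have "G - H \<noteq> 0" by simp
  then obtain \<kappa> where \<kappa>: "0 < \<kappa>" "\<And>c x r. 0 < r \<Longrightarrow>
    \<kappa> \<le> (LINT y:ball x r|lebesgue. norm (c + (G - H) *v (y - x)) / r) / measure lebesgue (ball x r)"
    by (rule affine_average_lower_bound) blast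
  obtain \<delta> where \<delta>: "0 < \<delta>" "\<And>y. dist y x < \<delta> \<Longrightarrow> u y = G *v y + d"
    using aff unfolding eventually_nhds_metric by blast
  obtain z where lim: "((\<lambda>r. (LINT y:ball x r|lebesgue. norm (u y - z - H *v (y - x)) / r)
                   / measure lebesgue (ball x r)) \<longlongrightarrow> 0) (at_right 0)"
    using H unfolding has_approx_gradient_def by blast
  have "\<forall>\<^sub>F r in at_right 0. 0 < r \<and> r < \<delta>"
    using \<delta>(1) by (auto simp: eventually_at_right[of 0 1] intro!: exI[of _ \<delta>])
  then have "\<forall>\<^sub>F r in at_right 0. \<kappa> \<le> (LINT y:ball x r|lebesgue. norm (u y - z - H *v (y - x)) / r) / measure lebesgue (ball x r)"
  proof eventually_elim
    case (elim r)
    have "u y - z - H *v (y - x) = (G *v x + d - z) + (G - H) *v (y - x)" if "y \<in> ball x r" for y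
      using \<delta>(2)[of y] that elim by (simp add: dist_commute matrix_vector_mult_diff_distrib matrix_diff_mult)
    then have "indicat_real (ball x r) y *\<^sub>R (norm (u y - z - H *v (y - x)) / r) =
       indicat_real (ball x r) y *\<^sub>R (norm ((G *v x + d - z) + (G - H) *v (y - x)) / r)" for y
      by (cases "y \<in> ball x r") (simp_all only: indicator_simps, simp)
    then have "(LINT y:ball x r|lebesgue. norm (u y - z - H *v (y - x)) / r) =
       (LINT y:ball x r|lebesgue. norm ((G *v x + d - z) + (G - H) *v (y - x)) / r)"
      unfolding set_lebesgue_integral_def by (simp only:)
    then show ?case using \<kappa>(2)[of r x "G *v x + d - z"] elim by simp
  qed
  then have "\<kappa> \<le> 0"
    by (intro tendsto_lowerbound[OF lim]) auto
  then show False using \<kappa>(1) by simp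
qed

lemma approx_gradient_affine:
  fixes u :: "real^'n \<Rightarrow> real^'n"
  assumes "\<forall>\<^sub>F y in nhds x. u y = G *v y + d"
  shows "approx_gradient u x = G"
proof -
  have "(THE G. has_approx_gradient u G x) = G"
    using has_approx_gradient_affine[OF assms] has_approx_gradient_unique[OF assms] by (rule the_equality)
  then show ?thesis
    unfolding approx_gradient_def using has_approx_gradient_affine[OF assms] by auto
qed

section \<open>Values and gradients on disjoint pieces\<close>

lemma ev_piece:
  assumes "disjoint_pieces F" "(l, u, G, d) \<in> set F" "x \<in> hbox l u"
  shows "ev F x = G *v x + d"
  using assms
proof (induction F)
  case (Cons P F)
  show ?case
  proof (cases "P = (l, u, G, d)")
    case True
    have "piece_ev x P' = 0" if "P' \<in> set F" for P'
      using Cons.prems True that by (intro piece_ev_outside) auto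
    then have "ev F x = 0" unfolding ev_def by (induction F) auto
    then show ?thesis using True Cons.prems by simp
  next
    case False
    then have "x \<notin> dom_box P" using Cons.prems by fastforce
    then show ?thesis using False Cons by (auto simp: piece_ev_outside)
  qed
qed simp

text \<open>At most one of the sets contains \<open>x\<close>, so at most one summand is
  nonzero.\<close>

lemma disjoint_list_sum_le:
  assumes "disjoint_pieces F"
    and "\<And>P. P \<in> set F \<Longrightarrow> x \<in> B P \<Longrightarrow> w P \<le> c" and "\<And>P. P \<in> set F \<Longrightarrow> B P \<subseteq> dom_box P" and "0 \<le> (c :: real)"
  shows "(\<Sum>P\<leftarrow>F. w P * indicator (B P) x) \<le> c"
  using assms
proof (induction F)
  case (Cons P F)
  show ?case
  proof (cases "x \<in> B P")
    case True
    have "w P' * indicator (B P') x = 0" if "P' \<in> set F" for P'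
    proof -
      have "B P \<subseteq> dom_box P" "B P' \<subseteq> dom_box P'" using Cons.prems(3) that by simp_all
      moreover have "dom_box P \<inter> dom_box P' = {}" using Cons.prems(1) that by simp
      ultimately have "x \<notin> B P'" using True by blast
      then show ?thesis by simp
    qed
    then have "(\<Sum>P\<leftarrow>F. w P * indicator (B P) x) = 0"
      by (intro ccontr[of "_ = _"]) (drule sum_list_nonzero, blast)
    then show ?thesis using True Cons.prems(2)[of P] by simp
  next
    case False
    then show ?thesis using Cons by simp
  qed
qed simp

context piece_seq
begin

definition first :: "nat \<Rightarrow> 'n piece list" where
  "first M = concat (map F [0..<M])"

lemma first_simps [simp]: "first 0 = []" "first (Suc M) = first M @ F M"
  by (simp_all add: first_def)

lemma set_first: "P \<in> set (first M) \<longleftrightarrow> (\<exists>m<M. P \<in> set (F m))"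
  by (auto simp: first_def)

lemma disjoint_first: "disjoint_pieces (first M)"
proof (induction M)
  case (Suc M)
  have "dom_box P \<inter> dom_box P' = {}" if P: "P \<in> set (first M)" "P' \<in> set (F M)" for P P'
  proof -
    obtain m where "m < M" "P \<in> set (F m)" using P(1) by (auto simp: set_first)
    then show ?thesis
      using sub_box_dom[OF sub, of P m] sub_box_dom[OF sub[OF P(2)]] disj[of m M] by blast
  qed
  then show ?case using Suc ord by (simp add: sorted_wrt_append)
qed simp

lemma u_piece:
  assumes "(l, r, G, d) \<in> set (F m)" "x \<in> hbox l r"
  shows "u x = G *v x + d"
  using assms sub_box_dom[OF sub[OF assms(1)]] u_eq[of x m] ev_piece[OF ord assms] by auto

lemma approx_gradient_u:
  assumes P: "(l, r, G, d) \<in> set (F m)" and x: "x \<in> box l r"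
  shows "approx_gradient u x = G"
proof (rule approx_gradient_affine)
  have "\<forall>\<^sub>F y in nhds x. y \<in> box l r"
    by (rule eventually_nhds_in_open) (use x in \<open>auto simp: open_box\<close>)
  then show "\<forall>\<^sub>F y in nhds x. u y = G *v y + d"
    by eventually_elim (rule u_piece[OF P], auto simp: mem_box_cart hbox_def less_imp_le)
qed

lemma gain_first: "(\<And>m. 1 \<le> gain p q (F m)) \<Longrightarrow> real M \<le> gain p q (first M)"
proof (induction M)
  case (Suc M)
  have "1 \<le> gain p q (F M)" by (rule Suc.prems)
  then show ?case using Suc.IH[OF Suc.prems] by (simp only: first_simps gain_simps of_nat_Suc)
qed simp

lemma box_dom: "box l r \<subseteq> dom_box (l, r, G, d)"
  by (auto simp: mem_box_cart hbox_def less_imp_le)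

lemma gain_integral:
  assumes "\<forall>P\<in>set E. box_piece P"
  shows "integrable lborel (\<lambda>x. \<Sum>P\<leftarrow>E. (case P of (l, r, G, d) \<Rightarrow> \<bar>G $ p $ q\<bar>) * indicator (case P of (l, r, G, d) \<Rightarrow> box l r) x) \<and>
    (LBINT x. (\<Sum>P\<leftarrow>E. (case P of (l, r, G, d) \<Rightarrow> \<bar>G $ p $ q\<bar>) * indicator (case P of (l, r, G, d) \<Rightarrow> box l r) x)) = gain p q E"
  using assms
proof (induction E)
  case (Cons P E)
  obtain l r G d where P: "P = (l, r, G, d)" by (cases P)
  have lr: "l $ j \<le> r $ j" for j using Cons.prems by (simp add: P box_piece_def less_imp_le)
  have "0 \<le> vol l r" unfolding vol_def using lr by (intro prod_nonneg) auto
  then have "measure lborel (box l r) = vol l r"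
    using emeasure_cbox_vol(2)[OF lr] by (simp add: measure_def)
  moreover have "integrable lborel (indicat_real (box l r))"
    using emeasure_lborel_box_finite[of l r] by (intro integrable_real_indicator) auto
  ultimately show ?case using Cons by (simp add: P)
qed simp

text \<open>The pieces in \<open>first M\<close> are disjoint, and on the interior of each the
  approximate gradient is its matrix. So the integral is at least the gain of
  \<open>first M\<close>, which is at least \<open>M\<close>.\<close>

lemma gradient_not_integrable:
  assumes gain: "\<And>m. 1 \<le> gain p q (F m)"
  shows "\<not> set_integrable lebesgue \<Omega> (approx_gradient u)"
proof
  assume int: "set_integrable lebesgue \<Omega> (approx_gradient u)"
  define N where "N = (\<lambda>x. norm (indicat_real \<Omega> x *\<^sub>R approx_gradient u x))"
  have N: "integrable lebesgue N"
    using int unfolding N_def set_integrable_def by (rule integrable_norm)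
  have "real M \<le> (\<integral>x. N x \<partial>lebesgue)" for M
  proof -
    let ?f = "\<lambda>x. \<Sum>P\<leftarrow>first M. (case P of (l, r, G, d) \<Rightarrow> \<bar>G $ p $ q\<bar>) * indicator (case P of (l, r, G, d) \<Rightarrow> box l r) x"
    have "\<forall>P\<in>set (first M). box_piece P" using box_pieces by (auto simp: set_first)
    note gi = gain_integral[OF this]
    have fm: "?f \<in> borel \<rightarrow>\<^sub>M borel" using gi by auto
    have "real M \<le> (LBINT x. ?f x)" using gain_first[OF gain] gi by simp
    also have "\<dots> = (\<integral>x. ?f x \<partial>lebesgue)" using fm by (intro integral_completion[symmetric]) simp
    also have "\<dots> \<le> (\<integral>x. N x \<partial>lebesgue)"
    proof (rule integral_mono)
      show "integrable lebesgue ?f"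
        by (rule iffD2[OF integrable_completion _]) (use fm in simp, rule gi[THEN conjunct1])
      fix x
      show "?f x \<le> N x"
      proof (rule disjoint_list_sum_le[OF disjoint_first])
        fix P assume P: "P \<in> set (first M)" "x \<in> (case P of (l, r, G, d) \<Rightarrow> box l r)"
        obtain l r G d where Pe: "P = (l, r, G, d)" by (cases P)
        obtain m where m: "(l, r, G, d) \<in> set (F m)" using P(1) by (auto simp: set_first Pe)
        have x: "x \<in> box l r" using P(2) by (simp add: Pe)
        then have "x \<in> hbox (L m) (U m)" using sub_box_dom[OF sub[OF m]] box_dom[of l r G d] by blast
        then have "x \<in> \<Omega>" using hbox_K K by blast
        then have "N x = norm G" using approx_gradient_u[OF m x] by (simp add: N_def)
        moreover have "\<bar>G $ p $ q\<bar> \<le> norm G"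
          using component_le_norm_cart[of "G $ p" q] Finite_Cartesian_Product.norm_nth_le[of G p] by linarith
        ultimately show "(case P of (l, r, G, d) \<Rightarrow> \<bar>G $ p $ q\<bar>) \<le> N x" by (simp add: Pe)
      next
        fix P assume "P \<in> set (first M)"
        show "(case P of (l, r, G, d) \<Rightarrow> box l r) \<subseteq> dom_box P"
          by (cases P) (simp only: prod.case box_dom)
      qed (simp add: N_def)
    qed (rule N)
    finally show ?thesis .
  qed
  then show False by (meson not_less reals_Archimedean2)
qed

end

section \<open>Smooth cut-off functions\<close>

lemma differentiable_partial:
  assumes "f differentiable (at x)"
  shows "(f has_derivative frechet_derivative f (at x)) (at x)"
  using assms frechet_derivative_works by blast

lemma partial_const [simp]: "partial j (\<lambda>_. c) = (\<lambda>_. 0)"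
  by (rule ext, rule partial_eq[OF has_derivative_const])

lemma partial_add:
  assumes "f differentiable (at x)" "g differentiable (at x)"
  shows "partial j (\<lambda>x. f x + g x) x = partial j f x + partial j g x"
  by (subst partial_eq[OF has_derivative_add[OF differentiable_partial[OF assms(1)] differentiable_partial[OF assms(2)]]])
     (simp add: partial_def)

lemma partial_mult:
  assumes "f differentiable (at x)" "g differentiable (at x)"
  shows "partial j (\<lambda>x. f x * g x) x = f x * partial j g x + partial j f x * g x"
  by (subst partial_eq[OF has_derivative_mult[OF differentiable_partial[OF assms(1)] differentiable_partial[OF assms(2)]]])
     (simp add: partial_def)

lemma Ck_Suc_imp: "Ck (Suc k) f \<Longrightarrow> Ck k f"
proof (induction k arbitrary: f)
  case 0
  then have "f differentiable (at x)" for x by simp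
  then show ?case by (auto intro!: continuous_at_imp_continuous_on differentiable_imp_continuous_within)
next
  case (Suc k)
  then show ?case by (metis Ck.simps(2))
qed

lemma Ck_const: "Ck k (\<lambda>_. c)"
proof (induction k arbitrary: c)
  case (Suc k)
  show ?case using Suc[of 0] by simp
qed simp

lemma Ck_add: "Ck k f \<Longrightarrow> Ck k g \<Longrightarrow> Ck k (\<lambda>x. f x + g x)"
proof (induction k arbitrary: f g)
  case 0
  then show ?case by (simp add: continuous_on_add)
next
  case (Suc k)
  have d: "f differentiable (at x)" "g differentiable (at x)" for x using Suc.prems by auto
  have "partial j (\<lambda>x. f x + g x) = (\<lambda>x. partial j f x + partial j g x)" for j
    by (rule ext) (rule partial_add[OF d])
  then show ?case using Suc d by auto
qed

lemma Ck_mult: "Ck k f \<Longrightarrow> Ck k g \<Longrightarrow> Ck k (\<lambda>x. f x * g x)"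
proof (induction k arbitrary: f g)
  case 0
  then show ?case by (simp add: continuous_on_mult)
next
  case (Suc k)
  have d: "f differentiable (at x)" "g differentiable (at x)" for x using Suc.prems by auto
  have "partial j (\<lambda>x. f x * g x) = (\<lambda>x. f x * partial j g x + partial j f x * g x)" for j
    by (rule ext) (rule partial_mult[OF d])
  moreover have "Ck k (\<lambda>x. f x * partial j g x + partial j f x * g x)" for j
    using Suc.prems Suc.IH Ck_Suc_imp[of k f] Ck_Suc_imp[of k g] by (intro Ck_add) auto
  ultimately show ?case using d by auto
qed

lemma Ck_prod: "finite S \<Longrightarrow> (\<And>i. i \<in> S \<Longrightarrow> Ck k (f i)) \<Longrightarrow> Ck k (\<lambda>x. \<Prod>i\<in>S. f i x)"
proof (induction S rule: finite_induct)
  case empty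
  then show ?case by (simp add: Ck_const)
next
  case (insert i S)
  then show ?case by (simp add: Ck_mult)
qed

text \<open>With \<open>s = 1 / t\<close> this is \<open>s ^ m * exp (- s)\<close>. The derivative
  of each member is a combination of later members, so smoothness of \<open>flat 0\<close> follows
  by an induction over the whole family.\<close>

definition flat :: "nat \<Rightarrow> real \<Rightarrow> real" where
  "flat m t = (if t \<le> 0 then 0 else (1 / t) ^ m * exp (- (1 / t)))"

lemma flat_tendsto: "(flat m \<longlongrightarrow> 0) (at_right 0)"
proof -
  have "((\<lambda>x::real. x ^ m / exp x) \<longlongrightarrow> 0) at_top" by (rule tendsto_power_div_exp_0)
  then have "((\<lambda>t::real. inverse t ^ m / exp (inverse t)) \<longlongrightarrow> 0) (at_right 0)"
    by (rule filterlim_compose) (rule filterlim_inverse_at_top_right)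
  moreover have "\<forall>\<^sub>F t in at_right 0. inverse t ^ m / exp (inverse t) = flat m t"
    by (auto simp: eventually_at_right[of 0 1] flat_def exp_minus field_simps intro!: exI[of _ 1])
  ultimately show ?thesis by (rule Lim_transform_eventually)
qed

lemma flat_deriv: "(flat m has_real_derivative (- real m * flat (Suc m) t + flat (m + 2) t)) (at t)"
proof -
  consider "t < 0" | "t = 0" | "0 < t" by linarith
  then show ?thesis
  proof cases
    case 1
    have "(flat m has_real_derivative 0) (at t)"
      by (rule has_field_derivative_transform_within_open[of "\<lambda>_. 0" _ _ "{..<0}"]) (use 1 in \<open>auto simp: flat_def\<close>)
    then show ?thesis using 1 by (simp add: flat_def)
  next
    case 2
    have "((\<lambda>h. (flat m (0 + h) - flat m 0) / h) \<longlongrightarrow> 0) (at 0)"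
    proof (rule filterlim_split_at)
      have "\<forall>\<^sub>F h in at_left 0. 0 = (flat m (0 + h) - flat m 0) / h"
        by (auto simp: eventually_at_left[of "-1" 0] flat_def intro!: exI[of _ "-1"])
      then show "((\<lambda>h. (flat m (0 + h) - flat m 0) / h) \<longlongrightarrow> 0) (at_left 0)"
        by (rule Lim_transform_eventually[rotated]) simp
      \<comment> \<open>At \<open>0\<close> the difference quotient from the right is again a member
        of the family.\<close>
      have "\<forall>\<^sub>F h in at_right 0. flat (Suc m) h = (flat m (0 + h) - flat m 0) / h"
        by (auto simp: eventually_at_right[of 0 1] flat_def intro!: exI[of _ 1])
      then show "((\<lambda>h. (flat m (0 + h) - flat m 0) / h) \<longlongrightarrow> 0) (at_right 0)"
        using flat_tendsto[of "Suc m"] by (rule Lim_transform_eventually[rotated])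
    qed
    then show ?thesis using 2 by (simp add: DERIV_def flat_def)
  next
    case 3
    have "((\<lambda>t. (1 / t) ^ m * exp (- (1 / t))) has_real_derivative (- real m * flat (Suc m) t + flat (m + 2) t)) (at t)"
    proof -
      have *: "t * t ^ (n - Suc 0) = t ^ n" if "n \<noteq> 0" for n using that by (cases n) auto
      show ?thesis
        using 3 by (cases m) (auto intro!: derivative_eq_intros simp: flat_def field_simps power2_eq_square, metis *)
    qed
    then show ?thesis
      by (rule has_field_derivative_transform_within_open[of _ _ _ "{0<..}"]) (use 3 in \<open>auto simp: flat_def\<close>)
  qed
qed

lemma flat_coord_deriv:
  "((\<lambda>x::real^'n. flat m (s * x $ j + c)) has_derivative
     (\<lambda>h. (s * h $ j) * (- real m * flat (Suc m) (s * x $ j + c) + flat (m + 2) (s * x $ j + c)))) (at x)"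
proof -
  have "((\<lambda>x::real^'n. s * x $ j + c) has_derivative (\<lambda>h. s * h $ j)) (at x)"
    by (auto intro!: derivative_eq_intros bounded_linear_imp_has_derivative bounded_linear_vec_nth)
  from has_derivative_compose[OF this flat_deriv[of m "s * x $ j + c", unfolded has_field_derivative_def]]
  show ?thesis by (simp add: mult.commute)
qed

lemma Ck_flat: "Ck k (\<lambda>x::real^'n. flat m (s * x $ j + c))"
proof (induction k arbitrary: m)
  case 0
  have "(\<lambda>x::real^'n. flat m (s * x $ j + c)) differentiable (at x)" for x
    using flat_coord_deriv differentiable_def by blast
  then show ?case by (auto intro!: continuous_at_imp_continuous_on differentiable_imp_continuous_within)
next
  case (Suc k)
  have "partial i (\<lambda>x::real^'n. flat m (s * x $ j + c)) =
      (\<lambda>x. (s * of_bool (i = j)) * (- real m * flat (Suc m) (s * x $ j + c) + flat (m + 2) (s * x $ j + c)))" for i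
    by (rule ext, subst partial_eq[OF flat_coord_deriv]) (simp add: axis_def)
  moreover have "Ck k (\<lambda>x. (s * of_bool (i = j)) * (- real m * flat (Suc m) (s * x $ j + c) + flat (m + 2) (s * x $ j + c)))" for i
    by (intro Ck_mult Ck_add Ck_const Suc)
  moreover have "(\<lambda>x::real^'n. flat m (s * x $ j + c)) differentiable (at x)" for x
    using flat_coord_deriv differentiable_def by blast
  ultimately show ?case by simp
qed

text \<open>The arguments are rescaled to the unit cube, so that the bounds do not depend on the
  box.\<close>

definition bump :: "real^'n \<Rightarrow> real^'n \<Rightarrow> real^'n \<Rightarrow> real" where
  "bump l u x = (\<Prod>j\<in>UNIV. flat 0 ((x $ j - l $ j) / (u $ j - l $ j)) * flat 0 ((u $ j - x $ j) / (u $ j - l $ j)))"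

lemma Ck_bump: "Ck k (bump l u)"
proof -
  have "Ck k (\<lambda>x. \<Prod>j\<in>UNIV. flat 0 ((1 / (u $ j - l $ j)) * x $ j + (- l $ j / (u $ j - l $ j))) *
     flat 0 ((- 1 / (u $ j - l $ j)) * x $ j + (u $ j / (u $ j - l $ j))))"
    by (intro Ck_prod Ck_mult Ck_flat) simp
  also have "(\<lambda>x. \<Prod>j\<in>UNIV. flat 0 ((1 / (u $ j - l $ j)) * x $ j + (- l $ j / (u $ j - l $ j))) *
     flat 0 ((- 1 / (u $ j - l $ j)) * x $ j + (u $ j / (u $ j - l $ j)))) = bump l u"
    unfolding bump_def by (intro ext prod.cong) (simp_all add: diff_divide_distrib)
  finally show ?thesis .
qed

lemma flat_bounds: "0 \<le> flat 0 t" "flat 0 t \<le> 1"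
  by (auto simp: flat_def)

lemma bump_bounds: "0 \<le> bump l u x" "bump l u x \<le> 1"
  unfolding bump_def using flat_bounds
  by (auto intro!: prod_nonneg prod_le_1 mult_le_one)

lemma bump_zero:
  assumes "\<And>j. l $ j < u $ j" "x \<notin> box l u"
  shows "bump l u x = 0"
proof -
  obtain j where "x $ j \<le> l $ j \<or> u $ j \<le> x $ j"
    using assms(2) by (auto simp: mem_box_cart not_less)
  then have "(x $ j - l $ j) / (u $ j - l $ j) \<le> 0 \<or> (u $ j - x $ j) / (u $ j - l $ j) \<le> 0"
    using assms(1)[of j] by (auto simp: divide_le_0_iff)
  then have "flat 0 ((x $ j - l $ j) / (u $ j - l $ j)) * flat 0 ((u $ j - x $ j) / (u $ j - l $ j)) = 0"
    by (auto simp: flat_def)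
  then show ?thesis unfolding bump_def by (intro prod_zero) auto
qed

lemma bump_supp:
  assumes "\<And>j. l $ j < u $ j"
  shows "supp (bump l u) \<subseteq> cbox l u"
  unfolding supp_def
proof (rule closure_minimal)
  show "{x. bump l u x \<noteq> 0} \<subseteq> cbox l u"
    using bump_zero[OF assms] box_subset_cbox by blast
qed (rule closed_cbox)

lemma bump_test_function:
  assumes "\<And>j. l $ j < u $ j" "cbox l u \<subseteq> \<Omega>"
  shows "bump l u \<in> test_functions \<Omega>"
proof -
  have "compact (supp (bump l u))"
    using bump_supp[OF assms(1)] compact_cbox by (metis closed_closure compact_Int_closed inf.absorb_iff2 supp_def)
  then show ?thesis
    unfolding test_functions_def using Ck_bump bump_supp[OF assms(1)] assms(2) by blast
qed

text \<open>On the concentric box with halved sides all arguments are at least \<open>1 / 4\<close>,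
  so each coordinate contributes at least \<open>exp (- 4) * exp (- 4)\<close>; the
  \<open>1 / 2\<close> per coordinate is the ratio of the volumes. The constant depends on the
  dimension only, which permits summation over all pieces.\<close>

lemma bump_integral:
  fixes l u :: "real^'n"
  assumes lu: "\<And>j. l $ j < u $ j"
  shows "integrable lborel (bump l u)"
    and "(exp (- 8) / 2) ^ CARD('n) * vol l u \<le> (LBINT x. bump l u x)"
proof -
  have cont: "continuous_on UNIV (bump l u)" using Ck_bump[of 0 l u] by simp
  have "(\<lambda>x. indicator (hbox l u) x * bump l u x) = bump l u"
  proof
    fix x show "indicator (hbox l u) x * bump l u x = bump l u x"
      using bump_zero[OF lu, of x] by (cases "x \<in> box l u") (auto simp: hbox_def mem_box_cart less_imp_le)
  qed
  then show int: "integrable lborel (bump l u)" using integrable_hbox[OF cont, of l u] by simp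
  define l' u' where "l' = (\<chi> j. l $ j + (u $ j - l $ j) / 4)" and "u' = (\<chi> j. u $ j - (u $ j - l $ j) / 4)"
  have lu': "l' $ j \<le> u' $ j" for j using lu[of j] by (simp add: l'_def u'_def field_simps)
  have "vol l' u' = (\<Prod>j\<in>UNIV. (u $ j - l $ j) * (1 / 2))"
    unfolding vol_def l'_def u'_def by (intro prod.cong) (auto simp: field_simps)
  also have "\<dots> = vol l u * (1 / 2) ^ CARD('n)"
    by (simp only: prod.distrib prod_constant vol_def)
  finally have v: "vol l' u' = vol l u * (1 / 2) ^ CARD('n)" .
  have "measure lborel (cbox l' u') = vol l' u'"
    using emeasure_cbox_vol(1)[OF lu'] v vol_pos[OF lu] by (simp add: measure_def)
  then have "(exp (- 8) / 2) ^ CARD('n) * vol l u = (LBINT x. exp (- 8) ^ CARD('n) * indicat_real (cbox l' u') x)"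
    by (simp add: v power_divide)
  also have "\<dots> \<le> (LBINT x. bump l u x)"
  proof (rule integral_mono[OF _ int])
    show "integrable lborel (\<lambda>x. exp (- 8) ^ CARD('n) * indicat_real (cbox l' u') x)"
      using emeasure_lborel_cbox_finite[of l' u'] by (intro integrable_mult_right integrable_real_indicator) auto
    fix x
    have "exp (- 8) ^ CARD('n) \<le> bump l u x" if x: "x \<in> cbox l' u'"
    proof -
      have fl: "exp (- 4) \<le> flat 0 t" if "1 / 4 \<le> t" for t
        using that by (auto simp: flat_def field_simps)
      have "exp (- 8) \<le> flat 0 ((x $ j - l $ j) / (u $ j - l $ j)) * flat 0 ((u $ j - x $ j) / (u $ j - l $ j))" for j
      proof -
        have "l' $ j \<le> x $ j" "x $ j \<le> u' $ j" using x by (auto simp: mem_box_cart)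
        then have "1 / 4 \<le> (x $ j - l $ j) / (u $ j - l $ j)" "1 / 4 \<le> (u $ j - x $ j) / (u $ j - l $ j)"
          using lu[of j] by (auto simp: l'_def u'_def field_simps)
        then have "exp (- 4) * exp (- 4) \<le> flat 0 ((x $ j - l $ j) / (u $ j - l $ j)) * flat 0 ((u $ j - x $ j) / (u $ j - l $ j))"
          by (intro mult_mono fl) (auto simp: flat_bounds)
        then show ?thesis by (simp flip: exp_add)
      qed
      then have "(\<Prod>j\<in>(UNIV::'n set). exp (- 8)) \<le> bump l u x"
        unfolding bump_def by (intro prod_mono) auto
      then show ?thesis by simp
    qed
    then show "exp (- 8) ^ CARD('n) * indicat_real (cbox l' u') x \<le> bump l u x"
      using bump_bounds[of l u x] by (auto simp: indicator_def)
  qed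
  finally show "(exp (- 8) / 2) ^ CARD('n) * vol l u \<le> (LBINT x. bump l u x)" .
qed

section \<open>Truncation of a coordinate by a function of class \<open>C^1\<close>\<close>

definition sqpos :: "real \<Rightarrow> real" where
  "sqpos t = (max 0 t)\<^sup>2"

lemma sqpos_deriv: "(sqpos has_real_derivative 2 * max 0 t) (at t)"
proof -
  consider "t < 0" | "t = 0" | "0 < t" by linarith
  then show ?thesis
  proof cases
    case 1
    have "(sqpos has_real_derivative 0) (at t)"
      by (rule has_field_derivative_transform_within_open[of "\<lambda>_. 0" _ _ "{..<0}"]) (use 1 in \<open>auto simp: sqpos_def\<close>)
    then show ?thesis using 1 by simp
  next
    case 2
    have "((\<lambda>h. (sqpos (0 + h) - sqpos 0) / h) \<longlongrightarrow> 0) (at 0)"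
    proof (rule tendsto_0_le[of "\<lambda>h. h" _ _ 1])
      show "\<forall>\<^sub>F h in at 0. norm ((sqpos (0 + h) - sqpos 0) / h) \<le> norm h * 1"
        by (auto simp: sqpos_def max_def power2_eq_square)
    qed (rule tendsto_ident_at)
    then show ?thesis using 2 by (simp add: DERIV_def)
  next
    case 3
    have "((\<lambda>t. t\<^sup>2) has_real_derivative 2 * t) (at t)" by (auto intro!: derivative_eq_intros)
    then have "(sqpos has_real_derivative 2 * t) (at t)"
      by (rule has_field_derivative_transform_within_open[of _ _ _ "{0<..}"]) (use 3 in \<open>auto simp: sqpos_def\<close>)
    then show ?thesis using 3 by simp
  qed
qed

lemma sqpos_continuous [continuous_intros]:
  "continuous_on S f \<Longrightarrow> continuous_on S (\<lambda>x. sqpos (f x))"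
  unfolding sqpos_def by (intro continuous_intros)

text \<open>Equals \<open>w $ p\<close> for \<open>norm w \<le> 1\<close> and \<open>0\<close> for
  \<open>w \<bullet> w \<ge> 2\<close>, so that its gradient has compact support, as the tests in
  \<open>GBV\<close> require.\<close>

definition cutoff :: "'n \<Rightarrow> real^'n \<Rightarrow> real" where
  "cutoff p w = w $ p * sqpos (1 - sqpos (w \<bullet> w - 1))"

lemma cutoff_eq: "norm w \<le> 1 \<Longrightarrow> cutoff p w = w $ p"
proof -
  assume "norm w \<le> 1"
  then have "w \<bullet> w \<le> 1" by (simp add: dot_square_norm power_le_one)
  then show ?thesis by (simp add: cutoff_def sqpos_def)
qed

lemma cutoff_has_derivative:
  "(cutoff p has_derivative (\<lambda>h. w $ p * ((2 * max 0 (1 - sqpos (w \<bullet> w - 1))) * (- ((2 * max 0 (w \<bullet> w - 1)) * (2 * (w \<bullet> h)))))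
     + h $ p * sqpos (1 - sqpos (w \<bullet> w - 1)))) (at w)"
proof -
  have 1: "((\<lambda>w. w \<bullet> w - 1) has_derivative (\<lambda>h. 2 * (w \<bullet> h))) (at w)"
    by (auto intro!: derivative_eq_intros simp: inner_commute)
  have 2: "((\<lambda>w. sqpos (w \<bullet> w - 1)) has_derivative (\<lambda>h. (2 * max 0 (w \<bullet> w - 1)) * (2 * (w \<bullet> h)))) (at w)"
    using has_derivative_compose[OF 1 sqpos_deriv[unfolded has_field_derivative_def]] by simp
  have 3: "((\<lambda>w. 1 - sqpos (w \<bullet> w - 1)) has_derivative (\<lambda>h. - ((2 * max 0 (w \<bullet> w - 1)) * (2 * (w \<bullet> h))))) (at w)"
    using has_derivative_diff[OF has_derivative_const 2, of 1] by simp
  have 4: "((\<lambda>w. sqpos (1 - sqpos (w \<bullet> w - 1))) has_derivative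
      (\<lambda>h. (2 * max 0 (1 - sqpos (w \<bullet> w - 1))) * (- ((2 * max 0 (w \<bullet> w - 1)) * (2 * (w \<bullet> h)))))) (at w)"
    using has_derivative_compose[OF 3 sqpos_deriv[unfolded has_field_derivative_def]] by simp
  have 5: "((\<lambda>w. w $ p) has_derivative (\<lambda>h. h $ p)) (at w)"
    by (rule bounded_linear_imp_has_derivative) (rule bounded_linear_vec_nth)
  show ?thesis unfolding cutoff_def[abs_def] by (rule has_derivative_mult[OF 5 4])
qed

lemma Ck_cutoff: "Ck 1 (cutoff p)"
proof -
  have "partial j (cutoff p) = (\<lambda>w. w $ p * ((2 * max 0 (1 - sqpos (w \<bullet> w - 1))) * (- ((2 * max 0 (w \<bullet> w - 1)) * (2 * (w \<bullet> axis j 1)))))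
     + (axis j 1 :: real^'a) $ p * sqpos (1 - sqpos (w \<bullet> w - 1)))" for j
    by (rule ext, rule partial_eq) (rule cutoff_has_derivative)
  moreover have "continuous_on UNIV (\<lambda>w::real^'a. w $ p * ((2 * max 0 (1 - sqpos (w \<bullet> w - 1))) * (- ((2 * max 0 (w \<bullet> w - 1)) * (2 * (w \<bullet> axis j 1)))))
     + (axis j 1 :: real^'a) $ p * sqpos (1 - sqpos (w \<bullet> w - 1)))" for j
    by (intro continuous_intros)
  moreover have "cutoff p differentiable (at w)" for w
    using cutoff_has_derivative differentiable_def by blast
  ultimately show ?thesis by simp
qed

lemma compact_supp_gradient_cutoff: "compact (supp (gradient (cutoff p)))"
proof -
  have "gradient (cutoff p) w = 0" if "2 < norm w" for w
  proof -
    have "(cutoff p has_derivative (\<lambda>h. 0)) (at w)"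
    proof (rule has_derivative_transform_within_open[OF has_derivative_const[of 0]])
      show "open {w::real^'a. 2 < norm w}" by (intro open_Collect_less continuous_intros)
      fix w :: "real^'a" assume "w \<in> {w. 2 < norm w}"
      then have "2\<^sup>2 \<le> (norm w)\<^sup>2" by (intro power_mono) auto
      then have "4 \<le> w \<bullet> w" by (simp add: dot_square_norm)
      then have "1 \<le> (max 0 (w \<bullet> w - 1))\<^sup>2" by (intro one_le_power) auto
      then show "0 = cutoff p w" by (simp add: cutoff_def sqpos_def)
    qed (use that in simp)
    then have "partial j (cutoff p) w = 0" for j by (rule partial_eq)
    then show ?thesis by (simp add: gradient_def vec_eq_iff)
  qed
  then have "{w. gradient (cutoff p) w \<noteq> 0} \<subseteq> cball 0 2" by (auto simp: not_less[symmetric])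
  then have "bounded {w. gradient (cutoff p) w \<noteq> 0}" by (rule bounded_subset[OF bounded_cball])
  then show ?thesis by (simp add: supp_def compact_closure)
qed

section \<open>Failure of generalised bounded variation\<close>

text \<open>Equality of the signed measures \<open>P - N\<close> and \<open>P' - N'\<close> is
  written with sums, which involves no subtraction in \<open>ennreal\<close> and survives the
  monotone limits of the induction.\<close>

lemma nn_integral_add_eq:
  assumes S: "sets N = sets P" "sets P' = sets P" "sets N' = sets P"
    and eq: "\<And>A. A \<in> sets P \<Longrightarrow> emeasure P A + emeasure N' A = emeasure P' A + emeasure N A"
    and f: "f \<in> borel_measurable P"
  shows "(\<integral>\<^sup>+x. f x \<partial>P) + (\<integral>\<^sup>+x. f x \<partial>N') = (\<integral>\<^sup>+x. f x \<partial>P') + (\<integral>\<^sup>+x. f x \<partial>N)"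
  using f
proof (induction rule: borel_measurable_induct)
  case (cong f g)
  have "space P' = space P" "space N = space P" "space N' = space P"
    using S by (metis sets_eq_imp_space_eq)+
  then have "(\<integral>\<^sup>+x. f x \<partial>M) = (\<integral>\<^sup>+x. g x \<partial>M)" if "M \<in> {P, P', N, N'}" for M
    using that cong(3) by (intro nn_integral_cong) auto
  then show ?case using cong by simp
next
  case (set A)
  then show ?case using eq[OF set] S by simp
next
  case (mult u c)
  have "(\<integral>\<^sup>+x. c * u x \<partial>M) = c * (\<integral>\<^sup>+x. u x \<partial>M)" if "sets M = sets P" for M
    using mult that by (intro nn_integral_cmult) (simp cong: measurable_cong_sets)
  then show ?case using mult S by (simp flip: distrib_left)
next
  case (add u v)
  have *: "(\<integral>\<^sup>+x. v x + u x \<partial>M) = (\<integral>\<^sup>+x. v x \<partial>M) + (\<integral>\<^sup>+x. u x \<partial>M)" if "sets M = sets P" for M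
    using add that by (intro nn_integral_add) (simp_all cong: measurable_cong_sets)
  have ac: "(a + b) + (c + d) = (a + c) + (b + d)" for a b c d :: ennreal
    by (simp add: ac_simps)
  have "(\<integral>\<^sup>+x. v x + u x \<partial>P) + (\<integral>\<^sup>+x. v x + u x \<partial>N') =
      ((\<integral>\<^sup>+x. v x \<partial>P) + (\<integral>\<^sup>+x. v x \<partial>N')) + ((\<integral>\<^sup>+x. u x \<partial>P) + (\<integral>\<^sup>+x. u x \<partial>N'))"
    unfolding *[OF refl] *[OF S(3)] by (rule ac)
  also have "\<dots> = ((\<integral>\<^sup>+x. v x \<partial>P') + (\<integral>\<^sup>+x. v x \<partial>N)) + ((\<integral>\<^sup>+x. u x \<partial>P') + (\<integral>\<^sup>+x. u x \<partial>N))"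
    using add by simp
  also have "\<dots> = (\<integral>\<^sup>+x. v x + u x \<partial>P') + (\<integral>\<^sup>+x. v x + u x \<partial>N)"
    unfolding *[OF S(1)] *[OF S(2)] by (rule ac)
  finally show ?case .
next
  case (seq U)
  have *: "(\<integral>\<^sup>+x. (SUP i. U i) x \<partial>M) = (SUP i. \<integral>\<^sup>+x. U i x \<partial>M)" if "sets M = sets P" for M
    unfolding SUP_apply using seq that
    by (intro nn_integral_monotone_convergence_SUP) (simp_all cong: measurable_cong_sets)
  have inc: "incseq (\<lambda>i. \<integral>\<^sup>+x. U i x \<partial>M)" for M
    using seq(3) by (auto simp: incseq_def le_fun_def intro!: nn_integral_mono)
  have "(SUP i. \<integral>\<^sup>+x. U i x \<partial>P) + (SUP i. \<integral>\<^sup>+x. U i x \<partial>N') = (SUP i. (\<integral>\<^sup>+x. U i x \<partial>P) + (\<integral>\<^sup>+x. U i x \<partial>N'))"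
    by (rule ennreal_SUP_add[symmetric]) (rule inc)+
  also have "\<dots> = (SUP i. (\<integral>\<^sup>+x. U i x \<partial>P') + (\<integral>\<^sup>+x. U i x \<partial>N))"
    using seq by simp
  also have "\<dots> = (SUP i. \<integral>\<^sup>+x. U i x \<partial>P') + (SUP i. \<integral>\<^sup>+x. U i x \<partial>N)"
    by (rule ennreal_SUP_add) (rule inc)+
  finally show ?case unfolding *[OF refl] *[OF S(1)] *[OF S(2)] *[OF S(3)] .
qed

text \<open>\<open>has_signed_integral\<close> may choose a different pair of measures for every
  test function; this lets all of them be compared with one fixed pair.\<close>

lemma signed_integral_unique:
  fixes f :: "'a \<Rightarrow> real"
  assumes fin: "finite_measure P" "finite_measure N" "finite_measure P'" "finite_measure N'"
    and S: "sets N = sets P" "sets P' = sets P" "sets N' = sets P"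
    and eq: "\<And>A. A \<in> sets P \<Longrightarrow> measure P A - measure N A = measure P' A - measure N' A"
    and int: "integrable P f" "integrable N f" "integrable P' f" "integrable N' f" and f: "\<And>x. 0 \<le> f x"
  shows "(\<integral>x. f x \<partial>P) - (\<integral>x. f x \<partial>N) = (\<integral>x. f x \<partial>P') - (\<integral>x. f x \<partial>N')"
proof -
  have "(\<integral>\<^sup>+x. ennreal (f x) \<partial>P) + (\<integral>\<^sup>+x. ennreal (f x) \<partial>N') = (\<integral>\<^sup>+x. ennreal (f x) \<partial>P') + (\<integral>\<^sup>+x. ennreal (f x) \<partial>N)"
  proof (rule nn_integral_add_eq[OF S])
    show "emeasure P A + emeasure N' A = emeasure P' A + emeasure N A" if "A \<in> sets P" for A
      using eq[OF that] by (simp add: finite_measure.emeasure_eq_measure[OF fin(1)] finite_measure.emeasure_eq_measure[OF fin(2)]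
          finite_measure.emeasure_eq_measure[OF fin(3)] finite_measure.emeasure_eq_measure[OF fin(4)] flip: ennreal_plus)
  qed (use int in auto)
  then have "ennreal ((\<integral>x. f x \<partial>P) + (\<integral>x. f x \<partial>N')) = ennreal ((\<integral>x. f x \<partial>P') + (\<integral>x. f x \<partial>N))"
    using int f by (simp add: nn_integral_eq_integral)
  then have "(\<integral>x. f x \<partial>P) + (\<integral>x. f x \<partial>N') = (\<integral>x. f x \<partial>P') + (\<integral>x. f x \<partial>N)"
    using f by (subst (asm) ennreal_inj) (auto intro!: add_nonneg_nonneg Bochner_Integration.integral_nonneg)
  then show ?thesis by simp
qed

lemma disjoint_list_measure_le:
  assumes fin: "finite_measure M" and d: "disjoint_pieces F"
    and B: "\<And>P. P \<in> set F \<Longrightarrow> B P \<subseteq> dom_box P" "\<And>P. P \<in> set F \<Longrightarrow> B P \<in> sets M"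
  shows "(\<Sum>P\<leftarrow>F. measure M (B P)) \<le> measure M (space M)"
proof -
  interpret finite_measure M by (rule fin)
  have i: "integrable M (\<lambda>x. \<Sum>P\<leftarrow>F. 1 * indicator (B P) x :: real) \<and>
     (\<integral>x. (\<Sum>P\<leftarrow>F. 1 * indicator (B P) x :: real) \<partial>M) = (\<Sum>P\<leftarrow>F. measure M (B P))"
    using B(2)
  proof (induction F)
    case (Cons P F)
    then show ?case by (simp add: integrable_real_indicator less_top[symmetric])
  qed simp
  then have "(\<Sum>P\<leftarrow>F. measure M (B P)) = (\<integral>x. (\<Sum>P\<leftarrow>F. 1 * indicator (B P) x :: real) \<partial>M)" by simp
  also have "\<dots> \<le> (\<integral>x. 1 \<partial>M)"
    using i by (intro integral_mono disjoint_list_sum_le[OF d]) (use B in auto)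
  finally show ?thesis by simp
qed

lemma compact_open_neighbourhood:
  fixes K :: "'a::euclidean_space set"
  assumes K: "compact K" "K \<subseteq> \<Omega>" "open \<Omega>"
  obtains V where "open V" "compact (closure V)" "K \<subseteq> V" "closure V \<subseteq> \<Omega>"
proof -
  obtain e where e: "0 < e" "(\<Union>x\<in>K. ball x e) \<subseteq> \<Omega>"
    using compact_subset_open_imp_ball_epsilon_subset[OF K(1) K(3) K(2)] by blast
  define V where "V = (\<Union>x\<in>K. ball x (e / 2))"
  show thesis
  proof
    show "open V" by (auto simp: V_def)
    show "K \<subseteq> V" using e(1) by (auto simp: V_def)
    obtain B where B: "\<And>x. x \<in> K \<Longrightarrow> norm x \<le> B"
      using compact_imp_bounded[OF K(1)] by (auto simp: bounded_iff)
    have "norm y \<le> B + e" if y: "y \<in> V" for y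
    proof -
      obtain x where "x \<in> K" "y \<in> ball x (e / 2)" using y unfolding V_def by blast
      then show ?thesis using B[of x] e(1) norm_triangle_ineq2[of y x] by (simp add: dist_norm norm_minus_commute)
    qed
    then have "bounded V" by (auto simp: bounded_iff)
    then show "compact (closure V)" by (simp add: compact_closure)
    show "closure V \<subseteq> \<Omega>"
    proof
      fix y assume "y \<in> closure V"
      then have "\<exists>z\<in>V. dist z y < e / 2"
        unfolding closure_approachable using half_gt_zero[OF e(1)] by blast
      then obtain z where z: "z \<in> V" "dist z y < e / 2" by blast
      then obtain x where x: "x \<in> K" "z \<in> ball x (e / 2)" unfolding V_def by blast
      have "dist x y < e" using dist_triangle[of x y z] z x by simp
      then have "y \<in> (\<Union>x\<in>K. ball x e)" using x(1) by auto
      then show "y \<in> \<Omega>" using e(2) by blast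
    qed
  qed
qed

section \<open>Testing the distributional derivative on single pieces\<close>

context piece_seq
begin

text \<open>The bump vanishes on all faces of its piece, so integration by parts leaves no jump term
  and only the gradient entry is seen.\<close>

lemma piece_integral:
  assumes P: "(l, r, G, d) \<in> set (F m)" and V: "open V" "cbox l r \<subseteq> V"
  shows "(LINT x:V|lebesgue. u x $ p * partial q (bump l r) x) = - G $ p $ q * (LBINT x. bump l r x)"
proof -
  have lr: "l $ j < r $ j" for j using sub[OF P] by (auto simp: sub_box_def)
  have C: "Ck k (bump l r)" for k by (rule Ck_bump)
  have diff: "bump l r differentiable (at x)" for x using C[of 1] by simp
  have cont: "continuous_on UNIV (partial q (bump l r))" "continuous_on UNIV (bump l r)"
    using C[of 1] C[of 0] by simp_all
  have z: "bump l r x = 0" if "x \<notin> box l r" for x by (rule bump_zero[OF lr that])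
  have pz: "partial q (bump l r) x = 0" if "x \<notin> cbox l r" for x
  proof -
    have "(bump l r has_derivative (\<lambda>h. 0)) (at x)"
      by (rule has_derivative_transform_within_open[OF has_derivative_const[of 0], of "- cbox l r"])
         (use that z box_subset_cbox[of l r] in \<open>auto simp: open_Compl closed_cbox\<close>)
    then show ?thesis by (rule partial_eq)
  qed
  define \<psi> where "\<psi> = (\<lambda>x. (G *v x + d) $ p * bump l r x)"
  have p\<psi>: "partial q \<psi> x = (G *v x + d) $ p * partial q (bump l r) x + G $ p $ q * bump l r x" for x
    unfolding \<psi>_def by (rule partial_affine_mult) (rule diff)
  have f: "(LBINT x. indicator (hbox l r) x * partial q \<psi> x) =
    (LBINT x. indicator (strip q) x * (of_bool (side q l r x) * (\<psi> (upd x q (r $ q)) - \<psi> (upd x q (l $ q)))))"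
  proof (rule divergence_hbox[OF lr])
    show "\<psi> differentiable at x" for x
      unfolding \<psi>_def differentiable_def using affine_mult_has_derivative[OF diff] by blast
    show "continuous_on UNIV (partial q \<psi>)"
      unfolding p\<psi>[abs_def] by (intro continuous_intros affine_continuous cont)
  qed
  have \<psi>0: "\<psi> (upd x q (r $ q)) = 0" "\<psi> (upd x q (l $ q)) = 0" for x
  proof -
    have "upd x q (r $ q) \<notin> box l r" "upd x q (l $ q) \<notin> box l r"
      by (auto simp: mem_box_cart dest!: spec[of _ q])
    then show "\<psi> (upd x q (r $ q)) = 0" "\<psi> (upd x q (l $ q)) = 0" by (simp_all add: \<psi>_def z)
  qed
  have 0: "(LBINT x. indicator (hbox l r) x * partial q \<psi> x) = 0"
    unfolding f by (simp add: \<psi>0)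
  let ?g = "\<lambda>x. indicator (hbox l r) x * ((G *v x + d) $ p * partial q (bump l r) x)"
  have gi: "integrable lborel ?g"
    by (intro integrable_hbox continuous_on_mult affine_continuous cont)
  have "(\<lambda>x. indicator (hbox l r) x * partial q \<psi> x) = (\<lambda>x. ?g x + G $ p $ q * bump l r x)"
  proof
    fix x show "indicator (hbox l r) x * partial q \<psi> x = ?g x + G $ p $ q * bump l r x"
    proof (cases "x \<in> hbox l r")
      case False
      then have "x \<notin> box l r" using box_dom[of l r G d] by auto
      then show ?thesis using False z by simp
    qed (simp add: p\<psi>)
  qed
  then have "0 = (LBINT x. ?g x) + G $ p $ q * (LBINT x. bump l r x)"
    using 0 gi bump_integral(1)[OF lr] by simp
  moreover have "(LBINT x. ?g x) = (LINT x:V|lebesgue. u x $ p * partial q (bump l r) x)"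
  proof -
    have gm: "?g \<in> borel \<rightarrow>\<^sub>M borel" using gi by simp
    have pm [measurable]: "partial q (bump l r) \<in> borel \<rightarrow>\<^sub>M borel"
      using cont(1) by (rule borel_measurable_continuous_onI)
    have Vm [measurable]: "V \<in> sets borel" using V by simp
    have fm: "(\<lambda>x. indicat_real V x *\<^sub>R (u x $ p * partial q (bump l r) x)) \<in> borel \<rightarrow>\<^sub>M borel" by measurable
    have "(LINT x:V|lebesgue. u x $ p * partial q (bump l r) x) = (LBINT x. indicat_real V x *\<^sub>R (u x $ p * partial q (bump l r) x))"
      unfolding set_lebesgue_integral_def using fm by (intro integral_completion) simp
    also have "\<dots> = (LBINT x. ?g x)"
    proof (rule integral_cong_AE)
      have "emeasure lborel (cbox l r - box l r) = 0"
      proof -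
        have lr': "l $ j \<le> r $ j" for j using lr[of j] by simp
        have "emeasure lborel (cbox l r - box l r) = emeasure lborel (cbox l r) - emeasure lborel (box l r)"
          using emeasure_lborel_box_finite[of l r] by (intro emeasure_Diff) (auto simp: box_subset_cbox)
        then show ?thesis using emeasure_cbox_vol[OF lr'] by simp
      qed
      then have "AE x in lborel. x \<notin> cbox l r - box l r"
        by (intro AE_not_in) (auto simp: null_sets_def)
      then show "AE x in lborel. indicat_real V x *\<^sub>R (u x $ p * partial q (bump l r) x) = ?g x"
      proof eventually_elim
        case (elim x)
        show ?case
        proof (cases "x \<in> box l r")
          case True
          then have "x \<in> hbox l r" "x \<in> V" using box_dom[of l r G d] V(2) box_subset_cbox[of l r] by auto
          then show ?thesis using u_piece[OF P] by simp
        next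
          case False
          then show ?thesis using elim pz by simp
        qed
      qed
    qed (use fm gm in auto)
    finally show ?thesis by simp
  qed
  ultimately show ?thesis by simp
qed

text \<open>Each bump shows that its box carries at least a fixed multiple of the gain of its piece,
  measured by one finite measure. The boxes are disjoint and the total gain is unbounded, a
  contradiction.\<close>

lemma not_GBV:
  assumes gain: "\<And>m. 1 \<le> gain p q (F m)"
  shows "u \<notin> GBV \<Omega>"
proof
  assume "u \<in> GBV \<Omega>"
  then have "(\<lambda>x. cutoff p (u x)) \<in> BV_loc \<Omega>"
    unfolding GBV_def using Ck_cutoff compact_supp_gradient_cutoff by blast
  \<comment> \<open>By \<open>norm_u\<close> the truncation acts as the coordinate function.\<close>
  then have loc: "(\<lambda>x. u x $ p) \<in> BV_loc \<Omega>" using cutoff_eq[OF norm_u] by simp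
  obtain V where V: "open V" "compact (closure V)" "K \<subseteq> V" "closure V \<subseteq> \<Omega>"
    using compact_open_neighbourhood[OF K(1,2) \<Omega>] by blast
  then have "(\<lambda>x. u x $ p) \<in> BV V" using loc by (auto simp: BV_loc_def)
  then obtain \<mu> :: "(real^'n) set \<Rightarrow> real^'n" where \<mu>: "\<And>\<phi>. \<phi> \<in> test_functions V \<Longrightarrow>
      has_signed_integral V (\<lambda>A. \<mu> A $ q) \<phi> (- (LINT x:V|lebesgue. u x $ p * partial q \<phi> x))"
    unfolding BV_def by blast
  \<comment> \<open>Testing with the zero function extracts one pair \<open>P0\<close>,
    \<open>N0\<close> that represents component \<open>q\<close> of \<open>\<mu>\<close> and stays
    fixed for all bumps.\<close>
  have "(\<lambda>x::real^'n. 0::real) \<in> test_functions V"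
    by (simp add: test_functions_def Ck_const supp_def)
  from \<mu>[OF this] obtain P0 N0 where 0: "finite_measure P0" "finite_measure N0"
    "sets P0 = sets (restrict_space borel V)" "sets N0 = sets (restrict_space borel V)"
    "\<forall>A\<in>sets (restrict_space borel V). \<mu> A $ q = measure P0 A - measure N0 A"
    unfolding has_signed_integral_def by blast
  define B :: "'n piece \<Rightarrow> (real^'n) set" where "B = (\<lambda>(l, r, G, d). box l r)"
  define \<kappa> where "\<kappa> = (exp (- 8) / 2 :: real) ^ CARD('n)"
  have \<kappa>: "0 < \<kappa>" by (simp add: \<kappa>_def)
  have piece: "\<kappa> * (\<bar>G $ p $ q\<bar> * vol l r) \<le> measure P0 (box l r) + measure N0 (box l r)"
    and box_sets: "box l r \<in> sets (restrict_space borel V)" if P: "(l, r, G, d) \<in> set (F m)" for l r G d m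
  proof -
    have lr: "l $ j < r $ j" for j using sub[OF P] by (auto simp: sub_box_def)
    have "cbox l r \<subseteq> cbox (L m) (U m)" using sub[OF P] by (fastforce simp: sub_box_def mem_box_cart intro: order_trans)
    then have cV: "cbox l r \<subseteq> V" using K(3)[of m] V(3) by blast
    then have bV: "box l r \<subseteq> V" using box_subset_cbox[of l r] by blast
    show bs: "box l r \<in> sets (restrict_space borel V)"
      using bV V(1) by (subst sets_restrict_space_iff) auto
    have "bump l r \<in> test_functions V" by (rule bump_test_function[OF lr cV])
    from \<mu>[OF this] obtain P N where 1: "finite_measure P" "finite_measure N"
      "sets P = sets (restrict_space borel V)" "sets N = sets (restrict_space borel V)"
      "\<forall>A\<in>sets (restrict_space borel V). \<mu> A $ q = measure P A - measure N A"
      "integrable P (bump l r)" "integrable N (bump l r)"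
      "- (LINT x:V|lebesgue. u x $ p * partial q (bump l r) x) = (\<integral>x. bump l r x \<partial>P) - (\<integral>x. bump l r x \<partial>N)"
      unfolding has_signed_integral_def by blast
    have bm: "bump l r \<in> borel \<rightarrow>\<^sub>M borel"
      using Ck_bump[of 0 l r] by (auto intro: borel_measurable_continuous_onI)
    have int: "integrable M (bump l r)" "(\<integral>x. bump l r x \<partial>M) \<le> measure M (box l r)"
      if M: "finite_measure M" "sets M = sets (restrict_space borel V)" for M
    proof -
      have "bump l r \<in> restrict_space borel V \<rightarrow>\<^sub>M borel" using bm by (rule measurable_restrict_space1)
      then have "bump l r \<in> M \<rightarrow>\<^sub>M borel" using M(2) by (simp cong: measurable_cong_sets)
      then show i: "integrable M (bump l r)"
        by (intro finite_measure.integrable_const_bound[OF M(1), of _ 1] AE_I2) (simp_all add: bump_bounds)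
      have bM: "box l r \<in> sets M" using bs M(2) by simp
      have "(\<integral>x. bump l r x \<partial>M) \<le> (\<integral>x. indicator (box l r) x \<partial>M)"
      proof (rule integral_mono[OF i])
        show "integrable M (indicat_real (box l r))"
          using bM finite_measure.emeasure_finite[OF M(1)] by (intro integrable_real_indicator) (auto simp: less_top[symmetric])
        show "bump l r x \<le> indicator (box l r) x" for x
          using bump_bounds[of l r x] bump_zero[OF lr, of x] by (auto simp: indicator_def)
      qed
      also have "\<dots> = measure M (box l r)"
        using sets.sets_into_space[OF bM] by (simp add: Int_absorb2)
      finally show "(\<integral>x. bump l r x \<partial>M) \<le> measure M (box l r)" .
    qed
    have "G $ p $ q * (LBINT x. bump l r x) = (\<integral>x. bump l r x \<partial>P) - (\<integral>x. bump l r x \<partial>N)"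
      using 1(8) piece_integral[OF P V(1) cV] by simp
    also have "\<dots> = (\<integral>x. bump l r x \<partial>P0) - (\<integral>x. bump l r x \<partial>N0)"
      using 0 1 int bump_bounds by (intro signed_integral_unique) auto
    finally have "\<bar>G $ p $ q\<bar> * (LBINT x. bump l r x) = \<bar>(\<integral>x. bump l r x \<partial>P0) - (\<integral>x. bump l r x \<partial>N0)\<bar>"
      using Bochner_Integration.integral_nonneg[of lborel "bump l r"] bump_bounds
      by (metis abs_mult abs_of_nonneg)
    also have "\<dots> \<le> (\<integral>x. bump l r x \<partial>P0) + (\<integral>x. bump l r x \<partial>N0)"
    proof -
      have "0 \<le> (\<integral>x. bump l r x \<partial>P0)" "0 \<le> (\<integral>x. bump l r x \<partial>N0)"
        by (intro Bochner_Integration.integral_nonneg bump_bounds)+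
      then show ?thesis by linarith
    qed
    also have "\<dots> \<le> measure P0 (box l r) + measure N0 (box l r)"
      using int(2)[OF 0(1,3)] int(2)[OF 0(2,4)] by simp
    finally have "\<bar>G $ p $ q\<bar> * (LBINT x. bump l r x) \<le> measure P0 (box l r) + measure N0 (box l r)" .
    moreover have "\<bar>G $ p $ q\<bar> * (\<kappa> * vol l r) \<le> \<bar>G $ p $ q\<bar> * (LBINT x. bump l r x)"
      using bump_integral(2)[OF lr] by (intro mult_left_mono) (auto simp: \<kappa>_def)
    ultimately show "\<kappa> * (\<bar>G $ p $ q\<bar> * vol l r) \<le> measure P0 (box l r) + measure N0 (box l r)"
      by (simp add: mult_ac)
  qed
  have "\<kappa> * real M \<le> measure P0 (space P0) + measure N0 (space N0)" for M
  proof -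
    have "\<kappa> * real M \<le> \<kappa> * gain p q (first M)"
      using gain_first[OF gain] \<kappa> by (intro mult_left_mono) auto
    also have "\<dots> \<le> (\<Sum>P\<leftarrow>first M. measure P0 (B P) + measure N0 (B P))"
    proof -
      have "\<kappa> * gain p q E \<le> (\<Sum>P\<leftarrow>E. measure P0 (B P) + measure N0 (B P))" if "set E \<subseteq> set (first M)" for E
        using that
      proof (induction E)
        case (Cons P E)
        obtain l r G d where Pe: "P = (l, r, G, d)" by (cases P)
        obtain m where "(l, r, G, d) \<in> set (F m)" using Cons.prems by (auto simp: Pe set_first)
        from piece[OF this] show ?case using Cons by (simp add: Pe B_def distrib_left)
      qed simp
      then show ?thesis by simp
    qed
    also have "\<dots> = (\<Sum>P\<leftarrow>first M. measure P0 (B P)) + (\<Sum>P\<leftarrow>first M. measure N0 (B P))"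
      by (rule sum_list_addf)
    also have "\<dots> \<le> measure P0 (space P0) + measure N0 (space N0)"
    proof (intro add_mono disjoint_list_measure_le[OF _ disjoint_first] 0(1,2))
      fix P assume "P \<in> set (first M)"
      moreover obtain l r G d where Pe: "P = (l, r, G, d)" by (cases P)
      ultimately obtain m where m: "(l, r, G, d) \<in> set (F m)" by (auto simp: set_first)
      show "B P \<subseteq> dom_box P" "B P \<subseteq> dom_box P" unfolding B_def Pe prod.case by (rule box_dom)+
      show "B P \<in> sets P0" "B P \<in> sets N0" using box_sets[OF m] 0(3,4) by (simp_all add: B_def Pe)
    qed
    finally show ?thesis .
  qed
  moreover obtain M where "(measure P0 (space P0) + measure N0 (space N0)) / \<kappa> < real M"
    using reals_Archimedean2 by blast
  then have "measure P0 (space P0) + measure N0 (space N0) < \<kappa> * real M"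
    using \<kappa> by (simp add: divide_less_eq mult.commute)
  ultimately show False by (meson not_less)
qed

end

section \<open>Hausdorff measure and conclusion\<close>

lemma ennreal_le_divide:
  assumes "ennreal a \<le> ennreal c * X" "0 < c"
  shows "ennreal (a / c) \<le> X"
proof (cases "0 \<le> a")
  case True
  have "ennreal (a / c) = ennreal (1 / c) * ennreal a"
    using assms(2) True by (simp flip: ennreal_mult)
  also have "\<dots> \<le> ennreal (1 / c) * (ennreal c * X)"
    by (rule mult_left_mono[OF assms(1)]) simp
  also have "\<dots> = X"
    using assms(2) by (simp add: mult.assoc[symmetric] flip: ennreal_mult)
  finally show ?thesis .
next
  case False
  then have "a / c \<le> 0" using assms(2) by (simp add: divide_le_0_iff)
  then show ?thesis by (simp add: ennreal_neg)
qed

text \<open>A cover of parallel faces by sets of diameter at most \<open>h\<close> becomes, after thickening by \<open>h\<close> in the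
  normal direction, a cover of disjoint slabs of known volume.\<close>

lemma hausdorff_faces:
  fixes E :: "(real^'n) set" and t :: "nat \<Rightarrow> real" and p :: 'n
  assumes card: "CARD('n) \<ge> 2" and lu: "\<And>j. l $ j < u $ j" and t: "inj t" and bad: "countable bad"
    and E: "\<And>m y. y $ p = t m \<Longrightarrow> (\<And>j. j \<noteq> p \<Longrightarrow> l $ j \<le> y $ j \<and> y $ j < u $ j \<and> y $ j \<notin> bad) \<Longrightarrow> y \<in> E"
  shows "ennreal (real N * (area p l u * unit_ball_vol (real (CARD('n) - 1)) / (3 * 4 ^ (CARD('n) - 1))))
     \<le> hausdorff_measure (CARD('n) - 1) E"
proof -
  define n where "n = CARD('n) - 1"
  have n: "0 < n" using card by (simp add: n_def)
  define ub where "ub = unit_ball_vol (real n)"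
  have ub: "0 < ub" unfolding ub_def by (rule unit_ball_vol_pos) simp
  \<comment> \<open>\<open>h\<close> is at most the distance of any two of the first
    \<open>N\<close> faces, so that their thickenings by \<open>h\<close> stay disjoint.\<close>
  have "\<exists>h>0. \<forall>m<N. \<forall>m'<N. m \<noteq> m' \<longrightarrow> h \<le> \<bar>t m - t m'\<bar>"
  proof -
    define D where "D = insert 1 ((\<lambda>(m, m'). \<bar>t m - t m'\<bar>) ` {(m, m'). m < N \<and> m' < N \<and> m \<noteq> m'})"
    have "{(m, m'). m < N \<and> m' < N \<and> m \<noteq> m'} \<subseteq> {..<N} \<times> {..<N}" by auto
    then have fin: "finite D" unfolding D_def by (intro finite.insertI finite_imageI) (erule finite_subset, simp)
    have pos: "0 < d" if "d \<in> D" for d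
      using that t by (auto simp: D_def inj_def)
    have "0 < Min D" using fin pos by (subst Min_gr_iff) (auto simp: D_def)
    moreover have "Min D \<le> \<bar>t m - t m'\<bar>" if "m < N" "m' < N" "m \<noteq> m'" for m m'
      using fin that by (intro Min_le) (auto simp: D_def)
    ultimately show ?thesis by blast
  qed
  then obtain h where h: "0 < h" "\<And>m m'. m < N \<Longrightarrow> m' < N \<Longrightarrow> m \<noteq> m' \<Longrightarrow> h \<le> \<bar>t m - t m'\<bar>" by blast
  define H where "H m = hbox (upd l p (t m)) (upd u p (t m + h))" for m
  \<comment> \<open>The points with an excluded coordinate; removing this null set does not change
    the volume.\<close>
  define Z where "Z = (\<Union>c\<in>bad. \<Union>j\<in>UNIV. {x::real^'n. x $ j = c})"
  have Z: "Z \<in> null_sets lborel"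
    unfolding Z_def
    by (intro null_sets_UN'[OF bad] null_sets_UN'[OF countable_finite[OF finite]] null_hyperplane)
  have mH [measurable]: "H m \<in> sets borel" for m by (simp add: H_def)
  have eH: "emeasure lborel (H m) = ennreal (h * area p l u)" for m
    unfolding H_def using lu h by (subst emeasure_hbox) (auto simp: vol_upd less_imp_le mult.commute)
  have a: "0 < area p l u" using lu by (rule area_pos)
  have disjH: "disjoint_family_on H {..<N}"
    unfolding disjoint_family_on_def
  proof (intro ballI impI)
    fix m m' assume m: "m \<in> {..<N}" "m' \<in> {..<N}" "m \<noteq> m'"
    have "h \<le> \<bar>t m - t m'\<bar>" using m h(2) by auto
    moreover have *: "t m \<le> x $ p" "x $ p < t m + h" if "x \<in> H m" for m x
      using that by (auto simp: H_def hbox_def dest!: spec[of _ p])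
    ultimately have "\<not> (x \<in> H m \<and> x \<in> H m')" for x
      using *[of x m] *[of x m'] by linarith
    then show "H m \<inter> H m' = {}" by blast
  qed
  have "emeasure lborel ((\<Union>m<N. H m) - Z) = emeasure lborel (\<Union>m<N. H m)"
    using Z by (intro emeasure_Diff_null_set) auto
  also have "\<dots> = (\<Sum>m<N. emeasure lborel (H m))"
    using disjH by (intro sum_emeasure[symmetric]) auto
  also have "\<dots> = ennreal (real N * (h * area p l u))"
    using h a by (simp add: eH ennreal_of_nat_eq_real_of_nat ennreal_mult'')
  finally have eT: "emeasure lborel ((\<Union>m<N. H m) - Z) = ennreal (real N * (h * area p l u))" .
  have "ennreal (real N * (area p l u * ub / (3 * 4 ^ n))) \<le> hausdorff_content n h E"
    unfolding hausdorff_content_def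
  proof (rule INF_greatest)
    fix C :: "nat \<Rightarrow> (real^'n) set"
    assume "C \<in> {C. E \<subseteq> (\<Union>i. C i) \<and> (\<forall>i. bounded (C i) \<and> diameter (C i) \<le> h)}"
    then have C: "E \<subseteq> (\<Union>i. C i)" "\<And>i. bounded (C i)" "\<And>i. diameter (C i) \<le> h" by auto
    define y where "y i = (SOME y. y \<in> C i)" for i
    have y: "y i \<in> C i" if "C i \<noteq> {}" for i using that unfolding y_def by (auto intro: someI)
    define r where "r i = diameter (C i)" for i
    have r: "0 \<le> r i" "r i \<le> h" for i using diameter_ge_0[OF C(2)] C(3) by (auto simp: r_def)
    \<comment> \<open>\<open>C i\<close> lies within distance \<open>r i\<close> of
      \<open>y i\<close>; the extra \<open>h\<close> in \<open>up\<close> accounts for the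
      thickening in direction \<open>p\<close>.\<close>
    define lo where "lo i = (\<chi> j. y i $ j - r i)" for i
    define up where "up i = (\<chi> j. y i $ j + r i + (if j = p then h else 0))" for i
    define B where "B i = (if C i = {} then {} else cbox (lo i) (up i))" for i
    let ?\<tau> = "\<lambda>i. if C i = {} then 0 else ennreal (ub * (diameter (C i) / 2) ^ n)"
    have "(\<Union>m<N. H m) - Z \<subseteq> (\<Union>i. B i)"
    proof
      fix x assume x: "x \<in> (\<Union>m<N. H m) - Z"
      then obtain m where m: "m < N" "x \<in> H m" by auto
      have xb: "x $ j \<notin> bad" for j using x by (auto simp: Z_def)
      have xp: "t m \<le> x $ p \<and> x $ p < t m + h" using m(2) by (auto simp: H_def hbox_def dest!: spec[of _ p])
      have xj: "l $ j \<le> x $ j \<and> x $ j < u $ j" if "j \<noteq> p" for j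
        using m(2) that by (auto simp: H_def hbox_def dest!: spec[of _ j])
      have "upd x p (t m) \<in> E" using xj xb by (intro E[of _ m]) auto
      then obtain i where i: "upd x p (t m) \<in> C i" using C(1) by blast
      then have ne: "C i \<noteq> {}" by auto
      have "dist (upd x p (t m)) (y i) \<le> r i"
        unfolding r_def by (rule diameter_bounded_bound[OF C(2) i y[OF ne]])
      then have d: "\<bar>upd x p (t m) $ j - y i $ j\<bar> \<le> r i" for j
        using component_le_norm_cart[of "upd x p (t m) - y i" j] by (simp add: dist_norm)
      have "lo i $ j \<le> x $ j \<and> x $ j \<le> up i $ j" for j
        using d[of j] xp by (cases "j = p") (auto simp: lo_def up_def)
      then have "x \<in> B i" using ne by (simp add: B_def mem_box_cart)
      then show "x \<in> (\<Union>i. B i)" by blast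
    qed
    then have "emeasure lborel ((\<Union>m<N. H m) - Z) \<le> emeasure lborel (\<Union>i. B i)"
      by (intro emeasure_mono) (auto simp: B_def)
    also have "\<dots> \<le> (\<Sum>i. emeasure lborel (B i))"
      by (rule emeasure_subadditive_countably) (auto simp: B_def)
    \<comment> \<open>As \<open>r i \<le> h\<close>, the extent in direction \<open>p\<close> is at
      most \<open>3 * h\<close>, and \<open>(2 * r i) ^ n\<close> is \<open>4 ^ n\<close> times
      \<open>(r i / 2) ^ n\<close>. The factor \<open>h\<close> later cancels against the thickness
      of the slabs.\<close>
    also have "\<dots> \<le> (\<Sum>i. ennreal (3 * h * 4 ^ n / ub) * ?\<tau> i)"
    proof (rule suminf_le)
      fix i
      show "emeasure lborel (B i) \<le> ennreal (3 * h * 4 ^ n / ub) * ?\<tau> i"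
      proof (cases "C i = {}")
        case False
        have lu': "lo i $ j \<le> up i $ j" for j using r[of i] h by (auto simp: lo_def up_def)
        have "area p (lo i) (up i) = (\<Prod>j\<in>UNIV - {p}. 2 * r i)"
          unfolding area_def by (intro prod.cong) (auto simp: lo_def up_def)
        also have "\<dots> = (2 * r i) ^ n" by (simp add: n_def card_Diff_singleton)
        finally have "vol (lo i) (up i) = (2 * r i) ^ n * (2 * r i + h)"
          by (simp add: vol_area[of _ _ p] lo_def up_def)
        also have "\<dots> \<le> (2 * r i) ^ n * (3 * h)"
          using r[of i] by (intro mult_left_mono) auto
        also have "\<dots> = (3 * h * 4 ^ n / ub) * (ub * (r i / 2) ^ n)"
        proof -
          have "(4 * (r i / 2)) ^ n = 4 ^ n * (r i / 2) ^ n" by (rule power_mult_distrib)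
          then show ?thesis using ub by simp
        qed
        finally have "ennreal (vol (lo i) (up i)) \<le> ennreal ((3 * h * 4 ^ n / ub) * (ub * (r i / 2) ^ n))"
          by (rule ennreal_leI)
        also have "\<dots> = ennreal (3 * h * 4 ^ n / ub) * ennreal (ub * (r i / 2) ^ n)"
          using h ub r by (intro ennreal_mult) auto
        finally show ?thesis
          using False emeasure_cbox_vol(1)[OF lu'] by (simp add: B_def r_def)
      qed (simp add: B_def)
    qed auto
    also have "\<dots> = ennreal (3 * h * 4 ^ n / ub) * (\<Sum>i. ?\<tau> i)"
      by (rule ennreal_suminf_cmult)
    finally have "ennreal (real N * (h * area p l u)) \<le> ennreal (3 * h * 4 ^ n / ub) * (\<Sum>i. ?\<tau> i)"
      unfolding eT .
    then have "ennreal (real N * (h * area p l u) / (3 * h * 4 ^ n / ub)) \<le> (\<Sum>i. ?\<tau> i)"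
      by (rule ennreal_le_divide) (use h ub in simp)
    also have "real N * (h * area p l u) / (3 * h * 4 ^ n / ub) = real N * (area p l u * ub / (3 * 4 ^ n))"
      using h ub by (simp add: field_simps)
    finally show "ennreal (real N * (area p l u * ub / (3 * 4 ^ n))) \<le> (\<Sum>i. if C i = {} then 0 else ennreal (unit_ball_vol (real n) * (diameter (C i) / 2) ^ n))"
      unfolding ub_def .
  qed
  also have "\<dots> \<le> hausdorff_measure n E"
    unfolding hausdorff_measure_def using h(1) by (intro SUP_upper) auto
  finally show ?thesis by (simp add: ub_def n_def)
qed

text \<open>Every face contributes the same positive amount in \<open>hausdorff_faces\<close>, and
  \<open>N\<close> is arbitrary there.\<close>

lemma hausdorff_infinite:
  fixes E :: "(real^'n) set" and t :: "nat \<Rightarrow> real" and p :: 'n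
  assumes card: "CARD('n) \<ge> 2" and lu: "\<And>j. l $ j < u $ j" and t: "inj t" and bad: "countable bad"
    and E: "\<And>m y. y $ p = t m \<Longrightarrow> (\<And>j. j \<noteq> p \<Longrightarrow> l $ j \<le> y $ j \<and> y $ j < u $ j \<and> y $ j \<notin> bad) \<Longrightarrow> y \<in> E"
  shows "hausdorff_measure (CARD('n) - 1) E = \<infinity>"
proof (rule ccontr)
  define c where "c = area p l u * unit_ball_vol (real (CARD('n) - 1)) / (3 * 4 ^ (CARD('n) - 1))"
  have c: "0 < c" unfolding c_def using area_pos[OF lu] by simp
  assume "hausdorff_measure (CARD('n) - 1) E \<noteq> \<infinity>"
  then obtain R where R: "0 \<le> R" "hausdorff_measure (CARD('n) - 1) E = ennreal R"
    by (metis ennreal_cases infinity_ennreal_def)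
  obtain N :: nat where "R / c < real N" using reals_Archimedean2 by blast
  then have "R < real N * c" using c by (simp add: divide_less_eq)
  moreover have "ennreal (real N * c) \<le> ennreal R"
    using hausdorff_faces[OF card lu t bad E, where N = N] unfolding R(2)[symmetric] c_def .
  ultimately show False using R by simp
qed

text \<open>The start is the map with single slope \<open>c\<close> and \<open>b = 0\<close>. Its
  own boundary jumps and the cost of the staircase are both proportional to \<open>c\<close>, apart
  from the free error \<open>e\<close>, whereas the gain is \<open>k * c / 4\<close> times the
  volume: \<open>c\<close> is taken small first and \<open>k\<close> large afterwards.\<close>

lemma rigid_box:
  fixes l u :: "real^'n"
  assumes pq: "p \<noteq> q" and lu: "\<And>j. l $ j < u $ j" and \<eta>: "0 < \<eta>"
  shows "\<exists>F. (\<forall>P\<in>set F. sub_box l u P) \<and> (\<forall>(l', u', G', d')\<in>set F. rigid p q G') \<and>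
     disjoint_pieces F \<and> (\<forall>x. norm (ev F x) \<le> 1) \<and>
     jump_mass F \<le> ennreal \<eta> \<and> 1 \<le> gain p q F"
proof -
  obtain C where C: "0 \<le> C" "\<And>c. 0 \<le> c \<Longrightarrow> jump_mass [(l, u, c *\<^sub>R munit q p, c *\<^sub>R 0)] \<le> ennreal (c * C)"
    using jump_mass_single[OF lu, of "munit q p" 0] by metis
  have V: "0 < vol l u" using lu by (rule vol_pos)
  define B where "B = \<bar>l $ p\<bar> + \<bar>u $ p\<bar> + 1"
  have B: "1 \<le> B" by (simp add: B_def)
  \<comment> \<open>One summand for each requirement on \<open>c = 1 / D\<close>: the boundary jumps
    of the affine start, the cost of the staircase, and the bound on the values.\<close>
  define D where "D = 4 * (C + 1) / \<eta> + 8 * vol l u / \<eta> + 2 * B"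
  define c where "c = 1 / D"
  have D: "0 < D" "4 * (C + 1) / \<eta> \<le> D" "8 * vol l u / \<eta> \<le> D" "2 * B \<le> D"
    using C V B \<eta> by (auto simp: D_def add_pos_pos)
  have c: "0 < c" "c * C \<le> \<eta> / 4" "2 * c * vol l u \<le> \<eta> / 4" "c * B \<le> 1 / 2"
    using D C \<eta> V B by (auto simp: c_def field_simps)
  define e where "e = min (1 / 2) (\<eta> / (4 * vol l u))"
  have e: "0 < e" "e \<le> 1 / 2" "e * vol l u \<le> \<eta> / 4"
    using \<eta> V by (auto simp: e_def min_def field_simps)
  \<comment> \<open>The number of steps is fixed only after \<open>c\<close>, which is possible
    because the jump bound does not involve \<open>k\<close>.\<close>
  obtain k :: nat where k: "4 / (c * vol l u) < real k" using reals_Archimedean2 by blast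
  obtain F where F: "rigid_approx p q l u (0 *\<^sub>R munit p q + c *\<^sub>R munit q p) 0 e
      ((2 * (0 + c) + e) * vol l u) (real k * (0 + c) / 4 * vol l u) F"
    using staircase[OF pq lu, of 0 c e 0 k] c e by auto
  have "norm (ev F x) \<le> 1" for x
  proof (cases "x \<in> hbox l u")
    case True
    then have "norm (ev F x - axis q (c * x $ p)) \<le> e"
      using F by (auto simp: rigid_approx_def matrix_scaleR_mult axis_scaleR[of q "c * _"] axis_scaleR[of q "_ $ _"])
    moreover have "norm (axis q (c * x $ p)) \<le> 1 / 2"
    proof -
      have "\<bar>x $ p\<bar> \<le> B" using True by (auto simp: hbox_def B_def dest!: spec[of _ p])
      then have "c * \<bar>x $ p\<bar> \<le> c * B" using c by (intro mult_left_mono) auto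
      then have "c * \<bar>x $ p\<bar> \<le> 1 / 2" using c(4) by linarith
      then show ?thesis using c(1) by (simp add: abs_mult)
    qed
    ultimately show ?thesis
      using norm_triangle_ineq[of "ev F x - axis q (c * x $ p)" "axis q (c * x $ p)"] e by simp
  next
    case False
    then have "ev F x = 0" using F by (intro ev_outside[of F l u]) (auto simp: rigid_approx_def)
    then show ?thesis by simp
  qed
  moreover have "jump_mass F \<le> ennreal \<eta>"
  proof -
    let ?G = "0 *\<^sub>R munit p q + c *\<^sub>R munit q p"
    have "jump_mass F \<le> jump_mass (F @ [(l, u, - ?G, - 0)]) + jump_mass [(l, u, c *\<^sub>R munit q p, c *\<^sub>R 0)]"
    proof (rule jump_mass_triangle)
      fix k y
      have "jump F k y = jump (F @ [(l, u, - ?G, - 0)]) k y + jump [(l, u, c *\<^sub>R munit q p, c *\<^sub>R 0)] k y"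
        using piece_jump_uminus[of k y l u ?G 0] by (simp del: piece_jump.simps)
      then show "norm (jump F k y) \<le> norm (jump (F @ [(l, u, - ?G, - 0)]) k y) + norm (jump [(l, u, c *\<^sub>R munit q p, c *\<^sub>R 0)] k y)"
        by (metis norm_triangle_ineq)
    qed
    also have "\<dots> \<le> ennreal ((2 * (0 + c) + e) * vol l u) + ennreal (c * C)"
      using F C(2)[of c] c by (intro add_mono) (auto simp: rigid_approx_def)
    also have "\<dots> = ennreal ((2 * (0 + c) + e) * vol l u + c * C)"
      using c e C V by (intro ennreal_plus[symmetric]) auto
    also have "\<dots> \<le> ennreal \<eta>"
      using c e \<eta> by (intro ennreal_leI) (simp add: distrib_right)
    finally show ?thesis .
  qed
  moreover have "1 \<le> gain p q F"
  proof -
    have "4 < real k * (c * vol l u)" using k c V by (simp add: divide_less_eq)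
    then have "1 \<le> real k * (0 + c) / 4 * vol l u" by simp
    also have "\<dots> \<le> gain p q F" using F by (auto simp: rigid_approx_def)
    finally show ?thesis .
  qed
  ultimately show ?thesis using F unfolding rigid_approx_def by blast
qed

section \<open>Assembly over slabs that accumulate at one face of a box\<close>

theorem theorem3p1:
  fixes \<Omega> :: "(real^'n) set"
  assumes "CARD('n) \<ge> 2"
    and "open \<Omega>" and "\<Omega> \<noteq> {}"
  shows "\<exists>u :: real^'n \<Rightarrow> real^'n.
    u \<in> SBD \<Omega> \<inter> Linfty \<Omega> \<and>
    (\<exists>e. is_e \<Omega> u e \<and> (AE x in lebesgue_on \<Omega>. e x = 0)) \<and>
    hausdorff_measure (CARD('n) - 1) (jump_set \<Omega> u) = \<infinity> \<and>
    \<not> set_integrable lebesgue \<Omega> (approx_gradient u) \<and>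
    u \<notin> GBV \<Omega>"
proof -
  obtain p q :: 'n where pq: "p \<noteq> q"
  proof (rule ccontr)
    assume "\<not> thesis"
    then have "p = undefined" for p :: 'n using that by blast
    then have "(UNIV :: 'n set) = {undefined}" by auto
    then have "CARD('n) = card {undefined :: 'n}" by simp
    then show False using assms(1) by simp
  qed
  obtain x0 where "x0 \<in> \<Omega>" using assms(3) by blast
  then obtain c b where cb: "cbox c b \<subseteq> \<Omega>" "\<forall>i\<in>Basis. c \<bullet> i < b \<bullet> i"
    using open_contains_cbox[OF assms(2)] by metis
  have cb': "c $ j < b $ j" for j
    using cb(2) by (auto simp: Basis_vec_def inner_axis)
  \<comment> \<open>Strictly decreasing to \<open>c $ p\<close> without reaching it, so the slabs
    accumulate only at that face.\<close>
  define s where "s m = c $ p + (b $ p - c $ p) / real (m + 1)" for m :: nat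
  \<comment> \<open>In each slab the part below \<open>mid\<close> in direction \<open>q\<close>
    carries the rigid pieces and the part above it a constant, so that on the upper faces the jumps
    come from the constants alone.\<close>
  define mid where "mid = (c $ q + b $ q) / 2"
  have mid: "c $ q < mid" "mid < b $ q" using cb'[of q] by (auto simp: mid_def)
  have s_less: "s m' < s m" if "m < m'" for m m'
    unfolding s_def using that cb'[of p] by (intro add_strict_left_mono divide_strict_left_mono) auto
  have s_le: "s m' \<le> s m" if "m \<le> m'" for m m'
    using s_less[of m m'] that by (cases "m = m'") auto
  have s_pos: "c $ p < s m" for m using cb'[of p] by (simp add: s_def)
  have s_b: "s m \<le> b $ p" for m using s_le[of 0 m] by (simp add: s_def)
  define L where "L m = upd c p (s (Suc m))" for m
  define U where "U m = upd b p (s m)" for m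
  have LU: "L m $ j < U m $ j" for m j using cb' s_less[of m "Suc m"] by (simp add: L_def U_def)
  define Q where "Q m = upd (U m) q mid" for m
  define R where "R m = upd (L m) q mid" for m
  have qLU: "L m $ q = c $ q" "U m $ q = b $ q" for m using pq by (auto simp: L_def U_def)
  have LQ: "L m $ j < Q m $ j" for m j using LU[of m j] mid by (simp add: Q_def qLU)
  have RU: "R m $ j < U m $ j" for m j using LU[of m j] mid by (simp add: R_def qLU)
  have ex: "\<exists>F. (\<forall>P\<in>set F. sub_box (L m) (Q m) P) \<and> (\<forall>(l', u', G', d')\<in>set F. rigid p q G') \<and>
     disjoint_pieces F \<and> (\<forall>x. norm (ev F x) \<le> 1) \<and>
     jump_mass F \<le> ennreal ((1 / 2) ^ Suc m) \<and> 1 \<le> gain p q F" for m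
    by (rule rigid_box[OF pq LQ]) simp
  then obtain S where S: "\<And>m P. P \<in> set (S m) \<Longrightarrow> sub_box (L m) (Q m) P"
    "\<And>m. \<forall>(l', u', G', d')\<in>set (S m). rigid p q G'"
    "\<And>m. disjoint_pieces (S m)"
    "\<And>m x. norm (ev (S m) x) \<le> 1" "\<And>m. jump_mass (S m) \<le> ennreal ((1 / 2) ^ Suc m)" "\<And>m. 1 \<le> gain p q (S m)"
    by metis
  \<comment> \<open>Half of the jump allowance \<open>(1 / 2) ^ m\<close> goes to the rigid pieces
    and half to the constant, whose height is positive but scaled down accordingly.\<close>
  have "\<exists>a. 0 < a \<and> a \<le> 1 \<and> jump_mass [(R m, U m, 0, a *\<^sub>R axis p ((- 1) ^ m))] \<le> ennreal ((1 / 2) ^ Suc m)" for m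
  proof -
    obtain C where C: "0 \<le> C" "\<And>a. 0 \<le> a \<Longrightarrow> jump_mass [(R m, U m, a *\<^sub>R 0, a *\<^sub>R axis p ((- 1) ^ m))] \<le> ennreal (a * C)"
      using jump_mass_single[OF RU[of m], of 0 "axis p ((- 1) ^ m)"] by metis
    define a where "a = (1 / 2) ^ Suc m / (C + 1)"
    have a: "0 < a" using C(1) by (simp add: a_def)
    have "(1 / 2 :: real) ^ Suc m \<le> 1" by (rule power_le_one) auto
    then have a1: "a \<le> 1" using C(1) unfolding a_def by (subst divide_le_eq_1_pos) linarith+
    have "a * C \<le> a * (C + 1)" using a by (intro mult_left_mono) auto
    moreover have z: "z / (C + 1) * (C + 1) = z" for z using C(1) by simp
    have "a * (C + 1) = (1 / 2) ^ Suc m" unfolding a_def by (rule z)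
    ultimately have "a * C \<le> (1 / 2) ^ Suc m" by (simp only:)
    then have "jump_mass [(R m, U m, 0, a *\<^sub>R axis p ((- 1) ^ m))] \<le> ennreal ((1 / 2) ^ Suc m)"
      using C(2)[of a] a by (auto intro: order_trans ennreal_leI)
    then show ?thesis using a a1 by blast
  qed
  then obtain a where a: "\<And>m. 0 < a m" "\<And>m. a m \<le> 1"
    "\<And>m. jump_mass [(R m, U m, 0, a m *\<^sub>R axis p ((- 1) ^ m))] \<le> ennreal ((1 / 2) ^ Suc m)"
    by metis
  define T where "T m = (R m, U m, 0 :: real^'n^'n, a m *\<^sub>R axis p ((- 1) ^ m :: real))" for m
  define F where "F m = S m @ [T m]" for m
  have split: "hbox (L m) (Q m) = {x \<in> hbox (L m) (U m). x $ q < mid}"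
    "hbox (R m) (U m) = {x \<in> hbox (L m) (U m). mid \<le> x $ q}" for m
    unfolding Q_def R_def using mid by (intro hbox_split; simp add: qLU)+
  have xp: "s (Suc m) \<le> x $ p \<and> x $ p < s m" if "x \<in> hbox (L m) (U m)" for x m
    using that by (auto simp: hbox_def L_def U_def dest!: spec[of _ p])
  have yp: "s (Suc m) \<le> x $ p \<and> x $ p \<le> s m" if "x \<in> cbox (L m) (U m)" for x m
    using that by (auto simp: mem_box_cart L_def U_def dest!: spec[of _ p])
  interpret piece_seq F L U p q \<Omega> "cbox c b"
  proof
    show "sub_box (L m) (U m) P" if P: "P \<in> set (F m)" for P m
    proof -
      consider "P \<in> set (S m)" | "P = T m" using P by (auto simp: F_def)
      then show ?thesis
      proof cases
        case 1
        show ?thesis by (rule sub_box_trans[OF S(1)[OF 1]]) (use mid pq in \<open>auto simp: Q_def qLU\<close>)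
      next
        case 2
        have "L m $ j \<le> R m $ j" for j using mid by (auto simp: R_def qLU)
        then show ?thesis using RU by (auto simp: 2 T_def sub_box_def)
      qed
    qed
    show "rigid p q G" if P: "(l, u, G, d) \<in> set (F m)" for l u G d m
    proof -
      consider "(l, u, G, d) \<in> set (S m)" | "G = 0" using P by (auto simp: F_def T_def)
      then show ?thesis
      proof cases
        case 2
        then show ?thesis unfolding rigid_def by (intro exI[of _ 0]) simp
      qed (use S(2) in fastforce)
    qed
    show "disjoint_pieces (F m)" for m
    proof -
      have "dom_box P \<inter> dom_box (T m) = {}" if "P \<in> set (S m)" for P
        using sub_box_dom[OF S(1)[OF that]] by (auto simp: T_def split)
      then show ?thesis using S(3) by (simp add: F_def sorted_wrt_append)
    qed
    show "hbox (L m) (U m) \<inter> hbox (L m') (U m') = {}" if "m \<noteq> m'" for m m'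
    proof -
      have "m < m' \<or> m' < m" using that by linarith
      then have "s m' \<le> s (Suc m) \<or> s m \<le> s (Suc m')" using s_le by auto
      then have "\<not> (x \<in> hbox (L m) (U m) \<and> x \<in> hbox (L m') (U m'))" for x
        using xp[of x m] xp[of x m'] by linarith
      then show ?thesis by blast
    qed
    show "\<exists>\<delta>>0. finite {m'. cbox (L m') (U m') \<inter> ball y \<delta> \<noteq> {}}" if y: "y \<in> cbox (L m) (U m)" for y m
    proof -
      \<comment> \<open>Half the distance to the accumulation face: a ball of this radius is met by
        finitely many slabs only.\<close>
      define \<delta> where "\<delta> = (y $ p - c $ p) / 2"
      have \<delta>: "0 < \<delta>" using yp[OF y] s_pos[of "Suc m"] by (simp add: \<delta>_def)
      obtain N :: nat where N: "(b $ p - c $ p) / \<delta> < real N" using reals_Archimedean2 by blast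
      have "m' \<le> N" if m': "cbox (L m') (U m') \<inter> ball y \<delta> \<noteq> {}" for m'
      proof -
        obtain x where x: "x \<in> cbox (L m') (U m')" "dist y x < \<delta>" using m' by auto
        have "\<bar>y $ p - x $ p\<bar> < \<delta>"
          using x(2) component_le_norm_cart[of "y - x" p] by (simp add: dist_norm)
        moreover have "y $ p = c $ p + 2 * \<delta>" by (simp add: \<delta>_def field_simps)
        ultimately have "c $ p + \<delta> < s m'" using yp[OF x(1)] by linarith
        then have "\<delta> * real (m' + 1) < b $ p - c $ p" by (simp add: s_def field_simps)
        moreover have "b $ p - c $ p < \<delta> * real N" using N \<delta> by (simp add: divide_less_eq mult.commute)
        ultimately have "\<delta> * real (m' + 1) < \<delta> * real N" by linarith
        then show ?thesis using \<delta> by simp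
      qed
      then have "finite {m'. cbox (L m') (U m') \<inter> ball y \<delta> \<noteq> {}}"
        by (intro finite_subset[OF _ finite_atMost[of N]]) auto
      then show ?thesis using \<delta> by blast
    qed
    show "jump_mass (F m) \<le> ennreal ((1 / 2) ^ m)" for m
    proof -
      have "jump_mass (F m) \<le> jump_mass (S m) + jump_mass [T m]"
        by (rule jump_mass_triangle) (simp add: F_def norm_triangle_ineq)
      also have "\<dots> \<le> ennreal ((1 / 2) ^ Suc m) + ennreal ((1 / 2) ^ Suc m)"
        unfolding T_def by (intro add_mono S a)
      also have "\<dots> = ennreal ((1 / 2) ^ m)" by (simp flip: ennreal_plus)
      finally show ?thesis .
    qed
    show "norm (ev (F m) x) \<le> 1" for m x
    proof (cases "x \<in> hbox (R m) (U m)")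
      case True
      then have "x \<notin> hbox (L m) (Q m)" by (auto simp: split)
      then have "ev (S m) x = 0" using S(1) by (intro ev_outside) auto
      then show ?thesis using True a[of m] by (simp add: F_def T_def)
    next
      case False
      then show ?thesis using S(4)[of m x] by (simp add: F_def T_def)
    qed
    show "cbox (L m) (U m) \<subseteq> cbox c b" for m
    proof -
      have "c $ j \<le> L m $ j" "U m $ j \<le> b $ j" for j
        using s_pos[of "Suc m"] s_b[of m] by (auto simp: L_def U_def)
      then show ?thesis by (fastforce simp: mem_box_cart intro: order_trans)
    qed
  qed (use assms(2) cb(1) in auto)
  have gain: "1 \<le> gain p q (F m)" for m
  proof -
    have "0 < vol (R m) (U m)" using RU by (rule vol_pos)
    then show ?thesis using S(6)[of m] by (simp add: F_def T_def)
  qed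
  have "hausdorff_measure (CARD('n) - 1) (jump_set \<Omega> u) = \<infinity>"
  \<comment> \<open>The faces are those shared by slab \<open>m\<close> and slab
    \<open>Suc m\<close>, restricted to the upper part; the excluded coordinates are those of all
    faces of pieces, so that the remaining points are in general position.\<close>
  proof (rule hausdorff_infinite[OF assms(1), where p = p and t = "\<lambda>m. s (Suc m)"])
    show "upd c q mid $ j < b $ j" for j using cb' mid by simp
    show "inj (\<lambda>m. s (Suc m))"
      by (rule injI) (metis Suc_inject linorder_less_linear order_less_irrefl s_less)
    show "countable (snd ` I)" using countable_I by blast
    fix m y assume ym: "y $ p = s (Suc m)"
      and y: "\<And>j. j \<noteq> p \<Longrightarrow> upd c q mid $ j \<le> y $ j \<and> y $ j < b $ j \<and> y $ j \<notin> snd ` I"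
    have yq: "mid \<le> y $ q" using y[of q] pq by auto
    have jS: "jump (S m') p y = 0" for m'
    proof (rule ccontr)
      assume "jump (S m') p y \<noteq> 0"
      then obtain P where P: "P \<in> set (S m')" "piece_jump p y P \<noteq> 0"
        using sum_list_nonzero unfolding jump_def by blast
      obtain l r G d where Pe: "P = (l, r, G, d)" by (cases P)
      have "side p l r y" using P(2) by (auto simp: Pe)
      then have "y $ q < r $ q" using pq by (auto simp: side_def)
      also have "r $ q \<le> mid" using S(1)[OF P(1)] by (auto simp: Pe sub_box_def Q_def dest!: spec[of _ q])
      finally show False using yq by simp
    qed
    have sd: "side p (R m') (U m') y" for m'
      unfolding side_def
    proof (intro allI impI)
      fix j assume "j \<noteq> p"
      from y[OF this] this show "R m' $ j \<le> y $ j \<and> y $ j < U m' $ j"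
        by (cases "j = q") (simp_all add: R_def U_def L_def)
    qed
    \<comment> \<open>\<open>y\<close> is on the lower face of slab \<open>m\<close> and on the
      upper face of slab \<open>Suc m\<close>. An upper face enters with a minus sign, which the
      alternation turns into a plus, so the two heights add and the total jump is nonzero.\<close>
    have jF: "jump (F m') p y = (if m' = m then a m *\<^sub>R axis p ((- 1) ^ m) else
        if m' = Suc m then a (Suc m) *\<^sub>R axis p ((- 1) ^ m) else 0)" for m'
    proof -
      have 1: "R m' $ p = s (Suc m')" "U m' $ p = s m'" using pq by (auto simp: R_def L_def U_def)
      have inj: "s i = s j \<longleftrightarrow> i = j" for i j using s_less[of i j] s_less[of j i] by (cases i j rule: linorder_cases) auto
      show ?thesis
        by (simp add: F_def jS T_def sd ym 1 inj) (auto simp: vec_eq_iff axis_def)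
    qed
    have "total_jump p y = (\<Sum>m'\<in>{m, Suc m}. jump (F m') p y)"
      unfolding total_jump_def by (rule suminf_finite) (auto simp: jF)
    also have "\<dots> = (a m + a (Suc m)) *\<^sub>R axis p ((- 1) ^ m)"
      by (simp add: jF scaleR_add_left)
    also have "\<dots> \<noteq> 0"
      using a(1)[of m] a(1)[of "Suc m"] by (simp add: axis_eq_0_iff)
    finally show "y \<in> jump_set \<Omega> u"
      by (rule jump_set_generic[rotated]) (use y in force)
  qed
  then show ?thesis
    using u_SBD u_Linfty is_e_zero gradient_not_integrable[OF gain] not_GBV[OF gain] by auto
qed

end
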